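(* Assume conditions (A), ($\mathfrak B$), ($\mathfrak C$), ($\mathfrak D$) of the context hold, and further that $$8K\tilde\rho(A)\omega\alpha^{-1}<1,\quad 8K\tilde\rho(B)\omega\alpha^{-1}<1,\quad 16K\tilde\rho(A)\lambda\alpha^{-1}<1,\quad 16K\tilde\rho(B)\lambda\alpha^{-1}<1,$$ $$\alpha_0=\alpha-2\omega\tilde\rho(A)e^{\alpha\theta}>0,\qquad F(\ell,\theta)(\beta_0+\ell)\theta=\upsilon<1,$$ where $F(\ell,\theta)=\dfrac{e^{(\beta+\ell)\theta}-1}{(\beta+\ell)\theta}$ and $\tilde\rho(\cdot)=\max(\rho(\cdot)\rho_0(\cdot),\rho(\cdot)e^{\alpha\theta})$. Then the system $$\begin{cases}x'(t)=A(t)x(t)+A_0(t)x(\gamma(t))+f(t,x(t),x(\gamma(t)))+\phi(t,y(t),y(\gamma(t))),\\ y'(t)=B(t)y(t)+B_0(t)y(\gamma(t))+g(t,x(t),x(\gamma(t)))+\psi(t,y(t),y(\gamma(t)))\end{cases}$$ is topologically conjugated to the linear system $$\begin{cases}x'(t)=A(t)x(t)+A_0(t)x(\gamma(t)),\\ y'(t)=B(t)y(t)+B_0(t)y(\gamma(t)).\end{cases}$$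
   Context: $|\cdot|$ denotes a vector norm or the corresponding matrix norm. $n_1+n_2=n$; $A,A_0$ are $n_1\times n_1$ and $B,B_0$ are $n_2\times n_2$ matrix functions of $t\in\mathbb{R}$; $f:\mathbb{R}\times\mathbb{R}^{n_1}\times\mathbb{R}^{n_1}\to\mathbb{R}^{n_1}$, $g:\mathbb{R}\times\mathbb{R}^{n_1}\times\mathbb{R}^{n_1}\to\mathbb{R}^{n_2}$, $\phi:\mathbb{R}\times\mathbb{R}^{n_2}\times\mathbb{R}^{n_2}\to\mathbb{R}^{n_1}$, $\psi:\mathbb{R}\times\mathbb{R}^{n_2}\times\mathbb{R}^{n_2}\to\mathbb{R}^{n_2}$; coefficients and nonlinear terms are locally integrable in $t$. Condition (A): there are real sequences $\{t_i\}_{i\in\mathbb{Z}}$, $\{\zeta_i\}_{i\in\mathbb{Z}}$ with $t_i<t_{i+1}$, $t_i\le\zeta_i\le t_{i+1}$; $t_i\to\pm\infty$ as $i\to\pm\infty$; $\gamma(t)=\zeta_i$ for $t\in[t_i,t_{i+1})$; and $\theta>0$ with $t_{i+1}-t_i\le\theta$ for all $i$. Condition ($\mathfrak B$): there are constants $\beta,\beta_0,\delta,\lambda,\omega>0$ such that $\sup_t|A(t)|\le\beta$, $\sup_t|B(t)|\le\beta$, $\sup_t|A_0(t)|\le\beta_0$, $\sup_t|B_0(t)|\le\beta_0$; for all $t$, $x,\bar x\in\mathbb{R}^{n_1}$, $y,\bar y\in\mathbb{R}^{n_2}$: $|f(t,x,\bar x)|\le\lambda(|x|+|\bar x|)$,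 $|g(t,x,\bar x)|\le\lambda(|x|+|\bar x|)$, $|\phi(t,y,\bar y)|\le\delta$, $|\psi(t,y,\bar y)|\le\delta$; and each of $k=f,g,\phi,\psi$ satisfies $|k(t,u_1,v_1)-k(t,u_2,v_2)|\le\omega(|u_1-u_2|+|v_1-v_2|)$ for all arguments in its domain. The constant $\ell>0$ is a Lipschitz constant of the whole nonlinear term $h(t,z,\bar z)=(f(t,x,\bar x)+\phi(t,y,\bar y),\,g(t,x,\bar x)+\psi(t,y,\bar y))$, $z=(x,y)$, $\bar z=(\bar x,\bar y)$, i.e. $|h(t,z,\bar z)-h(t,\hat z,\tilde z)|\le\ell(|z-\hat z|+|\bar z-\tilde z|)$. Condition ($\mathfrak C$): with $\rho_i^+(Q)=\exp(\int_{t_i}^{\zeta_i}|Q(s)|ds)$, $\rho_i^-(Q)=\exp(\int_{\zeta_i}^{t_{i+1}}|Q(s)|ds)$, there are $0<\nu^+<1$, $0<\nu^-<1$ with $\sup_i\rho_i^\pm(A)\ln\rho_i^\pm(A_0)\le\nu^\pm$ and $\sup_i\rho_i^\pm(B)\ln\rho_i^\pm(B_0)\le\nu^\pm$. For $Q=A,B$ put $\rho(Q)=\sup_i\rho_i^+(Q)\rho_i^-(Q)$ (finite, $\ge1$) and $\rho_0(Q)=\rho(Q)^2\frac{1+\nu^-}{1-\nu^+}$. Transition matrices: $Z_1(t,\tau)$ (resp. $Z_2(t,\tau)$) is the transition matrix of $x'=A(t)x+A_0(t)x(\gamma(t))$ (resp. $y'=B(t)y+B_0(t)y(\gamma(t))$):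 $t\mapsto Z_k(t,\tau)\xi$ is the solution on $\mathbb{R}$ with value $\xi$ at $\tau$ (well defined and invertible under ($\mathfrak C$)). Condition ($\mathfrak D$): there are $K\ge1$, $\alpha>0$ with $|Z_1(t,s)|\le e^{-\alpha(t-s)}$ for $t\ge s$ and $|Z_2(t,s)|\le Ke^{\alpha(t-s)}$ for $s>t$. Solution: a continuous function on $\mathbb{R}$, differentiable except possibly at the $t_i$, where one-sided derivatives exist, satisfying the equation on each $(t_i,t_{i+1})$, and with the right derivative at each $t_i$. Topological conjugacy of systems (I) and (II) on $\mathbb{R}^n$: there is a continuous $H:\mathbb{R}\times\mathbb{R}^n\to\mathbb{R}^n$ such that (i) for each $t$, $H(t,\cdot)$ is a homeomorphism of $\mathbb{R}^n$; (ii) $H(t,z)\to\infty$ as $z\to\infty$ uniformly in $t$; (iii) if $z(t)$ solves (I) then $H(t,z(t))$ solves (II); and the inverse $L(t,\cdot)=H(t,\cdot)^{-1}$ has the same properties (i)–(iii) with the roles of (I) and (II) exchanged.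
   Formalization: Solutions are taken in integrated (Carathéodory) form, since with locally integrable data pointwise differentiable solutions may not exist and the claim then fails; the norm on R^n is taken to extend those on the two blocks and to be monotone in |x|, |y|. *)

theory Defs
  imports "HOL-Analysis.Analysis"
begin

section \<open>Vector norms and induced matrix norms\<close>

definition vector_norm :: "('a::real_vector \<Rightarrow> real) \<Rightarrow> bool" where
  "vector_norm N \<longleftrightarrow>
     (\<forall>x. 0 \<le> N x) \<and> (\<forall>x. N x = 0 \<longleftrightarrow> x = 0) \<and>
     (\<forall>c x. N (c *\<^sub>R x) = \<bar>c\<bar> * N x) \<and> (\<forall>x y. N (x + y) \<le> N x + N y)"

definition matrix_norm :: "(real^'n \<Rightarrow> real) \<Rightarrow> real^'n^'n \<Rightarrow> real" where
  "matrix_norm N M = (SUP x\<in>{x. N x \<le> 1}. N (M *v x))"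

text \<open>
  The state space of dimension \<open>n\<^sub>1 + n\<^sub>2\<close> is \<^typ>\<open>(real^'n) \<times> (real^'m)\<close>. One symbol is used
  for the norm on all three spaces: \<open>N\<close> extends \<open>N\<^sub>1\<close> and \<open>N\<^sub>2\<close> and is monotone in the norms of
  the two blocks, so that the matrix norm of \<open>diag(P, Q)\<close> is the maximum of those of \<open>P\<close> and \<open>Q\<close>.
  Every \<open>p\<close>-norm, \<open>1 \<le> p \<le> \<infinity>\<close>, is of this kind.
\<close>

definition product_vector_norm ::
    "('a::real_vector \<Rightarrow> real) \<Rightarrow> ('b::real_vector \<Rightarrow> real) \<Rightarrow> ('a \<times> 'b \<Rightarrow> real) \<Rightarrow> bool" where
  "product_vector_norm N\<^sub>1 N\<^sub>2 N \<longleftrightarrow>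
     vector_norm N\<^sub>1 \<and> vector_norm N\<^sub>2 \<and> vector_norm N \<and>
     (\<forall>x. N (x, 0) = N\<^sub>1 x) \<and> (\<forall>y. N (0, y) = N\<^sub>2 y) \<and>
     (\<forall>x x' y y'. N\<^sub>1 x \<le> N\<^sub>1 x' \<longrightarrow> N\<^sub>2 y \<le> N\<^sub>2 y' \<longrightarrow> N (x, y) \<le> N (x', y'))"

section \<open>Piecewise constant argument\<close>

definition piecewise_constant_argument ::
    "(int \<Rightarrow> real) \<Rightarrow> (int \<Rightarrow> real) \<Rightarrow> (real \<Rightarrow> real) \<Rightarrow> real \<Rightarrow> bool" where
  "piecewise_constant_argument T \<zeta> \<gamma> \<theta> \<longleftrightarrow>
     (\<forall>i. T i < T (i + 1) \<and> T i \<le> \<zeta> i \<and> \<zeta> i \<le> T (i + 1)) \<and>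
     filterlim T at_top at_top \<and> filterlim T at_bot at_bot \<and>
     (\<forall>i. \<forall>t\<in>{T i..<T (i + 1)}. \<gamma> t = \<zeta> i) \<and>
     0 < \<theta> \<and> (\<forall>i. T (i + 1) - T i \<le> \<theta>)"

text \<open>
  A solution of \<open>z'(t) = F(t, z(t), z(\<gamma>(t)))\<close>. As the data are only locally integrable in \<open>t\<close>, the
  equation on each interval \<open>[t\<^sub>i, t\<^sub>i\<^sub>+\<^sub>1]\<close> is understood in the sense of Caratheodory, that is,
  in integrated form: a merely measurable right-hand side need not be a derivative at every point.
  The pointwise notion is \<open>classical_depca_solution\<close>; it is a special case
  (\<open>classical_imp_depca_solution\<close>), and the two notions agree as soon as the right-hand side along
  \<open>z\<close> is piecewise continuous with left limits at the \<open>t\<^sub>i\<close> (\<open>depca_solution_iff_classical\<close>).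
\<close>

definition depca_solution ::
    "(int \<Rightarrow> real) \<Rightarrow> (real \<Rightarrow> real) \<Rightarrow> (real \<Rightarrow> 'a \<Rightarrow> 'a \<Rightarrow> 'a::euclidean_space) \<Rightarrow> (real \<Rightarrow> 'a) \<Rightarrow> bool" where
  "depca_solution T \<gamma> F z \<longleftrightarrow>
     continuous_on UNIV z \<and>
     (\<forall>i. \<forall>t\<in>{T i..T (i + 1)}.
        ((\<lambda>s. F s (z s) (z (\<gamma> s))) has_integral (z t - z (T i))) {T i..t})"

definition classical_depca_solution ::
    "(int \<Rightarrow> real) \<Rightarrow> (real \<Rightarrow> real) \<Rightarrow> (real \<Rightarrow> 'a \<Rightarrow> 'a \<Rightarrow> 'a::euclidean_space) \<Rightarrow> (real \<Rightarrow> 'a) \<Rightarrow> bool" where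
  "classical_depca_solution T \<gamma> F z \<longleftrightarrow>
     continuous_on UNIV z \<and>
     (\<forall>i. \<forall>t\<in>{T i<..<T (i + 1)}. (z has_vector_derivative F t (z t) (z (\<gamma> t))) (at t)) \<and>
     (\<forall>i. (z has_vector_derivative F (T i) (z (T i)) (z (\<gamma> (T i)))) (at_right (T i))) \<and>
     (\<forall>i. \<exists>d. (z has_vector_derivative d) (at_left (T i)))"

lemma classical_imp_depca_solution:
  assumes "classical_depca_solution T \<gamma> F z"
  shows "depca_solution T \<gamma> F z"
  unfolding depca_solution_def
proof (intro conjI allI ballI)
  show "continuous_on UNIV z"
    using assms by (simp add: classical_depca_solution_def)
  fix i t assume t: "t \<in> {T i..T (i + 1)}"
  show "((\<lambda>s. F s (z s) (z (\<gamma> s))) has_integral (z t - z (T i))) {T i..t}"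
  proof (rule fundamental_theorem_of_calculus_interior)
    show "T i \<le> t" using t by simp
    show "continuous_on {T i..t} z"
      using assms continuous_on_subset unfolding classical_depca_solution_def by blast
    show "(z has_vector_derivative F s (z s) (z (\<gamma> s))) (at s)" if "s \<in> {T i<..<t}" for s
    proof -
      have "s \<in> {T i<..<T (i + 1)}" using t that by auto
      then show ?thesis using assms unfolding classical_depca_solution_def by blast
    qed
  qed
qed

lemma depca_solution_iff_classical:
  assumes mono: "\<And>i. T i < T (i + 1)"
    and cont: "\<And>i. continuous_on {T i..<T (i + 1)} (\<lambda>s. F s (z s) (z (\<gamma> s)))"
    and left: "\<And>i. \<exists>l. ((\<lambda>s. F s (z s) (z (\<gamma> s))) \<longlongrightarrow> l) (at_left (T i))"
  shows "depca_solution T \<gamma> F z \<longleftrightarrow> classical_depca_solution T \<gamma> F z"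
proof
  assume sol: "depca_solution T \<gamma> F z"
  have *: "\<exists>k. (\<forall>s\<in>{T i..<T (i + 1)}. k s = F s (z s) (z (\<gamma> s))) \<and>
      (\<forall>t\<in>{T i..T (i + 1)}. (z has_vector_derivative k t) (at t within {T i..T (i + 1)}))" for i
  proof -
    define G where "G = (\<lambda>s. F s (z s) (z (\<gamma> s)))"
    obtain l where l: "(G \<longlongrightarrow> l) (at_left (T (i + 1)))"
      using left[of "i + 1"] by (auto simp: G_def)
    define k where "k = (\<lambda>s. if s = T (i + 1) then l else G s)"
    have contk: "continuous_on {T i..T (i + 1)} k"
      unfolding continuous_on_def
    proof
      fix x assume x: "x \<in> {T i..T (i + 1)}"
      show "(k \<longlongrightarrow> k x) (at x within {T i..T (i + 1)})"
      proof (cases "x = T (i + 1)")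
        case True
        have "(k \<longlongrightarrow> l) (at_left (T (i + 1)))"
          by (rule Lim_transform_eventually[OF l]) (auto simp: k_def eventually_at_filter)
        then have "(k \<longlongrightarrow> l) (at (T (i + 1)) within {T i..T (i + 1)})"
          using mono[of i] by (simp add: at_within_Icc_at_left)
        then show ?thesis using True by (simp add: k_def)
      next
        case False
        have "(G \<longlongrightarrow> G x) (at x within {T i..<T (i + 1)})"
          using cont[of i] x False by (auto simp: continuous_on_def G_def)
        moreover have "at x within {T i..<T (i + 1)} = at x within {T i..T (i + 1)}"
          by (rule at_within_nhd[of _ "{..<T (i + 1)}"]) (use x False in auto)
        ultimately have "(G \<longlongrightarrow> G x) (at x within {T i..T (i + 1)})" by simp
        moreover have "eventually (\<lambda>s. G s = k s) (at x within {T i..T (i + 1)})"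
          unfolding eventually_at_topological
          by (rule exI[of _ "{..<T (i + 1)}"]) (use x False in \<open>auto simp: k_def\<close>)
        ultimately show ?thesis
          using Lim_transform_eventually False by (fastforce simp: k_def)
      qed
    qed
    have int: "integral {T i..t} k = z t - z (T i)" if t: "t \<in> {T i..T (i + 1)}" for t
    proof (rule integral_unique, rule has_integral_spike_finite)
      show "finite {T (i + 1)}" by simp
      show "(G has_integral z t - z (T i)) {T i..t}"
        using sol t by (auto simp: depca_solution_def G_def)
    qed (auto simp: k_def)
    have "(z has_vector_derivative k t) (at t within {T i..T (i + 1)})"
      if t: "t \<in> {T i..T (i + 1)}" for t
    proof (rule has_vector_derivative_transform[OF t])
      show "((\<lambda>u. z (T i) + integral {T i..u} k) has_vector_derivative k t)
              (at t within {T i..T (i + 1)})"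
        using has_vector_derivative_add[OF has_vector_derivative_const
            integral_has_vector_derivative[OF contk t]] by simp
    qed (simp add: int)
    then show ?thesis by (auto simp: k_def G_def intro!: exI[of _ k])
  qed
  show "classical_depca_solution T \<gamma> F z"
    unfolding classical_depca_solution_def
  proof (intro conjI allI ballI)
    show "continuous_on UNIV z" using sol by (simp add: depca_solution_def)
  next
    fix i t assume t: "t \<in> {T i<..<T (i + 1)}"
    have "(z has_vector_derivative F t (z t) (z (\<gamma> t))) (at t within {T i..T (i + 1)})"
      using *[of i] t by (metis atLeastAtMost_iff atLeastLessThan_iff greaterThanLessThan_iff less_imp_le)
    then show "(z has_vector_derivative F t (z t) (z (\<gamma> t))) (at t)"
      using t by (simp add: at_within_Icc_at)
  next
    fix i
    have "(z has_vector_derivative F (T i) (z (T i)) (z (\<gamma> (T i))))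
        (at (T i) within {T i..T (i + 1)})"
      using *[of i] mono[of i]
      by (metis atLeastAtMost_iff atLeastLessThan_iff less_imp_le order_refl)
    then show "(z has_vector_derivative F (T i) (z (T i)) (z (\<gamma> (T i)))) (at_right (T i))"
      using mono[of i] by (simp add: at_within_Icc_at_right)
  next
    fix i
    obtain d where "(z has_vector_derivative d) (at (T i) within {T (i - 1)..T i})"
      using *[of "i - 1"] mono[of "i - 1"] by force
    then show "\<exists>d. (z has_vector_derivative d) (at_left (T i))"
      using mono[of "i - 1"] by (auto simp: at_within_Icc_at_left)
  qed
qed (rule classical_imp_depca_solution)

definition transition_matrix ::
    "(int \<Rightarrow> real) \<Rightarrow> (real \<Rightarrow> real) \<Rightarrow> (real \<Rightarrow> real^'n^'n) \<Rightarrow> (real \<Rightarrow> real^'n^'n) \<Rightarrow>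
     (real \<Rightarrow> real \<Rightarrow> real^'n^'n) \<Rightarrow> bool" where
  "transition_matrix T \<gamma> A A\<^sub>0 Z \<longleftrightarrow>
     (\<forall>\<tau> \<xi>. depca_solution T \<gamma> (\<lambda>t x xb. A t *v x + A\<^sub>0 t *v xb) (\<lambda>t. Z t \<tau> *v \<xi>) \<and> Z \<tau> \<tau> *v \<xi> = \<xi>)"

section \<open>The two systems\<close>

definition linear_field ::
    "(real \<Rightarrow> real^'n^'n) \<Rightarrow> (real \<Rightarrow> real^'n^'n) \<Rightarrow> (real \<Rightarrow> real^'m^'m) \<Rightarrow> (real \<Rightarrow> real^'m^'m) \<Rightarrow>
     real \<Rightarrow> (real^'n) \<times> (real^'m) \<Rightarrow> (real^'n) \<times> (real^'m) \<Rightarrow> (real^'n) \<times> (real^'m)" where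
  "linear_field A A\<^sub>0 B B\<^sub>0 t = (\<lambda>(x, y) (xb, yb).
     (A t *v x + A\<^sub>0 t *v xb, B t *v y + B\<^sub>0 t *v yb))"

definition nonlinear_term ::
    "(real \<Rightarrow> 'a \<Rightarrow> 'a \<Rightarrow> 'a) \<Rightarrow> (real \<Rightarrow> 'a \<Rightarrow> 'a \<Rightarrow> 'b) \<Rightarrow>
     (real \<Rightarrow> 'b \<Rightarrow> 'b \<Rightarrow> 'a) \<Rightarrow> (real \<Rightarrow> 'b \<Rightarrow> 'b \<Rightarrow> 'b) \<Rightarrow>
     real \<Rightarrow> 'a \<times> 'b \<Rightarrow> 'a \<times> 'b \<Rightarrow> 'a::plus \<times> 'b::plus" where
  "nonlinear_term f g \<phi> \<psi> t = (\<lambda>(x, y) (xb, yb).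
     (f t x xb + \<phi> t y yb, g t x xb + \<psi> t y yb))"

section \<open>Constants\<close>

definition rho_plus ::
    "(real^'n \<Rightarrow> real) \<Rightarrow> (int \<Rightarrow> real) \<Rightarrow> (int \<Rightarrow> real) \<Rightarrow> (real \<Rightarrow> real^'n^'n) \<Rightarrow> int \<Rightarrow> real" where
  "rho_plus N T \<zeta> Q i = exp (integral {T i..\<zeta> i} (\<lambda>s. matrix_norm N (Q s)))"

definition rho_minus ::
    "(real^'n \<Rightarrow> real) \<Rightarrow> (int \<Rightarrow> real) \<Rightarrow> (int \<Rightarrow> real) \<Rightarrow> (real \<Rightarrow> real^'n^'n) \<Rightarrow> int \<Rightarrow> real" where
  "rho_minus N T \<zeta> Q i = exp (integral {\<zeta> i..T (i + 1)} (\<lambda>s. matrix_norm N (Q s)))"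

text \<open>
  The supremum is finite in the situations considered here: the matrix functions are bounded in
  norm and the lengths \<open>t\<^sub>i\<^sub>+\<^sub>1 - t\<^sub>i\<close> are bounded.
\<close>

definition rho ::
    "(real^'n \<Rightarrow> real) \<Rightarrow> (int \<Rightarrow> real) \<Rightarrow> (int \<Rightarrow> real) \<Rightarrow> (real \<Rightarrow> real^'n^'n) \<Rightarrow> real" where
  "rho N T \<zeta> Q = (SUP i. rho_plus N T \<zeta> Q i * rho_minus N T \<zeta> Q i)"

definition rho0 ::
    "(real^'n \<Rightarrow> real) \<Rightarrow> (int \<Rightarrow> real) \<Rightarrow> (int \<Rightarrow> real) \<Rightarrow> real \<Rightarrow> real \<Rightarrow> (real \<Rightarrow> real^'n^'n) \<Rightarrow> real" where
  "rho0 N T \<zeta> \<nu>p \<nu>m Q = (rho N T \<zeta> Q)\<^sup>2 * ((1 + \<nu>m) / (1 - \<nu>p))"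

definition rho_tilde ::
    "(real^'n \<Rightarrow> real) \<Rightarrow> (int \<Rightarrow> real) \<Rightarrow> (int \<Rightarrow> real) \<Rightarrow> real \<Rightarrow> real \<Rightarrow> real \<Rightarrow> real \<Rightarrow>
     (real \<Rightarrow> real^'n^'n) \<Rightarrow> real" where
  "rho_tilde N T \<zeta> \<nu>p \<nu>m \<alpha> \<theta> Q =
     max (rho N T \<zeta> Q * rho0 N T \<zeta> \<nu>p \<nu>m Q) (rho N T \<zeta> Q * exp (\<alpha> * \<theta>))"

definition F_factor :: "real \<Rightarrow> real \<Rightarrow> real \<Rightarrow> real" where
  "F_factor \<beta> l \<theta> = (exp ((\<beta> + l) * \<theta>) - 1) / ((\<beta> + l) * \<theta>)"

section \<open>Topological conjugacy\<close>

definition maps_solutions_homeomorphically ::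
    "((real \<Rightarrow> 'a) \<Rightarrow> bool) \<Rightarrow> ((real \<Rightarrow> 'a) \<Rightarrow> bool) \<Rightarrow> (real \<Rightarrow> 'a \<Rightarrow> 'a::real_normed_vector) \<Rightarrow> bool" where
  "maps_solutions_homeomorphically sol_I sol_II H \<longleftrightarrow>
     (\<forall>t. \<exists>G. homeomorphism UNIV UNIV (H t) G) \<and>
     (\<forall>R. \<forall>\<^sub>F z in at_infinity. \<forall>t. R < norm (H t z)) \<and>
     (\<forall>z. sol_I z \<longrightarrow> sol_II (\<lambda>t. H t (z t)))"

definition topologically_conjugate ::
    "((real \<Rightarrow> 'a) \<Rightarrow> bool) \<Rightarrow> ((real \<Rightarrow> 'a::real_normed_vector) \<Rightarrow> bool) \<Rightarrow> bool" where
  "topologically_conjugate sol_I sol_II \<longleftrightarrow>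
     (\<exists>H. continuous_on UNIV (\<lambda>(t, z). H t z) \<and>
          maps_solutions_homeomorphically sol_I sol_II H \<and>
          maps_solutions_homeomorphically sol_II sol_I (\<lambda>t. inv (H t)))"

end

theory Submission
  imports Defs
begin

text \<open>
  Two features of the perturbation are decisive. The terms \<open>f\<close> and \<open>g\<close> are unbounded, but they depend
  on the contracting component \<open>x\<close> only; and \<open>x\<close> is driven by a force of small linear growth plus
  the bounded term \<open>\<phi>\<close>. Hence \<open>x\<close> enters, after a time controlled by its size, a ball that is the same
  for all orbits, and stays there (\<open>absorption\<close>). Outside that ball \<open>f\<close> and \<open>g\<close> may be modified
  without touching the future of the orbits. They are cut off there, so slowly that the Lipschitz
  constants hardly grow (\<open>cutoff_difference\<close>). The strict smallness conditions leave room for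
  this, and the conjugacy is obtained in two steps.

  The given system and the cut-off one are conjugate because their orbits eventually coincide:
  follow an orbit of the former until it is absorbed; from then on it is an orbit of the latter,
  along which one returns to the initial time (\<open>eventually_common_orbits_conjugacy\<close>). This map can
  move points arbitrarily far, but points of a bounded set only by a bounded amount, uniformly in
  time.

  The cut-off system is a bounded perturbation of the linear one with a small Lipschitz constant.
  Each of its orbits is at bounded distance from exactly one linear orbit, since the difference is
  the bounded solution of a linear equation with bounded forcing (\<open>bounded_solution_exists\<close>,
  \<open>bounded_solution_estimate\<close>). The relation between initial values so defined is closed, which gives
  continuity in both directions; it is injective by the smallness condition on \<open>\<omega>\<close>, and onto by
  Brouwer's theorem (\<open>bounded_distance_conjugacy\<close>).

  Two estimates carry both steps. A perturbed or linear solution grows at most like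
  \<open>exp (rate \<bar>t - s\<bar>)\<close> in both directions of time, uniformly in \<open>t\<close> and \<open>s\<close> (\<open>interval_growth\<close>); here a weighted norm
  copes with the value \<open>z(\<gamma>(t))\<close>, which may lie in the future. And a forcing bounded by \<open>P\<close>
  contributes at most \<open>2 K \<rho> P exp (\<alpha>\<theta>) / \<alpha>\<close> to a solution of a block with exponential estimates
  (\<open>solution_estimate\<close>), by variation of constants on the intervals between the \<open>t\<^sub>i\<close>.
\<close>


section \<open>Vector norms and matrix norms\<close>

locale normed =
  fixes N :: "'a::euclidean_space \<Rightarrow> real"
  assumes vector_norm: "vector_norm N"
begin

lemma N_nonneg [simp]: "0 \<le> N x"
  and N_eq_0 [simp]: "N x = 0 \<longleftrightarrow> x = 0"
  and N_scaleR: "N (c *\<^sub>R x) = \<bar>c\<bar> * N x"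
  and N_triangle: "N (x + y) \<le> N x + N y"
  using vector_norm by (auto simp: vector_norm_def)

lemma N_zero [simp]: "N 0 = 0"
  by simp

lemma N_le_0 [simp]: "N x \<le> 0 \<longleftrightarrow> x = 0"
  using N_nonneg[of x] N_eq_0[of x] by linarith

lemma N_minus [simp]: "N (- x) = N x"
  using N_scaleR[of "-1" x] by simp

lemma N_minus_commute: "N (x - y) = N (y - x)"
  using N_minus[of "x - y"] by simp

lemma N_triangle_minus: "N (x - y) \<le> N x + N y"
  using N_triangle[of x "- y"] by simp

lemma N_triangle_sub: "N x \<le> N y + N (x - y)"
  using N_triangle[of y "x - y"] by simp

lemma N_triangle_dist: "N (x - z) \<le> N (x - y) + N (y - z)"
  using N_triangle[of "x - y" "y - z"] by simp

lemma N_sum: "N (sum h S) \<le> (\<Sum>i\<in>S. N (h i))"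
  by (induction S rule: infinite_finite_induct) (auto intro: order_trans[OF N_triangle])

lemma N_le_norm: "\<exists>C>0. \<forall>x. N x \<le> C * norm x"
proof (intro exI conjI allI)
  let ?C = "(\<Sum>b\<in>Basis. N b) + 1"
  show "0 < ?C" by (simp add: add_nonneg_pos sum_nonneg)
  fix x :: 'a
  have "N x = N (\<Sum>b\<in>Basis. (x \<bullet> b) *\<^sub>R b)" by (simp add: euclidean_representation)
  also have "\<dots> \<le> (\<Sum>b\<in>Basis. N ((x \<bullet> b) *\<^sub>R b))" by (rule N_sum)
  also have "\<dots> \<le> (\<Sum>b\<in>Basis. norm x * N b)"
    by (rule sum_mono) (simp add: N_scaleR mult_right_mono Basis_le_norm)
  also have "\<dots> \<le> ?C * norm x" by (simp add: sum_distrib_left algebra_simps)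
  finally show "N x \<le> ?C * norm x" .
qed

lemma continuous_on_N: "continuous_on S N"
proof -
  obtain C where C: "C > 0" "\<And>x. N x \<le> C * norm x" using N_le_norm by auto
  have "dist (N x) (N y) \<le> C * dist x y" for x y
    using N_triangle_sub[of x y] N_triangle_sub[of y x] C(2)[of "x - y"]
    by (simp add: dist_norm abs_le_iff N_minus_commute)
  then have "C-lipschitz_on S N" using C(1) by (intro lipschitz_onI) auto
  then show ?thesis by (rule lipschitz_on_continuous_on)
qed

lemma continuous_on_N_comp [continuous_intros]:
  "continuous_on S h \<Longrightarrow> continuous_on S (\<lambda>x. N (h x))"
  using continuous_on_compose2[OF continuous_on_N[of UNIV]] by auto

lemma tendsto_N: "(h \<longlongrightarrow> l) G \<Longrightarrow> ((\<lambda>x. N (h x)) \<longlongrightarrow> N l) G"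
  using isCont_tendsto_compose[of l N] continuous_on_N[of UNIV]
  by (simp add: continuous_on_eq_continuous_at)

lemma norm_le_N: "\<exists>C>0. \<forall>x. norm x \<le> C * N x"
proof -
  have "compact (sphere (0::'a) 1)" "sphere (0::'a) 1 \<noteq> {}" by auto
  then obtain x0 where x0: "x0 \<in> sphere 0 1" "\<And>y. y \<in> sphere 0 1 \<Longrightarrow> N x0 \<le> N y"
    using continuous_attains_inf[OF _ _ continuous_on_N] by metis
  have pos: "N x0 > 0"
  proof -
    have "x0 \<noteq> 0" using x0(1) by auto
    then show ?thesis using N_nonneg[of x0] N_eq_0[of x0] by linarith
  qed
  have "norm x \<le> (1 / N x0) * N x" for x
  proof (cases "x = 0")
    case False
    then have "N x0 \<le> N ((1 / norm x) *\<^sub>R x)" by (intro x0(2)) simp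
    also have "\<dots> = N x / norm x" by (simp add: N_scaleR)
    finally show ?thesis using False pos by (simp add: field_simps)
  qed simp
  then show ?thesis using pos by (intro exI[of _ "1 / N x0"]) auto
qed

lemma N_tendsto_0: "((\<lambda>x. N (h x)) \<longlongrightarrow> 0) G \<longleftrightarrow> (h \<longlongrightarrow> 0) G"
proof
  obtain C where C: "C > 0" "\<And>x. norm x \<le> C * N x" using norm_le_N by auto
  assume "((\<lambda>x. N (h x)) \<longlongrightarrow> 0) G"
  from tendsto_mult_left[OF this, of C] have *: "((\<lambda>x. C * N (h x)) \<longlongrightarrow> 0) G" by simp
  show "(h \<longlongrightarrow> 0) G"
    by (rule Lim_null_comparison[OF _ *]) (simp add: C)
qed (use tendsto_N[of h 0] in simp)

text \<open>
  The inequality is tested against the linear functionals dominated by \<open>N\<close>: a separating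
  hyperplane replaces the norm by one such functional, which commutes with the integral.
\<close>

lemma N_integral_le:
  fixes h :: "real \<Rightarrow> 'a"
  assumes h: "(h has_integral I) {a..b}" and k: "(k has_integral J) {a..b}"
    and le: "\<And>s. s \<in> {a..b} \<Longrightarrow> N (h s) \<le> k s"
  shows "N I \<le> J"
proof (rule ccontr)
  assume "\<not> N I \<le> J"
  have J0: "0 \<le> J" using has_integral_nonneg[OF k] le N_nonneg order_trans by blast
  obtain M where M: "J < M" "M < N I" using \<open>\<not> N I \<le> J\<close> dense[of J "N I"] by auto
  let ?S = "{x. N x \<le> M}"
  have "convex ?S"
  proof (rule convexI)
    fix x y and u v :: real
    assume A: "x \<in> ?S" "y \<in> ?S" "0 \<le> u" "0 \<le> v" "u + v = 1"
    have "N (u *\<^sub>R x + v *\<^sub>R y) \<le> u * N x + v * N y"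
      using N_triangle[of "u *\<^sub>R x" "v *\<^sub>R y"] A by (simp add: N_scaleR)
    also have "\<dots> \<le> u * M + v * M" using A by (intro add_mono mult_left_mono) auto
    finally show "u *\<^sub>R x + v *\<^sub>R y \<in> ?S" using A by (simp add: distrib_right[symmetric])
  qed
  moreover have "closed ?S"
    by (intro closed_Collect_le continuous_on_N continuous_intros)
  moreover have "I \<notin> ?S" using M by simp
  ultimately obtain v c where vc: "v \<bullet> I < c" "\<And>x. x \<in> ?S \<Longrightarrow> c < v \<bullet> x"
    using separating_hyperplane_closed_point[of ?S I] by auto
  have c: "c < 0" using vc(2)[of 0] M J0 by simp
  have dom: "- (v \<bullet> y) \<le> (- c / M) * N y" for y
  proof (cases "y = 0")
    case False
    then have pos: "N y > 0" using N_nonneg[of y] N_eq_0[of y] by linarith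
    have "c < v \<bullet> ((M / N y) *\<^sub>R y)" using M J0 pos by (intro vc(2)) (simp add: N_scaleR)
    then have "c * N y < M * (v \<bullet> y)" using pos by (simp add: field_simps)
    then have "- (M * (v \<bullet> y)) \<le> - (c * N y)" by simp
    then show ?thesis using M J0 by (simp add: field_simps)
  qed simp
  have 0: "((\<lambda>s. v \<bullet> h s) has_integral (v \<bullet> I)) {a..b}"
    using has_integral_linear[OF h bounded_linear_inner_right[of v]] by (simp add: o_def)
  have 1: "((\<lambda>s. - (v \<bullet> h s)) has_integral (- (v \<bullet> I))) {a..b}"
    by (rule has_integral_neg[OF 0])
  have 2: "((\<lambda>s. (- c / M) * k s) has_integral ((- c / M) * J)) {a..b}"
    by (rule has_integral_mult_right[OF k])
  have "- (v \<bullet> h s) \<le> (- c / M) * k s" if "s \<in> {a..b}" for s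
  proof -
    have "- c / M \<ge> 0" using c M J0 by (simp add: divide_nonpos_pos)
    then show ?thesis using dom[of "h s"] mult_left_mono[OF le[OF that]] order_trans by blast
  qed
  then have "- (v \<bullet> I) \<le> (- c / M) * J" by (rule has_integral_le[OF 1 2])
  also have "\<dots> < - c" using c M J0 by (simp add: field_simps)
  finally show False using vc(1) by simp
qed

end

lemma matrix_norm_bdd:
  fixes M :: "real^'n^'n"
  assumes "vector_norm N"
  shows "bdd_above ((\<lambda>x. N (M *v x)) ` {x. N x \<le> 1})"
proof -
  interpret normed N using assms by unfold_locales
  obtain C where C: "C > 0" "\<And>x. N x \<le> C * norm x" using N_le_norm by auto
  obtain D where D: "D > 0" "\<And>x. norm x \<le> D * N x" using norm_le_N by auto
  obtain B where B: "\<And>x. norm (M *v x) \<le> B * norm x" "B > 0"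
    using bounded_linear.pos_bounded[OF matrix_vector_mul_bounded_linear[of M]]
    by (auto simp: mult.commute)
  show ?thesis
  proof (rule bdd_aboveI2)
    fix x assume "x \<in> {x. N x \<le> 1}"
    then have "D * N x \<le> D * 1" using D(1) by (intro mult_left_mono) auto
    then have x: "norm x \<le> D" using D(2)[of x] by linarith
    have "N (M *v x) \<le> C * norm (M *v x)" by (rule C)
    also have "\<dots> \<le> C * (B * D)"
      using order_trans[OF B(1)[of x] mult_left_mono[OF x, of B]] B(2) C(1) by (intro mult_left_mono) auto
    finally show "N (M *v x) \<le> C * (B * D)" .
  qed
qed

lemma matrix_norm_le:
  fixes M :: "real^'n^'n"
  assumes N: "vector_norm N"
  shows "N (M *v x) \<le> matrix_norm N M * N x"
proof -
  interpret normed N using assms by unfold_locales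
  show ?thesis
  proof (cases "x = 0")
    case False
    then have pos: "N x > 0" using N_nonneg[of x] N_eq_0[of x] by linarith
    have "N (M *v ((1 / N x) *\<^sub>R x)) \<le> matrix_norm N M"
      unfolding matrix_norm_def using pos
      by (intro cSUP_upper matrix_norm_bdd[OF N]) (simp add: N_scaleR)
    then show ?thesis using pos by (simp add: matrix_vector_mult_scaleR N_scaleR field_simps)
  qed simp
qed

lemma matrix_norm_least:
  fixes M :: "real^'n^'n"
  assumes N: "vector_norm N" and "0 \<le> c" and "\<And>x. N (M *v x) \<le> c * N x"
  shows "matrix_norm N M \<le> c"
proof -
  interpret normed N using assms by unfold_locales
  show ?thesis
    unfolding matrix_norm_def
  proof (rule cSUP_least)
    show "{x. N x \<le> 1} \<noteq> {}" by (auto intro!: exI[of _ 0])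
    fix x assume "x \<in> {x. N x \<le> 1}"
    then show "N (M *v x) \<le> c"
      using assms(3)[of x] mult_left_mono[of "N x" 1 c] assms(2) by simp
  qed
qed

lemma matrix_norm_nonneg:
  fixes M :: "real^'n^'n"
  assumes N: "vector_norm N"
  shows "0 \<le> matrix_norm N M"
proof -
  interpret normed N using assms by unfold_locales
  have "N (M *v 0) \<le> matrix_norm N M"
    unfolding matrix_norm_def by (intro cSUP_upper matrix_norm_bdd[OF N]) simp
  then show ?thesis by simp
qed

text \<open>
  Used for its consequence that the matrix norm is continuous, so that its composition with a
  measurable matrix function is measurable.
\<close>

lemma vector_norm_matrix_norm:
  assumes N: "vector_norm N"
  shows "vector_norm (matrix_norm N :: real^'n^'n \<Rightarrow> real)"
proof -
  interpret normed N using assms by unfold_locales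
  have bound: "N (M *v x) \<le> matrix_norm N M * N x" for M :: "real^'n^'n" and x
    by (rule matrix_norm_le[OF N])
  have nonneg: "0 \<le> matrix_norm N M" for M :: "real^'n^'n" by (rule matrix_norm_nonneg[OF N])
  have scale: "matrix_norm N (c *\<^sub>R M) \<le> \<bar>c\<bar> * matrix_norm N M" for c and M :: "real^'n^'n"
    using bound nonneg
    by (intro matrix_norm_least[OF N])
      (auto simp: N_scaleR mult.assoc scaleR_matrix_vector_assoc[symmetric] intro: mult_left_mono)
  have "matrix_norm N M = 0 \<longleftrightarrow> M = 0" for M :: "real^'n^'n"
  proof
    assume "matrix_norm N M = 0"
    then have "M *v x = 0" for x using bound[of M x] by simp
    then show "M = 0" by (simp add: matrix_eq)
  qed (use nonneg[of 0] matrix_norm_least[OF N, of 0 0] in simp)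
  moreover have "matrix_norm N (c *\<^sub>R M) = \<bar>c\<bar> * matrix_norm N M" for c and M :: "real^'n^'n"
  proof (cases "c = 0")
    case False
    then show ?thesis using scale[of c M] scale[of "1 / c" "c *\<^sub>R M"] by (simp add: field_simps)
  qed (use scale[of 0 M] nonneg[of 0] in simp)
  moreover have "matrix_norm N (M + M') \<le> matrix_norm N M + matrix_norm N M'" for M M' :: "real^'n^'n"
  proof (rule matrix_norm_least[OF N])
    show "N ((M + M') *v x) \<le> (matrix_norm N M + matrix_norm N M') * N x" for x
      using N_triangle[of "M *v x" "M' *v x"] bound[of M x] bound[of M' x]
      by (simp add: matrix_vector_mult_add_rdistrib distrib_right)
  qed (simp add: nonneg)
  ultimately show ?thesis using nonneg by (simp add: vector_norm_def)
qed

lemma matrix_norm_integrable: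
  fixes A :: "real \<Rightarrow> real^'n^'n"
  assumes N: "vector_norm N" and A: "A absolutely_integrable_on {a..b}"
    and bound: "\<And>t. matrix_norm N (A t) \<le> \<beta>"
  shows "(\<lambda>s. matrix_norm N (A s)) integrable_on {a..b}"
proof (rule measurable_bounded_by_integrable_imp_integrable[where g = "\<lambda>_. \<beta>"])
  have "A \<in> borel_measurable (lebesgue_on {a..b})"
    using A by (simp add: absolutely_integrable_measurable)
  then show "(\<lambda>s. matrix_norm N (A s)) \<in> borel_measurable (lebesgue_on {a..b})"
    by (rule measurable_compose[OF _ borel_measurable_continuous_onI[OF
          normed.continuous_on_N[OF normed.intro[OF vector_norm_matrix_norm[OF N]]]]])
qed (use bound matrix_norm_nonneg[OF N] in auto)

section \<open>Gronwall's inequality\<close>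

text \<open>
  Splitting \<open>[a, b]\<close> into \<open>n\<close> equal parts bounds the total increment by \<open>C (b - a)\<^sup>2 / n\<close>.
\<close>

lemma nonincreasing_if_quadratic_increments:
  fixes h :: "real \<Rightarrow> real"
  assumes quad: "\<And>s t. a \<le> s \<Longrightarrow> s \<le> t \<Longrightarrow> t \<le> b \<Longrightarrow> h t - h s \<le> C * (t - s)\<^sup>2"
    and ab: "a \<le> b"
  shows "h b \<le> h a"
proof -
  have step: "h b - h a \<le> C * (b - a)\<^sup>2 / real (Suc n)" for n
  proof -
    define c where "c = (b - a) / real (Suc n)"
    define x where "x k = a + real k * c" for k
    have c: "0 \<le> c" "real (Suc n) * c = b - a" using ab by (auto simp: c_def)
    have x_le: "x k \<le> b" if "k \<le> Suc n" for k
    proof -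
      have "real k * c \<le> real (Suc n) * c"
        using that c(1) by (intro mult_right_mono) auto
      then show ?thesis unfolding x_def c(2) by simp
    qed
    have inc: "x (Suc k) - x k = c" for k
      by (simp add: x_def algebra_simps)
    have ge: "a \<le> x k" for k using c by (simp add: x_def)
    have mono: "x k \<le> x (Suc k)" for k
      using inc[of k] c(1) by linarith
    have "h b - h a = h (x (Suc n)) - h (x 0)" by (simp add: x_def c(2) del: of_nat_Suc)
    also have "\<dots> = (\<Sum>k<Suc n. h (x (Suc k)) - h (x k))"
      by (rule sum_lessThan_telescope[symmetric])
    also have "\<dots> \<le> (\<Sum>k<Suc n. C * c\<^sup>2)"
    proof (rule sum_mono)
      fix k assume "k \<in> {..<Suc n}"
      then have "h (x (Suc k)) - h (x k) \<le> C * (x (Suc k) - x k)\<^sup>2"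
        by (intro quad ge mono x_le) auto
      then show "h (x (Suc k)) - h (x k) \<le> C * c\<^sup>2"
        unfolding inc .
    qed
    also have "\<dots> = C * (b - a)\<^sup>2 / real (Suc n)"
      by (simp add: c_def power2_eq_square del: of_nat_Suc)
    finally show ?thesis .
  qed
  have "(\<lambda>n. C * (b - a)\<^sup>2 / real (Suc n)) \<longlonglongrightarrow> 0"
    using LIMSEQ_Suc[OF lim_const_over_n[of "C * (b - a)\<^sup>2"]] by simp
  from LIMSEQ_le_const[OF this, of "h b - h a"] step show ?thesis by auto
qed

text \<open>
  The weight \<open>exp (- \<integral>k)\<close> turns the integral inequality into an inequality for increments up to an
  error of second order, so no differentiability of the merely integrable coefficient \<open>k\<close> enters.
\<close>

lemma gronwall_forward:
  fixes u k :: "real \<Rightarrow> real"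
  assumes zero: "u a = 0" and nonneg: "\<And>s. s \<in> {a..b} \<Longrightarrow> 0 \<le> u s"
    and cont: "continuous_on {a..b} u"
    and k: "k integrable_on {a..b}" "\<And>s. s \<in> {a..b} \<Longrightarrow> 0 \<le> k s" "\<And>s. s \<in> {a..b} \<Longrightarrow> k s \<le> \<beta>"
    and incr: "\<And>s t M. a \<le> s \<Longrightarrow> s \<le> t \<Longrightarrow> t \<le> b \<Longrightarrow> (\<And>r. r \<in> {s..t} \<Longrightarrow> u r \<le> M) \<Longrightarrow>
        u t - u s \<le> M * integral {s..t} k + P * (t - s)"
    and P: "0 \<le> P" and ab: "a \<le> b"
  shows "u b \<le> P * (b - a) * exp (integral {a..b} k)"
proof -
  obtain m where m: "\<And>s. s \<in> {a..b} \<Longrightarrow> u s \<le> m"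
    using continuous_attains_sup[of "{a..b}" u] cont ab by (metis atLeastatMost_empty_iff2 compact_Icc not_le)
  have m0: "0 \<le> m" using m[of a] zero ab by simp
  have \<beta>0: "0 \<le> \<beta>" using k(2,3)[of a] ab by simp
  have kint: "k integrable_on {s..t}" if "a \<le> s" "t \<le> b" for s t
    using integrable_on_subinterval[OF k(1), of s t] that by auto
  define I where "I t = integral {a..t} k" for t
  have I_diff: "I t - I s = integral {s..t} k" if "a \<le> s" "s \<le> t" "t \<le> b" for s t
    using Henstock_Kurzweil_Integration.integral_combine[of a s t k] kint[of a t] that by (simp add: I_def)
  have k_bound: "0 \<le> integral {s..t} k" "integral {s..t} k \<le> \<beta> * (t - s)"
    if "a \<le> s" "s \<le> t" "t \<le> b" for s t
  proof -
    show "0 \<le> integral {s..t} k"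
      using that by (intro Henstock_Kurzweil_Integration.integral_nonneg kint k(2)) auto
    have "integral {s..t} k \<le> integral {s..t} (\<lambda>_. \<beta>)"
      using that by (intro integral_le kint k(3)) auto
    then show "integral {s..t} k \<le> \<beta> * (t - s)" using that by (simp add: mult.commute)
  qed
  define L where "L = m * \<beta> + P"
  have L0: "0 \<le> L" using m0 \<beta>0 P by (simp add: L_def)
  have lip: "u t - u s \<le> L * (t - s)" if "a \<le> s" "s \<le> t" "t \<le> b" for s t
  proof -
    have "u t - u s \<le> m * integral {s..t} k + P * (t - s)"
      using that m by (intro incr) auto
    also have "\<dots> \<le> m * (\<beta> * (t - s)) + P * (t - s)"
      using k_bound(2)[OF that] m0 by (intro add_right_mono mult_left_mono) auto
    finally show ?thesis by (simp add: L_def algebra_simps)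
  qed
  have "exp (- I b) * u b - P * b \<le> exp (- I a) * u a - P * a"
  proof (rule nonincreasing_if_quadratic_increments[OF _ ab])
    fix s t assume st: "a \<le> s" "s \<le> t" "t \<le> b"
    define x where "x = integral {s..t} k"
    have x: "0 \<le> x" "x \<le> \<beta> * (t - s)" using k_bound[OF st] by (auto simp: x_def)
    have "u t - u s \<le> (u s + L * (t - s)) * x + P * (t - s)"
      unfolding x_def
    proof (rule incr[OF st])
      fix r assume r: "r \<in> {s..t}"
      have "L * (r - s) \<le> L * (t - s)" using r L0 by (intro mult_left_mono) auto
      then show "u r \<le> u s + L * (t - s)" using lip[of s r] r st by auto
    qed
    moreover have "L * (t - s) * x \<le> L * (t - s) * (\<beta> * (t - s))"
      using x L0 st by (intro mult_left_mono) auto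
    ultimately have "u t \<le> u s * (1 + x) + (P * (t - s) + L * \<beta> * (t - s)\<^sup>2)"
      by (simp add: algebra_simps power2_eq_square)
    then have "exp (- I t) * u t \<le> exp (- I t) * (u s * (1 + x) + (P * (t - s) + L * \<beta> * (t - s)\<^sup>2))"
      by (intro mult_left_mono) auto
    also have "\<dots> = exp (- I t) * (u s * (1 + x)) + exp (- I t) * (P * (t - s) + L * \<beta> * (t - s)\<^sup>2)"
      by (rule distrib_left)
    also have "\<dots> \<le> exp (- I s) * u s + (P * (t - s) + L * \<beta> * (t - s)\<^sup>2)"
    proof (rule add_mono)
      have "exp (- I t) * (u s * (1 + x)) \<le> exp (- I t) * (u s * exp x)"
        using nonneg[of s] st exp_ge_add_one_self[of x] by (intro mult_left_mono) auto
      also have "\<dots> = exp (- I t + x) * u s" by (simp only: exp_add mult_ac)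
      also have "- I t + x = - I s" using I_diff[OF st] by (simp add: x_def)
      finally show "exp (- I t) * (u s * (1 + x)) \<le> exp (- I s) * u s" .
      have "0 \<le> I t" unfolding I_def using k_bound(1)[of a t] st by auto
      then have "exp (- I t) \<le> 1" by simp
      moreover have "0 \<le> P * (t - s) + L * \<beta> * (t - s)\<^sup>2" using P L0 \<beta>0 st by simp
      ultimately show "exp (- I t) * (P * (t - s) + L * \<beta> * (t - s)\<^sup>2) \<le> P * (t - s) + L * \<beta> * (t - s)\<^sup>2"
        by (intro mult_left_le_one_le) auto
    qed
    finally show "exp (- I t) * u t - P * t - (exp (- I s) * u s - P * s) \<le> (L * \<beta>) * (t - s)\<^sup>2"
      by (simp add: algebra_simps)
  qed
  then have *: "exp (- I b) * u b \<le> P * (b - a)" using zero by (simp add: algebra_simps)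
  have "u b = exp (- I b) * u b * exp (I b)"
    by (simp add: exp_minus)
  also have "\<dots> \<le> P * (b - a) * exp (I b)"
    using * by (intro mult_right_mono) auto
  finally show ?thesis by (simp add: I_def)
qed

text \<open>The same bound on either side of the zero \<open>c\<close>; the left side is the right one reflected.\<close>

lemma gronwall_two_sided:
  fixes u k :: "real \<Rightarrow> real"
  assumes zero: "u c = 0" and nonneg: "\<And>s. s \<in> {a..b} \<Longrightarrow> 0 \<le> u s"
    and cont: "continuous_on {a..b} u"
    and k: "k integrable_on {a..b}" "\<And>s. s \<in> {a..b} \<Longrightarrow> 0 \<le> k s" "\<And>s. s \<in> {a..b} \<Longrightarrow> k s \<le> \<beta>"
    and incr: "\<And>s t M. a \<le> s \<Longrightarrow> s \<le> t \<Longrightarrow> t \<le> b \<Longrightarrow> (\<And>r. r \<in> {s..t} \<Longrightarrow> u r \<le> M) \<Longrightarrow>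
        \<bar>u t - u s\<bar> \<le> M * integral {s..t} k + P * (t - s)"
    and P: "0 \<le> P" and c: "c \<in> {a..b}" and t: "t \<in> {a..b}"
  shows "u t \<le> P * \<bar>t - c\<bar> * exp (integral {a..b} k)"
proof -
  have mono: "integral {r..s} k \<le> integral {a..b} k" if "a \<le> r" "s \<le> b" for r s
    using that k(2) by (intro integral_subset_le integrable_on_subinterval[OF k(1)]) auto
  have weaken: "P * \<bar>t - c\<bar> * exp (integral {r..s} k) \<le> P * \<bar>t - c\<bar> * exp (integral {a..b} k)"
    if "a \<le> r" "s \<le> b" for r s
    using mono[OF that] P by (intro mult_left_mono) auto
  show ?thesis
  proof (cases "c \<le> t")
    case True
    have "u t \<le> P * (t - c) * exp (integral {c..t} k)"
    proof (rule gronwall_forward[where \<beta> = \<beta>])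
      show "continuous_on {c..t} u" using cont by (rule continuous_on_subset) (use c t in auto)
      show "k integrable_on {c..t}" using k(1) by (rule integrable_on_subinterval) (use c t in auto)
      show "u r - u s \<le> M * integral {s..r} k + P * (r - s)"
        if "c \<le> s" "s \<le> r" "r \<le> t" "\<And>q. q \<in> {s..r} \<Longrightarrow> u q \<le> M" for s r M
      proof -
        have "\<bar>u r - u s\<bar> \<le> M * integral {s..r} k + P * (r - s)"
          using that c t by (intro incr) auto
        then show ?thesis by linarith
      qed
    qed (use zero nonneg k(2,3) P c t True in auto)
    then show ?thesis using weaken[of c t] True c t by auto
  next
    case False
    have refl: "integral {- r..- s} (\<lambda>x. k (- x)) = integral {s..r} k" for r s
      by simp
    have "u (- (- t)) \<le> P * (- t - (- c)) * exp (integral {- c..- t} (\<lambda>x. k (- x)))"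
    proof (rule gronwall_forward[where u = "\<lambda>x. u (- x)" and \<beta> = \<beta>])
      show "continuous_on {- c..- t} (\<lambda>x. u (- x))"
        by (rule continuous_on_compose2[OF cont]) (use c t in \<open>auto intro!: continuous_intros\<close>)
      show "(\<lambda>x. k (- x)) integrable_on {- c..- t}"
        using integrable_on_subinterval[OF k(1), of t c] c t by simp
      show "u (- r) - u (- s) \<le> M * integral {s..r} (\<lambda>x. k (- x)) + P * (r - s)"
        if srt: "- c \<le> s" "s \<le> r" "r \<le> - t" and M: "\<And>q. q \<in> {s..r} \<Longrightarrow> u (- q) \<le> M" for s r M
      proof -
        have "u q \<le> M" if "q \<in> {- r..- s}" for q
          using M[of "- q"] that by auto
        then have "\<bar>u (- s) - u (- r)\<bar> \<le> M * integral {- r..- s} k + P * (- s - - r)"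
          using srt c t by (intro incr) auto
        then show ?thesis using refl[of "- s" "- r"] by simp
      qed
    qed (use zero nonneg k(2,3) P c t False in auto)
    then show ?thesis using weaken[of t c] False c t refl[of c t] by auto
  qed
qed

section \<open>Superposition with a continuous function\<close>

text \<open>
  The composition is a uniform limit of the functions obtained by freezing \<open>z\<close> on the pieces of a
  subdivision.
\<close>

lemma caratheodory_integrable:
  fixes G :: "real \<Rightarrow> 'a::euclidean_space \<Rightarrow> 'b::euclidean_space"
  assumes G: "\<And>x. (\<lambda>t. G t x) integrable_on {a..b}"
    and lip: "\<And>t x y. t \<in> {a..b} \<Longrightarrow> norm (G t x - G t y) \<le> C * norm (x - y)"
    and z: "continuous_on {a..b} z"
  shows "(\<lambda>t. G t (z t)) integrable_on {a..b}"
proof (cases "a \<le> b")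
  case ab: True
  have "\<exists>g. (\<forall>x\<in>cbox a b. norm (G x (z x) - g x) \<le> e) \<and> g integrable_on cbox a b" if e: "0 < e" for e
  proof -
    define C' where "C' = \<bar>C\<bar> + 1"
    have C': "C' > 0" by (simp add: C'_def)
    have lip': "norm (G t x - G t y) \<le> C' * norm (x - y)" if "t \<in> {a..b}" for t x y
    proof -
      have "C * norm (x - y) \<le> C' * norm (x - y)" by (intro mult_right_mono) (auto simp: C'_def)
      then show ?thesis using lip[OF that, of x y] by linarith
    qed
    define Q where "Q u v \<longleftrightarrow> (a \<le> u \<longrightarrow> v \<le> b \<longrightarrow>
        (\<exists>g. (\<forall>x\<in>{u..v}. norm (G x (z x) - g x) \<le> e) \<and> g integrable_on {u..v}))" for u v
    have "Q a b"
    proof (rule Bolzano[OF ab])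
      fix u v w assume uvw: "Q u v" "Q v w" "u \<le> v" "v \<le> w"
      show "Q u w" unfolding Q_def
      proof (intro impI)
        assume "a \<le> u" "w \<le> b"
        then have "v \<le> b" "a \<le> v" using uvw by linarith+
        from uvw(1) \<open>a \<le> u\<close> \<open>v \<le> b\<close> obtain g where
          g: "\<forall>x\<in>{u..v}. norm (G x (z x) - g x) \<le> e" "g integrable_on {u..v}"
          unfolding Q_def by blast
        from uvw(2) \<open>a \<le> v\<close> \<open>w \<le> b\<close> obtain h where
          h: "\<forall>x\<in>{v..w}. norm (G x (z x) - h x) \<le> e" "h integrable_on {v..w}"
          unfolding Q_def by blast
        let ?k = "\<lambda>x. if x \<le> v then g x else h x"
        have "?k integrable_on {u..v}" by (rule integrable_eq[OF g(2)]) auto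
        moreover have "?k integrable_on {v..w}"
          by (rule integrable_spike[OF h(2) negligible_sing[of v]]) auto
        ultimately have "?k integrable_on {u..w}"
          by (rule Henstock_Kurzweil_Integration.integrable_combine[OF uvw(3,4)])
        then show "\<exists>g. (\<forall>x\<in>{u..w}. norm (G x (z x) - g x) \<le> e) \<and> g integrable_on {u..w}"
          using g(1) h(1) by (intro exI[of _ ?k]) auto
      qed
    next
      fix x assume x: "a \<le> x" "x \<le> b"
      have "0 < e / C'" using e C' by simp
      then obtain d where d: "d > 0" "\<And>y. y \<in> {a..b} \<Longrightarrow> dist y x < d \<Longrightarrow> dist (z y) (z x) < e / C'"
        using z[unfolded continuous_on_iff, rule_format, of x "e / C'"] x by auto
      show "\<exists>d>0. \<forall>u v. u \<le> x \<and> x \<le> v \<and> v - u < d \<longrightarrow> Q u v"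
      proof (intro exI[of _ d] conjI d(1) allI impI)
        fix u v assume uv: "u \<le> x \<and> x \<le> v \<and> v - u < d"
        show "Q u v" unfolding Q_def
        proof (intro impI exI conjI ballI)
          assume "a \<le> u" "v \<le> b"
          then show "(\<lambda>t. G t (z x)) integrable_on {u..v}"
            by (intro integrable_on_subinterval[OF G]) auto
          fix y assume "y \<in> {u..v}"
          then have "y \<in> {a..b}" "dist y x < d" using uv \<open>a \<le> u\<close> \<open>v \<le> b\<close> by (auto simp: dist_real_def)
          then have "norm (G y (z y) - G y (z x)) \<le> C' * norm (z y - z x)" "norm (z y - z x) < e / C'"
            using lip' d(2) by (auto simp: dist_norm)
          then show "norm (G y (z y) - G y (z x)) \<le> e"
            using C' by (simp add: field_simps)
        qed
      qed
    qed
    then show ?thesis by (simp add: Q_def)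
  qed
  then show ?thesis using integrable_uniform_limit[of a b "\<lambda>t. G t (z t)"] by simp
qed (simp add: integrable_on_empty)

section \<open>The initial value problem on one interval\<close>

text \<open>
  The argument \<open>\<gamma>\<close> is constantly \<open>\<zeta>\<close> on the interval, so the equation reads
  \<open>z' = G(t, z, z(\<zeta>))\<close> there.
\<close>

definition interval_solution ::
    "real \<Rightarrow> real \<Rightarrow> real \<Rightarrow> (real \<Rightarrow> 'a \<Rightarrow> 'a \<Rightarrow> 'a::euclidean_space) \<Rightarrow> (real \<Rightarrow> 'a) \<Rightarrow> bool" where
  "interval_solution a b \<zeta> G z \<longleftrightarrow> continuous_on {a..b} z \<and>
     (\<forall>t\<in>{a..b}. ((\<lambda>s. G s (z s) (z \<zeta>)) has_integral (z t - z a)) {a..t})"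

lemma indefinite_integral_diff:
  fixes h :: "real \<Rightarrow> 'a::euclidean_space"
  assumes h: "h integrable_on {a..b}" and st: "a \<le> s" "s \<le> t" "t \<le> b"
  shows "(h has_integral (integral {a..t} h - integral {a..s} h)) {s..t}"
proof -
  have "h integrable_on {s..t}" "h integrable_on {a..t}"
    using st by (auto intro!: integrable_on_subinterval[OF h])
  moreover have "integral {a..s} h + integral {s..t} h = integral {a..t} h"
    by (rule Henstock_Kurzweil_Integration.integral_combine) (use st calculation in auto)
  then have "integral {s..t} h = integral {a..t} h - integral {a..s} h"
    by (simp add: algebra_simps)
  ultimately show ?thesis by (metis integrable_integral)
qed

lemma interval_solution_has_integral:
  assumes z: "interval_solution a b \<zeta> G z" and st: "a \<le> s" "s \<le> t" "t \<le> b"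
  shows "((\<lambda>r. G r (z r) (z \<zeta>)) has_integral (z t - z s)) {s..t}"
proof -
  have I: "integral {a..r} (\<lambda>r. G r (z r) (z \<zeta>)) = z r - z a" if "r \<in> {a..b}" for r
    using z that unfolding interval_solution_def by (intro integral_unique) auto
  have "(\<lambda>r. G r (z r) (z \<zeta>)) integrable_on {a..b}"
    using z st unfolding interval_solution_def
    by (metis atLeastAtMost_iff has_integral_integrable order_refl order_trans)
  from indefinite_integral_diff[OF this st] show ?thesis
    using st by (simp add: I)
qed

text \<open>
  Picard iteration from the zero function. As \<open>\<eta> \<le> w \<le> 1\<close>, convergence in the norm weighted by \<open>w\<close>
  is uniform convergence.
\<close>

lemma (in normed) weighted_contraction_fixpoint:
  fixes \<T> :: "(real \<Rightarrow> 'a) \<Rightarrow> real \<Rightarrow> 'a" and w :: "real \<Rightarrow> real"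
  assumes cont: "\<And>z. continuous_on {a..b} z \<Longrightarrow> continuous_on {a..b} (\<T> z)"
    and contr: "\<And>z v m t. continuous_on {a..b} z \<Longrightarrow> continuous_on {a..b} v \<Longrightarrow> 0 \<le> m \<Longrightarrow>
        (\<And>t. t \<in> {a..b} \<Longrightarrow> N (z t - v t) \<le> m * w t) \<Longrightarrow> t \<in> {a..b} \<Longrightarrow>
        N (\<T> z t - \<T> v t) \<le> q * m * w t"
    and q: "0 \<le> q" "q < 1" and \<eta>: "0 < \<eta>"
    and w: "\<And>t. t \<in> {a..b} \<Longrightarrow> \<eta> \<le> w t" "\<And>t. t \<in> {a..b} \<Longrightarrow> w t \<le> 1"
  obtains z where "continuous_on {a..b} z" "\<And>t. t \<in> {a..b} \<Longrightarrow> \<T> z t = z t"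
proof -
  obtain C where C: "C > 0" "\<And>x. norm x \<le> C * N x" using norm_le_N by auto
  obtain C' where C': "C' > 0" "\<And>x. N x \<le> C' * norm x" using N_le_norm by auto
  define z where "z n = (\<T> ^^ n) (\<lambda>_. 0)" for n
  have z_Suc: "z (Suc n) = \<T> (z n)" for n by (simp add: z_def)
  have cz: "continuous_on {a..b} (z n)" for n
    by (induction n) (simp_all add: z_Suc cont, simp add: z_def)
  have "compact ((\<lambda>t. N (z 1 t)) ` {a..b})"
    by (intro compact_continuous_image continuous_on_N_comp cz) simp
  then obtain B where B0: "0 < B" "\<forall>x\<in>(\<lambda>t. N (z 1 t)) ` {a..b}. norm x \<le> B"
    using compact_imp_bounded bounded_pos by metis
  have B: "N (z 1 t) \<le> B" if "t \<in> {a..b}" for t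
    using B0(2)[rule_format, OF imageI[OF that]] by simp
  define m where "m = B / \<eta>"
  have m: "0 \<le> m" using B0(1) \<eta> by (simp add: m_def)
  have diff: "N (z (Suc n) t - z n t) \<le> q ^ n * m * w t" if "t \<in> {a..b}" for n t
    using that
  proof (induction n arbitrary: t)
    case 0
    have "B \<le> m * w t" using w(1)[OF 0] B0(1) \<eta> by (simp add: m_def field_simps)
    then show ?case using B[OF 0] by (simp add: z_def)
  next
    case (Suc n)
    have "N (\<T> (z (Suc n)) t - \<T> (z n) t) \<le> q * (q ^ n * m) * w t"
      by (rule contr[OF cz cz _ Suc.IH Suc.prems]) (use m q in auto)
    then show ?case by (simp add: z_Suc mult.assoc)
  qed
  define y where "y t = (\<Sum>i. z (Suc i) t - z i t)" for t
  have "uniform_limit {a..b} (\<lambda>n t. \<Sum>i<n. z (Suc i) t - z i t) y sequentially"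
    unfolding y_def
  proof (rule Weierstrass_m_test)
    show "norm (z (Suc n) t - z n t) \<le> C * m * q ^ n" if t: "t \<in> {a..b}" for n t
    proof -
      have "norm (z (Suc n) t - z n t) \<le> C * N (z (Suc n) t - z n t)" by (rule C)
      also have "\<dots> \<le> C * (q ^ n * m * 1)"
        using order_trans[OF diff[OF t, of n] mult_left_mono[OF w(2)[OF t], of "q ^ n * m"]] C m q
        by (intro mult_left_mono) auto
      finally show ?thesis by (simp add: mult_ac)
    qed
    show "summable (\<lambda>n. C * m * q ^ n)"
      by (intro summable_mult summable_geometric) (use q in auto)
  qed
  moreover have "(\<Sum>i<n. z (Suc i) t - z i t) = z n t" for n t
    using sum_lessThan_telescope[of "\<lambda>i. z i t" n] by (simp add: z_def)
  ultimately have lim: "uniform_limit {a..b} z y sequentially" by simp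
  have cy: "continuous_on {a..b} y"
    by (rule uniform_limit_theorem[OF _ lim]) (auto simp: cz)
  have "\<T> y t = y t" if t: "t \<in> {a..b}" for t
  proof -
    have "(\<lambda>n. \<T> (z n) t) \<longlonglongrightarrow> \<T> y t"
    proof (rule LIM_zero_cancel, subst N_tendsto_0[symmetric], rule tendstoI)
      fix e :: real assume e: "0 < e"
      define e' where "e' = e * \<eta> / C'"
      have e': "0 < e'" using e \<eta> C' by (simp add: e'_def)
      have "\<forall>\<^sub>F n in sequentially. \<forall>s\<in>{a..b}. dist (z n s) (y s) < e'"
        using lim e' by (simp add: uniform_limit_iff)
      then show "\<forall>\<^sub>F n in sequentially. dist (N (\<T> (z n) t - \<T> y t)) 0 < e"
      proof (rule eventually_mono)
        fix n assume n: "\<forall>s\<in>{a..b}. dist (z n s) (y s) < e'"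
        have "N (\<T> (z n) t - \<T> y t) \<le> q * e * w t"
        proof (rule contr[OF cz cy _ _ t])
          fix s assume s: "s \<in> {a..b}"
          have "N (z n s - y s) \<le> C' * norm (z n s - y s)" by (rule C')
          also have "\<dots> \<le> C' * e'" using n s C'(1) by (intro mult_left_mono) (auto simp: dist_norm less_imp_le)
          also have "\<dots> = e * \<eta>" using C' by (simp add: e'_def)
          also have "\<dots> \<le> e * w s" using w(1)[OF s] e by (intro mult_left_mono) auto
          finally show "N (z n s - y s) \<le> e * w s" .
        qed (use e in auto)
        also have "\<dots> \<le> q * e * 1" using w(2)[OF t] q e by (intro mult_left_mono) auto
        also have "\<dots> < e" using q e by simp
        finally show "dist (N (\<T> (z n) t - \<T> y t)) 0 < e" by simp
      qed
    qed
    moreover have "(\<lambda>n. \<T> (z n) t) \<longlonglongrightarrow> y t"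
      using LIMSEQ_Suc[OF tendsto_uniform_limitI[OF lim t]] by (simp add: z_Suc)
    ultimately show ?thesis using LIMSEQ_unique by blast
  qed
  then show thesis using that cy by blast
qed

text \<open>
  The smallness condition in this form bounds the loss caused by the unknown value \<open>z(\<zeta>)\<close>: a
  change of that value by \<open>x\<close> changes the solution of an ordinary differential equation with
  prescribed value at \<open>\<tau>\<close> by at most \<open>\<beta>0 (exp (\<beta>\<theta>) - 1) / \<beta> \<cdot> x\<close> at \<open>\<zeta>\<close>.
\<close>

locale interval_ivp = normed N
  for N :: "'a::euclidean_space \<Rightarrow> real" +
  fixes \<theta> \<beta> \<beta>0 :: real
  assumes \<beta>: "0 < \<beta>" and \<beta>0: "0 \<le> \<beta>0" and \<theta>: "0 < \<theta>"
    and small: "\<beta>0 * (exp (\<beta> * \<theta>) - 1) / \<beta> < 1"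
begin

definition floor_weight :: real ("\<eta>") where
  "\<eta> = (1 - \<beta>0 * (exp (\<beta> * \<theta>) - 1) / \<beta>) * exp (- (\<beta> * \<theta>))"

lemma eta_pos: "0 < \<eta>"
  using small by (simp add: floor_weight_def)

text \<open>
  The solution of \<open>w' = \<beta> w + \<beta>0\<close> growing from \<open>w(\<tau>) = \<eta>\<close> in both directions; \<open>\<eta>\<close> is chosen such
  that \<open>w\<close> reaches at most \<open>1\<close> within the distance \<open>\<theta>\<close>. The integral operator of the problem is a
  contraction for the norm weighted by \<open>w\<close>, although it need not be one for the supremum norm.
\<close>

definition weight :: "real \<Rightarrow> real \<Rightarrow> real" where
  "weight \<tau> t = \<eta> * exp (\<beta> * \<bar>t - \<tau>\<bar>) + \<beta>0 * (exp (\<beta> * \<bar>t - \<tau>\<bar>) - 1) / \<beta>"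

lemma weight_ge: "\<eta> \<le> weight \<tau> t"
proof -
  have "1 \<le> exp (\<beta> * \<bar>t - \<tau>\<bar>)" using \<beta> by simp
  then have "\<eta> * 1 \<le> \<eta> * exp (\<beta> * \<bar>t - \<tau>\<bar>)" "0 \<le> \<beta>0 * (exp (\<beta> * \<bar>t - \<tau>\<bar>) - 1) / \<beta>"
    using eta_pos \<beta> \<beta>0 by (auto intro!: mult_left_mono divide_nonneg_pos mult_nonneg_nonneg)
  then show ?thesis by (simp add: weight_def)
qed

lemma weight_le_1:
  assumes "\<bar>t - \<tau>\<bar> \<le> \<theta>"
  shows "weight \<tau> t \<le> 1"
proof -
  have "exp (\<beta> * \<bar>t - \<tau>\<bar>) \<le> exp (\<beta> * \<theta>)" using assms \<beta> by simp
  then have "weight \<tau> t \<le> \<eta> * exp (\<beta> * \<theta>) + \<beta>0 * (exp (\<beta> * \<theta>) - 1) / \<beta>"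
    unfolding weight_def using eta_pos \<beta> \<beta>0
    by (intro add_mono mult_left_mono divide_right_mono) auto
  also have "\<eta> * exp (\<beta> * \<theta>) = 1 - \<beta>0 * (exp (\<beta> * \<theta>) - 1) / \<beta>"
    by (simp add: floor_weight_def mult.assoc flip: exp_add)
  finally show ?thesis by simp
qed

lemma eta_le_1: "\<eta> \<le> 1"
  using weight_ge[of 0 0] weight_le_1[of 0 0] \<theta> by simp

lemma weight_has_integral:
  "((\<lambda>r. \<beta> * weight \<tau> r + \<beta>0) has_integral (weight \<tau> t - \<eta>)) {min \<tau> t..max \<tau> t}"
proof (cases "\<tau> \<le> t")
  case True
  let ?g = "\<lambda>r. \<eta> * exp (\<beta> * (r - \<tau>)) + \<beta>0 * (exp (\<beta> * (r - \<tau>)) - 1) / \<beta>"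
  have "((\<lambda>r. \<beta> * ?g r + \<beta>0) has_integral (?g t - ?g \<tau>)) {\<tau>..t}"
  proof (rule fundamental_theorem_of_calculus[OF True])
    fix x
    have "(?g has_real_derivative (\<beta> * ?g x + \<beta>0)) (at x within {\<tau>..t})"
      using \<beta> by (auto intro!: derivative_eq_intros simp: field_simps)
    then show "(?g has_vector_derivative (\<beta> * ?g x + \<beta>0)) (at x within {\<tau>..t})"
      by (rule has_real_derivative_iff_has_vector_derivative[THEN iffD1])
  qed
  then have "((\<lambda>r. \<beta> * weight \<tau> r + \<beta>0) has_integral (?g t - ?g \<tau>)) {\<tau>..t}"
    by (rule has_integral_eq[rotated]) (simp add: weight_def)
  then show ?thesis using True by (simp add: weight_def)
next
  case False
  let ?g = "\<lambda>r. \<eta> * exp (\<beta> * (\<tau> - r)) + \<beta>0 * (exp (\<beta> * (\<tau> - r)) - 1) / \<beta>"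
  have "((\<lambda>r. \<beta> * ?g r + \<beta>0) has_integral (- ?g \<tau> - (- ?g t))) {t..\<tau>}"
  proof (rule fundamental_theorem_of_calculus)
    show "t \<le> \<tau>" using False by simp
    fix x
    have "((\<lambda>r. - ?g r) has_real_derivative (\<beta> * ?g x + \<beta>0)) (at x within {t..\<tau>})"
      using \<beta> by (auto intro!: derivative_eq_intros simp: field_simps)
    then show "((\<lambda>r. - ?g r) has_vector_derivative (\<beta> * ?g x + \<beta>0)) (at x within {t..\<tau>})"
      by (rule has_real_derivative_iff_has_vector_derivative[THEN iffD1])
  qed
  then have "((\<lambda>r. \<beta> * weight \<tau> r + \<beta>0) has_integral (- ?g \<tau> - (- ?g t))) {t..\<tau>}"
    by (rule has_integral_eq[rotated]) (simp add: weight_def)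
  moreover have "- ?g \<tau> - (- ?g t) = weight \<tau> t - \<eta>" using False by (simp add: weight_def)
  moreover have "{min \<tau> t..max \<tau> t} = {t..\<tau>}" using False by auto
  ultimately show ?thesis by (simp only:)
qed

text \<open>
  At a point where \<open>N (d t) / weight \<tau> t\<close> takes its maximum \<open>m\<close>, the integral inequality reads
  \<open>m weight \<le> N (d \<tau>) + c \<theta> + m (weight - \<eta>)\<close>, and the weight cancels.
\<close>

lemma interval_estimate:
  assumes d: "continuous_on {a..b} d" and \<zeta>: "\<zeta> \<in> {a..b}" and \<tau>: "\<tau> \<in> {a..b}"
    and ab: "b - a \<le> \<theta>" and c: "0 \<le> c"
    and incr: "\<And>t J. t \<in> {a..b} \<Longrightarrow>
        ((\<lambda>r. \<beta> * N (d r) + \<beta>0 * N (d \<zeta>) + c) has_integral J) {min \<tau> t..max \<tau> t} \<Longrightarrow>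
        N (d t - d \<tau>) \<le> J"
    and t: "t \<in> {a..b}"
  shows "N (d t) \<le> (N (d \<tau>) + c * \<theta>) / \<eta>"
proof -
  have w1: "weight \<tau> r \<le> 1" if "r \<in> {a..b}" for r
    using that \<tau> ab by (intro weight_le_1) auto
  have wpos: "0 < weight \<tau> r" for r using weight_ge[of \<tau> r] eta_pos by linarith
  have cw: "continuous_on {a..b} (weight \<tau>)"
    unfolding weight_def by (intro continuous_intros) (use \<beta> in auto)
  have "continuous_on {a..b} (\<lambda>r. N (d r) / weight \<tau> r)"
    by (intro continuous_intros cw d) (use wpos in \<open>auto simp: less_imp_neq[symmetric]\<close>)
  then obtain s where s: "s \<in> {a..b}"
      "\<And>r. r \<in> {a..b} \<Longrightarrow> N (d r) / weight \<tau> r \<le> N (d s) / weight \<tau> s"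
    using continuous_attains_sup[of "{a..b}" "\<lambda>r. N (d r) / weight \<tau> r"] \<tau> by auto
  define m where "m = N (d s) / weight \<tau> s"
  have m: "0 \<le> m" using wpos[of s] by (simp add: m_def)
  have le: "N (d r) \<le> m * weight \<tau> r" if "r \<in> {a..b}" for r
    using s(2)[OF that] wpos[of r] by (simp add: m_def field_simps)
  let ?S = "{min \<tau> s..max \<tau> s}"
  have sub: "?S \<subseteq> {a..b}" using s(1) \<tau> by auto
  have "continuous_on ?S (\<lambda>r. \<beta> * N (d r) + \<beta>0 * N (d \<zeta>) + c)"
    by (intro continuous_intros continuous_on_subset[OF d sub])
  then have J: "((\<lambda>r. \<beta> * N (d r) + \<beta>0 * N (d \<zeta>) + c) has_integral
      integral ?S (\<lambda>r. \<beta> * N (d r) + \<beta>0 * N (d \<zeta>) + c)) ?S" (is "(?h has_integral ?J) ?S")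
    by (intro integrable_integral integrable_continuous_real)
  have 1: "((\<lambda>r. m * (\<beta> * weight \<tau> r + \<beta>0) + c) has_integral
      (m * (weight \<tau> s - \<eta>) + \<bar>s - \<tau>\<bar> *\<^sub>R c)) ?S"
  proof (rule has_integral_add)
    show "((\<lambda>r. m * (\<beta> * weight \<tau> r + \<beta>0)) has_integral m * (weight \<tau> s - \<eta>)) ?S"
      by (intro has_integral_mult_right weight_has_integral)
    have "\<bar>s - \<tau>\<bar> = max \<tau> s - min \<tau> s" by auto
    then show "((\<lambda>r. c) has_integral \<bar>s - \<tau>\<bar> *\<^sub>R c) ?S"
      using has_integral_const_real[of c "min \<tau> s" "max \<tau> s"] by (auto simp: min_def max_def)
  qed
  have "?J \<le> m * (weight \<tau> s - \<eta>) + \<bar>s - \<tau>\<bar> *\<^sub>R c"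
  proof (rule has_integral_le[OF J 1])
    fix r assume "r \<in> ?S"
    then have "r \<in> {a..b}" using sub by auto
    then have "\<beta> * N (d r) \<le> \<beta> * (m * weight \<tau> r)" using le \<beta> by (intro mult_left_mono) auto
    moreover have "N (d \<zeta>) \<le> m * 1"
      using order_trans[OF le[OF \<zeta>] mult_left_mono[OF w1[OF \<zeta>] m]] .
    then have "\<beta>0 * N (d \<zeta>) \<le> \<beta>0 * (m * 1)" using \<beta>0 by (intro mult_left_mono) auto
    ultimately show "?h r \<le> m * (\<beta> * weight \<tau> r + \<beta>0) + c" by (simp add: algebra_simps)
  qed
  moreover have "N (d s - d \<tau>) \<le> ?J" by (rule incr[OF s(1) J])
  moreover have "N (d s) \<le> N (d \<tau>) + N (d s - d \<tau>)" by (rule N_triangle_sub)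
  moreover have "\<bar>s - \<tau>\<bar> *\<^sub>R c \<le> c * \<theta>"
    using mult_right_mono[of "\<bar>s - \<tau>\<bar>" \<theta> c] s(1) \<tau> ab c by (auto simp: mult.commute)
  moreover have "N (d s) = m * weight \<tau> s" using wpos[of s] by (simp add: m_def)
  ultimately have "m * \<eta> \<le> N (d \<tau>) + c * \<theta>" by (simp add: algebra_simps)
  then have "m \<le> (N (d \<tau>) + c * \<theta>) / \<eta>" using eta_pos by (simp add: field_simps)
  moreover have "N (d t) \<le> m * 1"
    using order_trans[OF le[OF t] mult_left_mono[OF w1[OF t] m]] .
  ultimately show ?thesis by simp
qed

definition rate :: real where
  "rate = (\<beta> + \<beta>0) / \<eta> + 1"

lemma rate_pos: "0 < rate"
  using \<beta> \<beta>0 eta_pos by (simp add: rate_def add_nonneg_pos)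

text \<open>
  A bound by a fixed factor per interval would be useless on a long time span, since it may contain
  arbitrarily many short intervals; this one has the factor \<open>1 + O(\<bar>t - \<tau>\<bar>)\<close>.
\<close>

lemma interval_growth:
  assumes d: "continuous_on {a..b} d" and \<zeta>: "\<zeta> \<in> {a..b}" and \<tau>: "\<tau> \<in> {a..b}"
    and ab: "b - a \<le> \<theta>" and c: "0 \<le> c"
    and incr: "\<And>t J. t \<in> {a..b} \<Longrightarrow>
        ((\<lambda>r. \<beta> * N (d r) + \<beta>0 * N (d \<zeta>) + c) has_integral J) {min \<tau> t..max \<tau> t} \<Longrightarrow>
        N (d t - d \<tau>) \<le> J"
    and t: "t \<in> {a..b}"
  shows "N (d t) + c * (\<theta> + 1) \<le> exp (rate * \<bar>t - \<tau>\<bar>) * (N (d \<tau>) + c * (\<theta> + 1))"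
proof -
  define M where "M = (N (d \<tau>) + c * \<theta>) / \<eta>"
  have bound: "N (d r) \<le> M" if "r \<in> {a..b}" for r
    unfolding M_def by (rule interval_estimate[OF d \<zeta> \<tau> ab c incr that])
  let ?S = "{min \<tau> t..max \<tau> t}"
  have sub: "?S \<subseteq> {a..b}" using t \<tau> by auto
  have "continuous_on ?S (\<lambda>r. \<beta> * N (d r) + \<beta>0 * N (d \<zeta>) + c)"
    by (intro continuous_intros continuous_on_subset[OF d sub])
  then have J: "((\<lambda>r. \<beta> * N (d r) + \<beta>0 * N (d \<zeta>) + c) has_integral
      integral ?S (\<lambda>r. \<beta> * N (d r) + \<beta>0 * N (d \<zeta>) + c)) ?S" (is "(?h has_integral ?J) ?S")
    by (intro integrable_integral integrable_continuous_real)
  have "((\<lambda>_. (\<beta> + \<beta>0) * M + c) has_integral (max \<tau> t - min \<tau> t) *\<^sub>R ((\<beta> + \<beta>0) * M + c)) ?S"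
    using has_integral_const_real[of "(\<beta> + \<beta>0) * M + c" "min \<tau> t" "max \<tau> t"]
    by (auto simp: min_def max_def)
  moreover have "?h r \<le> (\<beta> + \<beta>0) * M + c" if "r \<in> ?S" for r
    unfolding distrib_right using bound[OF subsetD[OF sub that]] bound[OF \<zeta>] \<beta> \<beta>0
    by (intro add_mono mult_left_mono order_refl) auto
  ultimately have "?J \<le> (max \<tau> t - min \<tau> t) *\<^sub>R ((\<beta> + \<beta>0) * M + c)"
    by (intro has_integral_le[OF J]) auto
  moreover have "max \<tau> t - min \<tau> t = \<bar>t - \<tau>\<bar>" by auto
  ultimately have J_le: "?J \<le> \<bar>t - \<tau>\<bar> * ((\<beta> + \<beta>0) * M + c)" by simp
  have "(\<beta> + \<beta>0) * M + c \<le> rate * (N (d \<tau>) + c * (\<theta> + 1))"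
  proof -
    have "(\<beta> + \<beta>0) * M = (\<beta> + \<beta>0) / \<eta> * (N (d \<tau>) + c * \<theta>)" by (simp add: M_def)
    also have "\<dots> \<le> (\<beta> + \<beta>0) / \<eta> * (N (d \<tau>) + c * (\<theta> + 1))"
      using \<beta> \<beta>0 eta_pos c by (intro mult_left_mono) (auto simp: distrib_left)
    moreover have "c \<le> N (d \<tau>) + c * (\<theta> + 1)" using c \<theta> by (simp add: distrib_left)
    ultimately show ?thesis by (simp add: rate_def distrib_right)
  qed
  then have "\<bar>t - \<tau>\<bar> * ((\<beta> + \<beta>0) * M + c) \<le> \<bar>t - \<tau>\<bar> * (rate * (N (d \<tau>) + c * (\<theta> + 1)))"
    by (intro mult_left_mono) auto
  then have "N (d t - d \<tau>) \<le> \<bar>t - \<tau>\<bar> * (rate * (N (d \<tau>) + c * (\<theta> + 1)))"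
    using incr[OF t J] J_le by linarith
  then have "N (d t) + c * (\<theta> + 1) \<le> (1 + rate * \<bar>t - \<tau>\<bar>) * (N (d \<tau>) + c * (\<theta> + 1))"
    using N_triangle_sub[of "d t" "d \<tau>"] by (simp add: algebra_simps)
  also have "\<dots> \<le> exp (rate * \<bar>t - \<tau>\<bar>) * (N (d \<tau>) + c * (\<theta> + 1))"
    using c \<theta> by (intro mult_right_mono exp_ge_add_one_self) auto
  finally show ?thesis .
qed

lemma caratheodory_integrable_N:
  fixes G :: "real \<Rightarrow> 'a \<Rightarrow> 'a \<Rightarrow> 'a"
  assumes G: "\<And>x. (\<lambda>t. G t x y) integrable_on {a..b}"
    and lip: "\<And>t u v u' v'. t \<in> {a..b} \<Longrightarrow>
        N (G t u v - G t u' v') \<le> \<beta> * N (u - u') + \<beta>0 * N (v - v')"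
    and z: "continuous_on {a..b} z"
  shows "(\<lambda>t. G t (z t) y) integrable_on {a..b}"
proof -
  obtain C where C: "C > 0" "\<And>x. norm x \<le> C * N x" using norm_le_N by auto
  obtain C' where C': "C' > 0" "\<And>x. N x \<le> C' * norm x" using N_le_norm by auto
  show ?thesis
  proof (rule caratheodory_integrable[OF _ _ z, where G = "\<lambda>t u. G t u y"])
    show "(\<lambda>t. G t x y) integrable_on {a..b}" for x by (rule G)
  next
    fix t u u' assume t: "t \<in> {a..b}"
    have "norm (G t u y - G t u' y) \<le> C * N (G t u y - G t u' y)" by (rule C)
    also have "\<dots> \<le> C * (\<beta> * (C' * norm (u - u')))"
      using order_trans[OF lip[OF t, of u y u' y]] C C' \<beta> by (intro mult_left_mono) auto
    finally show "norm (G t u y - G t u' y) \<le> (C * \<beta> * C') * norm (u - u')" by (simp add: mult_ac)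
  qed
qed

lemma N_indefinite_integral_le:
  fixes h :: "real \<Rightarrow> 'a"
  assumes h: "h integrable_on {a..b}" and \<tau>: "\<tau> \<in> {a..b}" and t: "t \<in> {a..b}"
    and le: "\<And>r. r \<in> {min \<tau> t..max \<tau> t} \<Longrightarrow> N (h r) \<le> k r"
    and k: "(k has_integral J) {min \<tau> t..max \<tau> t}"
  shows "N (integral {a..t} h - integral {a..\<tau>} h) \<le> J"
proof -
  have "(h has_integral (integral {a..max \<tau> t} h - integral {a..min \<tau> t} h)) {min \<tau> t..max \<tau> t}"
    using \<tau> t by (intro indefinite_integral_diff[OF h]) auto
  from N_integral_le[OF this k le]
  have "N (integral {a..max \<tau> t} h - integral {a..min \<tau> t} h) \<le> J" .
  then show ?thesis by (cases "\<tau> \<le> t") (auto simp: N_minus_commute max_def min_def)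
qed

lemma interval_solution_exists:
  fixes G :: "real \<Rightarrow> 'a \<Rightarrow> 'a \<Rightarrow> 'a"
  assumes G: "\<And>x y. (\<lambda>t. G t x y) integrable_on {a..b}"
    and lip: "\<And>t u v u' v'. t \<in> {a..b} \<Longrightarrow>
        N (G t u v - G t u' v') \<le> \<beta> * N (u - u') + \<beta>0 * N (v - v')"
    and \<zeta>: "\<zeta> \<in> {a..b}" and \<tau>: "\<tau> \<in> {a..b}" and ab: "b - a \<le> \<theta>"
  obtains z where "interval_solution a b \<zeta> G z" "z \<tau> = \<xi>"
proof -
  define I where "I z t = integral {a..t} (\<lambda>s. G s (z s) (z \<zeta>))" for z t
  define \<T> where "\<T> z t = \<xi> + (I z t - I z \<tau>)" for z t
  have int: "(\<lambda>s. G s (z s) (z \<zeta>)) integrable_on {a..b}" if "continuous_on {a..b} z" for z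
    by (rule caratheodory_integrable_N[OF G lip that])
  have contI: "continuous_on {a..b} (I z)" if "continuous_on {a..b} z" for z
    unfolding I_def by (rule indefinite_integral_continuous_1[OF int[OF that]])
  obtain z where z: "continuous_on {a..b} z" "\<And>t. t \<in> {a..b} \<Longrightarrow> \<T> z t = z t"
  proof (rule weighted_contraction_fixpoint[of a b \<T> "weight \<tau>" "1 - \<eta>" \<eta>])
    show "continuous_on {a..b} (\<T> z)" if "continuous_on {a..b} z" for z
      unfolding \<T>_def by (intro continuous_intros contI that)
  next
    fix z v m t
    assume zv: "continuous_on {a..b} z" "continuous_on {a..b} v" and m: "0 \<le> m"
      and le: "\<And>t. t \<in> {a..b} \<Longrightarrow> N (z t - v t) \<le> m * weight \<tau> t" and t: "t \<in> {a..b}"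
    let ?h = "\<lambda>s. G s (z s) (z \<zeta>) - G s (v s) (v \<zeta>)"
    have h: "?h integrable_on {a..b}" by (intro integrable_diff int zv)
    have "I z r - I v r = integral {a..r} ?h" if "r \<in> {a..b}" for r
      unfolding I_def using that
      by (intro Henstock_Kurzweil_Integration.integral_diff[symmetric])
        (auto intro!: integrable_on_subinterval[OF int] zv)
    from this[OF t] this[OF \<tau>]
    have eq: "\<T> z t - \<T> v t = integral {a..t} ?h - integral {a..\<tau>} ?h"
      by (simp add: \<T>_def algebra_simps)
    have "N (integral {a..t} ?h - integral {a..\<tau>} ?h) \<le> m * (weight \<tau> t - \<eta>)"
    proof (rule N_indefinite_integral_le[OF h \<tau> t])
      show "((\<lambda>r. m * (\<beta> * weight \<tau> r + \<beta>0)) has_integral m * (weight \<tau> t - \<eta>)) {min \<tau> t..max \<tau> t}"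
        by (intro has_integral_mult_right weight_has_integral)
      fix r assume "r \<in> {min \<tau> t..max \<tau> t}"
      then have r: "r \<in> {a..b}" using t \<tau> by auto
      have "weight \<tau> \<zeta> \<le> 1" using \<zeta> \<tau> ab by (intro weight_le_1) auto
      then have z1: "N (z \<zeta> - v \<zeta>) \<le> m * 1"
        using order_trans[OF le[OF \<zeta>] mult_left_mono[OF _ m]] by blast
      have "N (?h r) \<le> \<beta> * N (z r - v r) + \<beta>0 * N (z \<zeta> - v \<zeta>)" by (rule lip[OF r])
      also have "\<dots> \<le> \<beta> * (m * weight \<tau> r) + \<beta>0 * (m * 1)"
        using le[OF r] z1 \<beta> \<beta>0 by (intro add_mono mult_left_mono) auto
      finally show "N (?h r) \<le> m * (\<beta> * weight \<tau> r + \<beta>0)" by (simp add: algebra_simps)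
    qed
    also have "\<dots> \<le> m * ((1 - \<eta>) * weight \<tau> t)"
    proof (rule mult_left_mono[OF _ m])
      have "weight \<tau> t \<le> 1" using t \<tau> ab by (intro weight_le_1) auto
      then have "\<eta> * weight \<tau> t \<le> \<eta> * 1" using eta_pos by (intro mult_left_mono) auto
      then show "weight \<tau> t - \<eta> \<le> (1 - \<eta>) * weight \<tau> t" by (simp add: algebra_simps)
    qed
    finally show "N (\<T> z t - \<T> v t) \<le> (1 - \<eta>) * m * weight \<tau> t"
      unfolding eq by (simp add: mult_ac)
  next
    show "weight \<tau> t \<le> 1" if "t \<in> {a..b}" for t
      using that \<tau> ab by (intro weight_le_1) auto
  qed (use eta_pos eta_le_1 weight_ge in auto)
  have "interval_solution a b \<zeta> G z"
    unfolding interval_solution_def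
  proof (intro conjI z(1) ballI)
    fix t assume t: "t \<in> {a..b}"
    then have a: "a \<in> {a..b}" by auto
    have "z t - z a = I z t"
      unfolding z(2)[OF t, symmetric] z(2)[OF a, symmetric] by (simp add: \<T>_def I_def)
    then show "((\<lambda>s. G s (z s) (z \<zeta>)) has_integral z t - z a) {a..t}"
      unfolding I_def using t
      by (auto intro!: integrable_integral integrable_on_subinterval[OF int[OF z(1)]])
  qed
  moreover have "z \<tau> = \<xi>" using z(2)[OF \<tau>] by (simp add: \<T>_def)
  ultimately show thesis by (rule that)
qed

end

section \<open>Solutions on the whole line\<close>

lemma interval_solution_cong:
  assumes "interval_solution a b \<zeta> G z" and "\<And>t. t \<in> {a..b} \<Longrightarrow> w t = z t"
    and "\<And>t. t \<in> {a..b} \<Longrightarrow> H t (z t) (z \<zeta>) = G t (z t) (z \<zeta>)" and "\<zeta> \<in> {a..b}"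
  shows "interval_solution a b \<zeta> H w"
  unfolding interval_solution_def
proof (intro conjI ballI)
  show "continuous_on {a..b} w"
    using assms(1,2) continuous_on_cong unfolding interval_solution_def by metis
  fix t assume t: "t \<in> {a..b}"
  then have "((\<lambda>s. G s (z s) (z \<zeta>)) has_integral z t - z a) {a..t}"
    using assms(1) by (simp add: interval_solution_def)
  then have "((\<lambda>s. H s (w s) (w \<zeta>)) has_integral z t - z a) {a..t}"
    by (rule has_integral_eq[rotated]) (use assms(2-4) t in auto)
  moreover have "w t = z t" "w a = z a" using t by (auto intro!: assms(2))
  ultimately show "((\<lambda>s. H s (w s) (w \<zeta>)) has_integral w t - w a) {a..t}" by simp
qed

lemma interval_solution_diff:
  assumes "interval_solution a b \<zeta> G z" "interval_solution a b \<zeta> H w"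
    and "\<And>t. t \<in> {a..b} \<Longrightarrow> D t (z t - w t) (z \<zeta> - w \<zeta>) = G t (z t) (z \<zeta>) - H t (w t) (w \<zeta>)"
  shows "interval_solution a b \<zeta> D (\<lambda>t. z t - w t)"
  unfolding interval_solution_def
proof (intro conjI ballI)
  show "continuous_on {a..b} (\<lambda>t. z t - w t)"
    using assms by (auto simp: interval_solution_def intro: continuous_on_diff)
  fix t assume t: "t \<in> {a..b}"
  have "((\<lambda>s. G s (z s) (z \<zeta>) - H s (w s) (w \<zeta>)) has_integral (z t - z a) - (w t - w a)) {a..t}"
    using assms t by (intro has_integral_diff) (auto simp: interval_solution_def)
  then have "((\<lambda>s. D s (z s - w s) (z \<zeta> - w \<zeta>)) has_integral (z t - z a) - (w t - w a)) {a..t}"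
    by (rule has_integral_eq[rotated]) (use assms(3) t in auto)
  then show "((\<lambda>s. D s (z s - w s) (z \<zeta> - w \<zeta>)) has_integral z t - w t - (z a - w a)) {a..t}"
    by (simp add: algebra_simps)
qed

lemma (in normed) interval_solution_increment:
  assumes z: "interval_solution a b \<zeta> G z" and \<tau>: "\<tau> \<in> {a..b}" and t: "t \<in> {a..b}"
    and k: "(k has_integral J) {min \<tau> t..max \<tau> t}"
    and le: "\<And>r. r \<in> {a..b} \<Longrightarrow> N (G r (z r) (z \<zeta>)) \<le> k r"
  shows "N (z t - z \<tau>) \<le> J"
proof -
  have "((\<lambda>r. G r (z r) (z \<zeta>)) has_integral z (max \<tau> t) - z (min \<tau> t)) {min \<tau> t..max \<tau> t}"
    by (rule interval_solution_has_integral[OF z]) (use \<tau> t in auto)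
  then have "N (z (max \<tau> t) - z (min \<tau> t)) \<le> J"
  proof (rule N_integral_le[OF _ k])
    fix r assume "r \<in> {min \<tau> t..max \<tau> t}"
    then have "r \<in> {a..b}" using \<tau> t by auto
    then show "N (G r (z r) (z \<zeta>)) \<le> k r" by (rule le)
  qed
  then show ?thesis by (cases "\<tau> \<le> t") (auto simp: N_minus_commute max_def min_def)
qed

lemma bi_infinite_choice:
  fixes R :: "int \<Rightarrow> 'a \<Rightarrow> 'a \<Rightarrow> bool"
  assumes up: "\<And>i x. \<exists>y. R i x y" and down: "\<And>i y. \<exists>x. R i x y"
  obtains a where "a k = x0" "\<And>i. R i (a i) (a (i + 1))"
proof -
  define u where "u = rec_nat x0 (\<lambda>n x. SOME y. R (k + int n) x y)"
  define d where "d = rec_nat x0 (\<lambda>n y. SOME x. R (k - 1 - int n) x y)"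
  have u: "R (k + int n) (u n) (u (Suc n))" for n
    using someI_ex[OF up[of "k + int n" "u n"]] by (simp add: u_def)
  have d: "R (k - 1 - int n) (d (Suc n)) (d n)" for n
    using someI_ex[OF down[of "k - 1 - int n" "d n"]] by (simp add: d_def)
  have ud: "u 0 = x0" "d 0 = x0" by (simp_all add: u_def d_def)
  define a where "a i = (if k \<le> i then u (nat (i - k)) else d (nat (k - i)))" for i
  show thesis
  proof
    show "a k = x0" by (simp add: a_def ud)
    fix i
    show "R i (a i) (a (i + 1))"
    proof (cases "k \<le> i")
      case True
      then have "nat (i + 1 - k) = Suc (nat (i - k))" by simp
      then show ?thesis using u[of "nat (i - k)"] True by (simp add: a_def)
    next
      case False
      define n where "n = nat (k - 1 - i)"
      have n: "i = k - 1 - int n" "nat (k - i) = Suc n" using False by (auto simp: n_def)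
      have "a i = d (Suc n)" using False n by (simp add: a_def)
      moreover have "a (i + 1) = d n"
      proof (cases "n = 0")
        case True
        then show ?thesis using n ud by (simp add: a_def)
      next
        case False
        then have "\<not> k \<le> i + 1" "nat (k - (i + 1)) = n" using n by auto
        then show ?thesis by (simp add: a_def)
      qed
      ultimately show ?thesis using d[of n] n by simp
    qed
  qed
qed

locale grid =
  fixes T \<zeta> :: "int \<Rightarrow> real" and \<gamma> :: "real \<Rightarrow> real" and \<theta> :: real
  assumes pca: "piecewise_constant_argument T \<zeta> \<gamma> \<theta>"
begin

abbreviation cell :: "int \<Rightarrow> real set" where
  "cell i \<equiv> {T i..T (i + 1)}"

lemma T_less: "T i < T (i + 1)"
  and zeta_cell: "\<zeta> i \<in> cell i"
  and gamma_eq: "t \<in> {T i..<T (i + 1)} \<Longrightarrow> \<gamma> t = \<zeta> i"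
  and \<theta>: "0 < \<theta>"
  and cell_length: "T (i + 1) - T i \<le> \<theta>"
  using pca by (auto simp: piecewise_constant_argument_def)

lemma T_mono: "i \<le> j \<Longrightarrow> T i \<le> T j"
proof (induction j rule: int_ge_induct)
  case (step j)
  then show ?case using T_less[of j] by linarith
qed simp

lemma T_in_cell: "T i \<in> cell i" "T (i + 1) \<in> cell i"
  using T_less[of i] by auto

lemma T_unbounded_below: "\<exists>i. \<forall>j\<le>i. T j \<le> t"
proof -
  have "filterlim T at_bot at_bot" using pca by (simp add: piecewise_constant_argument_def)
  then have "\<forall>\<^sub>F i in at_bot. T i \<le> t" by (simp add: filterlim_at_bot)
  then show ?thesis by (simp add: eventually_at_bot_linorder)
qed

lemma T_unbounded_above: "\<exists>i. \<forall>j\<ge>i. t \<le> T j"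
proof -
  have "filterlim T at_top at_top" using pca by (simp add: piecewise_constant_argument_def)
  then have "\<forall>\<^sub>F i in at_top. t \<le> T i" by (simp add: filterlim_at_top)
  then show ?thesis by (simp add: eventually_at_top_linorder)
qed

lemma cell_cover: "\<exists>i. t \<in> {T i..<T (i + 1)}"
proof -
  obtain i where i: "T i \<le> t" using T_unbounded_below by blast
  obtain j where j: "t + 1 \<le> T j" using T_unbounded_above by blast
  have ij: "i \<le> j" using i j T_mono[of j i] by linarith
  define n where "n = (LEAST n. t < T (i + int n))"
  have "t < T (i + int (nat (j - i)))" using j ij by simp
  then have n: "t < T (i + int n)" unfolding n_def by (rule LeastI)
  have "n \<noteq> 0" using n i by (metis add_0_right int_ops(1) not_less)
  then obtain m where m: "n = Suc m" using not0_implies_Suc by blast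
  have "T (i + int m) \<le> t" using not_less_Least[of m "\<lambda>n. t < T (i + int n)"] m
    by (simp add: n_def)
  moreover have "i + int n = i + int m + 1" using m by simp
  ultimately show ?thesis using n by (intro exI[of _ "i + int m"]) (simp only: atLeastLessThan_iff simp_thms)
qed

lemma cell_coverE: obtains i where "t \<in> cell i" "T i \<le> t" "t < T (i + 1)"
  using cell_cover[of t] by auto

lemma cell_unique:
  assumes "t \<in> {T i..<T (i + 1)}" "t \<in> {T j..<T (j + 1)}"
  shows "i = j"
  using assms T_mono[of "i + 1" j] T_mono[of "j + 1" i] by (cases i j rule: linorder_cases) auto

lemma cell_order:
  assumes "s \<in> cell i" "t \<in> cell j" "s < t"
  shows "i \<le> j"
  using assms T_mono[of "j + 1" i] by (cases "i \<le> j") auto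

lemma continuous_on_cells:
  fixes z :: "real \<Rightarrow> 'a::euclidean_space"
  assumes "\<And>i. continuous_on (cell i) z"
  shows "continuous_on UNIV z"
proof (rule continuous_at_imp_continuous_on, intro ballI)
  fix t :: real
  obtain i where i: "T i \<le> t" "t < T (i + 1)" using cell_coverE by blast
  have "continuous_on (cell (i - 1) \<union> cell i) z"
    using assms[of "i - 1"] assms[of i] by (intro continuous_on_closed_Un) auto
  then have "continuous_on {T (i - 1)<..<T (i + 1)} z"
    by (rule continuous_on_subset) auto
  then show "isCont z t"
    using i T_less[of "i - 1"] by (simp add: continuous_on_eq_continuous_at)
qed

text \<open>
  At the right end of a cell \<open>\<gamma>\<close> already has its next value; a single point does not affect the
  integral.
\<close>

lemma depca_solution_iff_interval:
  "depca_solution T \<gamma> F z \<longleftrightarrow> (\<forall>i. interval_solution (T i) (T (i + 1)) (\<zeta> i) F z)"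
proof -
  have iff: "((\<lambda>s. F s (z s) (z (\<gamma> s))) has_integral y) {T i..t} \<longleftrightarrow>
      ((\<lambda>s. F s (z s) (z (\<zeta> i))) has_integral y) {T i..t}" if "t \<in> cell i" for i t y
  proof (rule has_integral_spike_eq[OF negligible_sing[of "T (i + 1)"]])
    fix s assume "s \<in> {T i..t} - {T (i + 1)}"
    then have "\<gamma> s = \<zeta> i" using that by (intro gamma_eq) auto
    then show "F s (z s) (z (\<zeta> i)) = F s (z s) (z (\<gamma> s))" by simp
  qed
  show ?thesis
    unfolding depca_solution_def interval_solution_def
    using iff continuous_on_cells[of z] continuous_on_subset[of UNIV z] by blast
qed

text \<open>
  The exponents add up, because the grid points passed on the way from \<open>s\<close> to \<open>t\<close> are ordered. Only the
  cells between \<open>s\<close> and \<open>t\<close> enter; this matters for functions that solve an equation on a half-line.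
\<close>

lemma exponential_chain:
  assumes local: "\<And>k s t. i \<le> k \<Longrightarrow> k \<le> j \<Longrightarrow> s \<in> cell k \<Longrightarrow> t \<in> cell k \<Longrightarrow>
      \<Phi> t \<le> exp (C * \<bar>t - s\<bar>) * \<Phi> s"
    and ij: "i \<le> j" and s: "s \<in> cell i" and t: "t \<in> cell j" and st: "s \<le> t"
  shows "\<Phi> t \<le> exp (C * (t - s)) * \<Phi> s \<and> \<Phi> s \<le> exp (C * (t - s)) * (\<Phi> t :: real)"
  using ij local t st
proof (induction j arbitrary: t rule: int_ge_induct)
  case base
  then show ?case
    using base.prems(1)[of i s t] base.prems(1)[of i t s] s by (simp add: abs_minus_commute)
next
  case (step j)
  let ?r = "T (j + 1)"
  have r: "?r \<in> cell j" "?r \<in> cell (j + 1)" "s \<le> ?r" "?r \<le> t"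
    using T_in_cell s step.prems(2) T_mono[of "i + 1" "j + 1"] step.hyps by auto
  have IH: "\<Phi> ?r \<le> exp (C * (?r - s)) * \<Phi> s \<and> \<Phi> s \<le> exp (C * (?r - s)) * \<Phi> ?r"
    by (rule step.IH[OF _ r(1,3)]) (use step.prems(1) in auto)
  have 1: "\<Phi> t \<le> exp (C * (t - ?r)) * \<Phi> ?r" "\<Phi> ?r \<le> exp (C * (t - ?r)) * \<Phi> t"
    using step.prems(1)[of "j + 1" ?r t] step.prems(1)[of "j + 1" t ?r] step.prems(2) step.hyps r
    by (auto simp: abs_minus_commute)
  have split: "exp (C * (t - s)) = exp (C * (t - ?r)) * exp (C * (?r - s))"
    by (simp add: algebra_simps flip: exp_add)
  have "exp (C * (t - ?r)) * \<Phi> ?r \<le> exp (C * (t - ?r)) * (exp (C * (?r - s)) * \<Phi> s)"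
    "exp (C * (?r - s)) * \<Phi> ?r \<le> exp (C * (?r - s)) * (exp (C * (t - ?r)) * \<Phi> t)"
    using IH 1 by (auto intro!: mult_left_mono)
  then have "\<Phi> t \<le> exp (C * (t - ?r)) * (exp (C * (?r - s)) * \<Phi> s)"
    "\<Phi> s \<le> exp (C * (?r - s)) * (exp (C * (t - ?r)) * \<Phi> t)"
    using IH 1 by linarith+
  then show ?case unfolding split by (simp only: mult_ac simp_thms)
qed

lemma exponential_growth_on_line:
  fixes \<Phi> :: "real \<Rightarrow> real"
  assumes local: "\<And>k s t. s \<in> cell k \<Longrightarrow> t \<in> cell k \<Longrightarrow> \<Phi> t \<le> exp (C * \<bar>t - s\<bar>) * \<Phi> s"
  shows "\<Phi> t \<le> exp (C * \<bar>t - s\<bar>) * \<Phi> s"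
proof -
  have le: "\<Phi> v \<le> exp (C * (v - u)) * \<Phi> u \<and> \<Phi> u \<le> exp (C * (v - u)) * \<Phi> v" if uv: "u < v" for u v
  proof -
    obtain i j where "u \<in> cell i" "v \<in> cell j" using cell_coverE by metis
    then show ?thesis
      using exponential_chain[of i j \<Phi> C u v] cell_order[of u i v j] uv local by simp
  qed
  show ?thesis using le[of s t] le[of t s] by (cases s t rule: linorder_cases) auto
qed

end

text \<open>
  Two-parameter families of homeomorphisms of the state space with growth controlled uniformly on
  time spans of bounded length.
\<close>

locale evolution =
  fixes U :: "real \<Rightarrow> real \<Rightarrow> 'a::euclidean_space \<Rightarrow> 'a"
  assumes refl [simp]: "U t t x = x"
    and cocycle [simp]: "U t s (U s r x) = U t r x"
    and cont_time_space: "continuous_on UNIV (\<lambda>(t, x). U t s x)"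
    and cont_init_space: "continuous_on UNIV (\<lambda>(s, x). U t s x)"
    and bounded_growth: "\<exists>r'. \<forall>t s x. \<bar>t - s\<bar> \<le> S \<longrightarrow> norm x \<le> r \<longrightarrow> norm (U t s x) \<le> r'"
begin

lemma cont_space: "continuous_on UNIV (U t s)"
  using continuous_on_compose2[OF cont_time_space[of s], of UNIV "\<lambda>x. (t, x)"]
  by (simp add: continuous_on_Pair continuous_on_id)

end

text \<open>
  Here \<open>\<beta>\<close> and \<open>\<beta>0\<close> are Lipschitz constants of the whole right-hand side in its two arguments, so that
  linear, perturbed and cut-off equations are instances of the same locale.
\<close>

locale depca = grid T \<zeta> \<gamma> \<theta> + interval_ivp N \<theta> \<beta> \<beta>0
  for N :: "'a::euclidean_space \<Rightarrow> real" and T \<zeta> \<gamma> \<theta> \<beta> \<beta>0 +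
  fixes F :: "real \<Rightarrow> 'a \<Rightarrow> 'a \<Rightarrow> 'a" and c :: real
  assumes F_integrable: "(\<lambda>t. F t x y) integrable_on {a..b}"
    and F_lipschitz: "N (F t u v - F t u' v') \<le> \<beta> * N (u - u') + \<beta>0 * N (v - v')"
    and F_zero: "N (F t 0 0) \<le> c"
begin

lemma c_nonneg: "0 \<le> c"
  using F_zero N_nonneg order_trans by blast

abbreviation cell_solution :: "int \<Rightarrow> (real \<Rightarrow> 'a) \<Rightarrow> bool" where
  "cell_solution i \<equiv> interval_solution (T i) (T (i + 1)) (\<zeta> i) F"

lemma cell_solution_exists:
  assumes "\<tau> \<in> cell i"
  obtains z where "cell_solution i z" "z \<tau> = \<xi>"
  using interval_solution_exists[OF F_integrable F_lipschitz zeta_cell assms cell_length] by blast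

lemma cell_solution_growth:
  assumes d: "interval_solution (T i) (T (i + 1)) (\<zeta> i) G d" and e: "0 \<le> e"
    and G: "\<And>r. N (G r (d r) (d (\<zeta> i))) \<le> \<beta> * N (d r) + \<beta>0 * N (d (\<zeta> i)) + e"
    and s: "s \<in> cell i" and t: "t \<in> cell i"
  shows "N (d t) + e * (\<theta> + 1) \<le> exp (rate * \<bar>t - s\<bar>) * (N (d s) + e * (\<theta> + 1))"
proof (rule interval_growth[OF _ zeta_cell s cell_length e _ t])
  show "continuous_on (cell i) d" using d by (simp add: interval_solution_def)
  fix t J assume t: "t \<in> cell i"
    and J: "((\<lambda>r. \<beta> * N (d r) + \<beta>0 * N (d (\<zeta> i)) + e) has_integral J) {min s t..max s t}"
  show "N (d t - d s) \<le> J" by (rule interval_solution_increment[OF d s t J G])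
qed

lemma cell_growth:
  assumes z: "cell_solution i z" and st: "s \<in> cell i" "t \<in> cell i"
  shows "N (z t) + c * (\<theta> + 1) \<le> exp (rate * \<bar>t - s\<bar>) * (N (z s) + c * (\<theta> + 1))"
proof (rule cell_solution_growth[OF z c_nonneg _ st])
  show "N (F r (z r) (z (\<zeta> i))) \<le> \<beta> * N (z r) + \<beta>0 * N (z (\<zeta> i)) + c" for r
    using N_triangle_sub[of "F r (z r) (z (\<zeta> i))" "F r 0 0"]
      F_lipschitz[of r "z r" "z (\<zeta> i)" 0 0] F_zero[of r] by simp
qed

lemma cell_diff_growth:
  assumes "cell_solution i z" "cell_solution i w" and st: "s \<in> cell i" "t \<in> cell i"
  shows "N (z t - w t) \<le> exp (rate * \<bar>t - s\<bar>) * N (z s - w s)"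
  using cell_solution_growth[OF interval_solution_diff[OF assms(1,2)
        , of "\<lambda>r _ _. F r (z r) (z (\<zeta> i)) - F r (w r) (w (\<zeta> i))"] order_refl _ st] F_lipschitz
  by simp

lemma forward_uniqueness:
  assumes z: "\<And>k. i \<le> k \<Longrightarrow> cell_solution k z" and w: "\<And>k. i \<le> k \<Longrightarrow> cell_solution k w"
    and s: "s \<in> cell i" and eq: "z s = w s" and st: "s \<le> t"
  shows "z t = w t"
proof (cases "s = t")
  case False
  obtain j where j: "t \<in> cell j" using cell_coverE by blast
  have "i \<le> j" using cell_order[OF s j] st False by simp
  then have "N (z t - w t) \<le> exp (rate * (t - s)) * N (z s - w s)"
    using exponential_chain[of i j "\<lambda>t. N (z t - w t)" rate s t] cell_diff_growth[OF z w] s j st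
    by blast
  then show ?thesis using eq by simp
qed (use eq in simp)

lemma solution_diff_growth:
  assumes z: "depca_solution T \<gamma> F z" and w: "depca_solution T \<gamma> F w"
  shows "N (z t - w t) \<le> exp (rate * \<bar>t - s\<bar>) * N (z s - w s)"
  using exponential_growth_on_line[where \<Phi> = "\<lambda>t. N (z t - w t)"] cell_diff_growth z w
    depca_solution_iff_interval by blast

lemma solution_growth:
  assumes z: "depca_solution T \<gamma> F z"
  shows "N (z t) + c * (\<theta> + 1) \<le> exp (rate * \<bar>t - s\<bar>) * (N (z s) + c * (\<theta> + 1))"
  using exponential_growth_on_line[where \<Phi> = "\<lambda>t. N (z t) + c * (\<theta> + 1)"] cell_growth z
    depca_solution_iff_interval by blast

text \<open>The pieces on the cells are joined, in both directions, at the common end points.\<close>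

lemma solution_exists: "\<exists>z. depca_solution T \<gamma> F z \<and> z \<tau> = \<xi>"
proof -
  obtain k where k: "\<tau> \<in> cell k" using cell_coverE by blast
  obtain z0 where z0: "cell_solution k z0" "z0 \<tau> = \<xi>" using cell_solution_exists[OF k] by blast
  define R where "R i x y \<longleftrightarrow> (\<exists>z. cell_solution i z \<and> z (T i) = x \<and> z (T (i + 1)) = y)" for i x y
  obtain a where a: "a k = z0 (T k)" "\<And>i. R i (a i) (a (i + 1))"
  proof (rule bi_infinite_choice[of R k "z0 (T k)"])
    show "\<exists>y. R i x y" for i x
      using cell_solution_exists[OF T_in_cell(1)[of i], of x] unfolding R_def by metis
    show "\<exists>x. R i x y" for i y
      using cell_solution_exists[OF T_in_cell(2)[of i], of y] unfolding R_def by metis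
  qed blast
  then obtain Y where Y: "\<And>i. cell_solution i (Y i)" "\<And>i. Y i (T i) = a i" "\<And>i. Y i (T (i + 1)) = a (i + 1)"
    unfolding R_def by metis
  define idx where "idx t = (SOME i. t \<in> {T i..<T (i + 1)})" for t
  have idx: "idx t = i" if "t \<in> {T i..<T (i + 1)}" for t i
    using someI[of "\<lambda>i. t \<in> {T i..<T (i + 1)}", OF that] that cell_unique unfolding idx_def by blast
  define z where "z t = Y (idx t) t" for t
  have zY: "z t = Y i t" if "t \<in> cell i" for i t
  proof (cases "t = T (i + 1)")
    case True
    then have "idx t = i + 1" using T_less[of "i + 1"] by (intro idx) auto
    then show ?thesis using True Y(2)[of "i + 1"] Y(3)[of i] by (simp add: z_def)
  next
    case False
    then have "idx t = i" using that by (intro idx) auto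
    then show ?thesis by (simp add: z_def)
  qed
  have "cell_solution i z" for i
    by (rule interval_solution_cong[OF Y(1)]) (use zY zeta_cell in auto)
  then have "depca_solution T \<gamma> F z" using depca_solution_iff_interval by blast
  moreover have "N (Y k \<tau> - z0 \<tau>) \<le> exp (rate * \<bar>\<tau> - T k\<bar>) * N (Y k (T k) - z0 (T k))"
    by (rule cell_diff_growth[OF Y(1) z0(1) T_in_cell(1) k])
  then have "z \<tau> = \<xi>"
    using zY[OF k] Y(2)[of k] a(1) z0(2) by simp
  ultimately show ?thesis by blast
qed

definition flow :: "real \<Rightarrow> real \<Rightarrow> 'a \<Rightarrow> 'a" where
  "flow t s x = (SOME z. depca_solution T \<gamma> F z \<and> z s = x) t"

lemma flow_solution: "depca_solution T \<gamma> F (\<lambda>t. flow t s x)"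
  and flow_refl [simp]: "flow s s x = x"
  using someI_ex[OF solution_exists[of s x]] by (simp_all add: flow_def)

lemma flow_unique:
  assumes "depca_solution T \<gamma> F z"
  shows "flow t s (z s) = z t"
  using solution_diff_growth[OF flow_solution[of s "z s"] assms, of t s] by simp

lemma flow_cocycle [simp]: "flow t s (flow s r x) = flow t r x"
  by (rule flow_unique[OF flow_solution])

lemma flow_lipschitz: "N (flow t s x - flow t s y) \<le> exp (rate * \<bar>t - s\<bar>) * N (x - y)"
  using solution_diff_growth[OF flow_solution[of s x] flow_solution[of s y], of t s] by simp

lemma flow_cont_time: "continuous_on UNIV (\<lambda>t. flow t s x)"
  using flow_solution[of s x] by (simp add: depca_solution_def)

lemma flow_continuous_in_time: "continuous_on UNIV (\<lambda>(t, x). flow t s x)"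
proof (rule continuous_at_imp_continuous_on, intro ballI)
  fix p :: "real \<times> 'a"
  obtain t0 x0 where p: "p = (t0, x0)" by fastforce
  have "((\<lambda>q. flow (fst q) s (snd q) - flow (fst q) s x0) \<longlongrightarrow> 0) (at p)"
  proof (subst N_tendsto_0[symmetric], rule Lim_null_comparison)
    show "\<forall>\<^sub>F q in at p. norm (N (flow (fst q) s (snd q) - flow (fst q) s x0))
        \<le> exp (rate * \<bar>fst q - s\<bar>) * N (snd q - x0)"
      using flow_lipschitz by (intro always_eventually allI) simp
    have "((\<lambda>q. exp (rate * \<bar>fst q - s\<bar>) * N (snd q - x0)) \<longlongrightarrow> exp (rate * \<bar>fst p - s\<bar>) * N (snd p - x0)) (at p)"
      by (intro tendsto_intros tendsto_N)
    then show "((\<lambda>q. exp (rate * \<bar>fst q - s\<bar>) * N (snd q - x0)) \<longlongrightarrow> 0) (at p)" by (simp add: p)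
  qed
  moreover have "((\<lambda>q. flow (fst q) s x0) \<longlongrightarrow> flow t0 s x0) (at p)"
  proof (rule isCont_tendsto_compose[where g = "\<lambda>t. flow t s x0"])
    show "isCont (\<lambda>t. flow t s x0) t0"
      using flow_cont_time[of s x0] by (simp add: continuous_on_eq_continuous_at)
    show "(fst \<longlongrightarrow> t0) (at p)" using tendsto_fst[OF tendsto_ident_at[of p]] by (simp add: p)
  qed
  ultimately have "((\<lambda>q. (flow (fst q) s (snd q) - flow (fst q) s x0) + flow (fst q) s x0) \<longlongrightarrow> 0 + flow t0 s x0) (at p)"
    by (rule tendsto_add)
  then show "isCont (\<lambda>(t, x). flow t s x) p"
    unfolding isCont_def p by (simp add: split_def)
qed

text \<open>
  The initial time is moved along the orbit through the limit point: comparing \<open>(s, x)\<close> with the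
  point of that orbit at time \<open>s\<close> reduces the claim to the Lipschitz estimate for a fixed initial time.
\<close>

lemma flow_continuous_in_init: "continuous_on UNIV (\<lambda>(s, x). flow t s x)"
proof (rule continuous_at_imp_continuous_on, intro ballI)
  fix p :: "real \<times> 'a"
  obtain s0 x0 where p: "p = (s0, x0)" by fastforce
  define y where "y = flow t s0 x0"
  have "((\<lambda>q. flow t (fst q) (snd q) - y) \<longlongrightarrow> 0) (at p)"
  proof (subst N_tendsto_0[symmetric], rule Lim_null_comparison)
    have "N (flow t (fst q) (snd q) - flow t (fst q) (flow (fst q) t y))
        \<le> exp (rate * \<bar>t - fst q\<bar>) * N (snd q - flow (fst q) t y)" for q
      by (rule flow_lipschitz)
    then show "\<forall>\<^sub>F q in at p. norm (N (flow t (fst q) (snd q) - y))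
        \<le> exp (rate * \<bar>t - fst q\<bar>) * N (snd q - flow (fst q) t y)"
      by (intro always_eventually allI) simp
    have 1: "((\<lambda>q. flow (fst q) t y) \<longlongrightarrow> flow (fst p) t y) (at p)"
      by (rule isCont_tendsto_compose[where g = "\<lambda>s. flow s t y", OF _ tendsto_fst[OF tendsto_ident_at]])
        (use flow_cont_time[of t y] in \<open>simp add: continuous_on_eq_continuous_at\<close>)
    have "((\<lambda>q. exp (rate * \<bar>t - fst q\<bar>) * N (snd q - flow (fst q) t y))
        \<longlongrightarrow> exp (rate * \<bar>t - fst p\<bar>) * N (snd p - flow (fst p) t y)) (at p)"
      by (intro tendsto_intros tendsto_N 1)
    then show "((\<lambda>q. exp (rate * \<bar>t - fst q\<bar>) * N (snd q - flow (fst q) t y)) \<longlongrightarrow> 0) (at p)"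
      by (simp add: p y_def)
  qed
  then have "((\<lambda>q. flow t (fst q) (snd q)) \<longlongrightarrow> y) (at p)" by (rule LIM_zero_cancel)
  then show "isCont (\<lambda>(s, x). flow t s x) p"
    unfolding isCont_def p y_def by (simp add: split_def)
qed

lemma flow_bounded_growth: "\<exists>r'. \<forall>t s x. \<bar>t - s\<bar> \<le> S \<longrightarrow> norm x \<le> r \<longrightarrow> norm (flow t s x) \<le> r'"
proof -
  obtain C where C: "C > 0" "\<And>x. norm x \<le> C * N x" using norm_le_N by auto
  obtain C' where C': "C' > 0" "\<And>x. N x \<le> C' * norm x" using N_le_norm by auto
  have "norm (flow t s x) \<le> C * (exp (rate * S) * (C' * r + c * (\<theta> + 1)))"
    if ts: "\<bar>t - s\<bar> \<le> S" and x: "norm x \<le> r" for t s x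
  proof -
    have "N (flow t s x) + c * (\<theta> + 1) \<le> exp (rate * \<bar>t - s\<bar>) * (N x + c * (\<theta> + 1))"
      using solution_growth[OF flow_solution[of s x], of t s] by simp
    also have "\<dots> \<le> exp (rate * S) * (C' * r + c * (\<theta> + 1))"
    proof (rule mult_mono)
      show "exp (rate * \<bar>t - s\<bar>) \<le> exp (rate * S)" using ts rate_pos by simp
      show "N x + c * (\<theta> + 1) \<le> C' * r + c * (\<theta> + 1)"
        using order_trans[OF C'(2) mult_left_mono[OF x, of C']] C' by simp
      show "0 \<le> N x + c * (\<theta> + 1)" using c_nonneg \<theta> by simp
    qed simp
    finally have "N (flow t s x) \<le> exp (rate * S) * (C' * r + c * (\<theta> + 1))"
      using mult_nonneg_nonneg[OF c_nonneg, of "\<theta> + 1"] \<theta> by linarith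
    then show ?thesis
      using order_trans[OF C(2) mult_left_mono] C(1) by simp
  qed
  then show ?thesis by blast
qed

sublocale evolution flow
  by unfold_locales
    (rule flow_refl flow_cocycle flow_continuous_in_time flow_continuous_in_init flow_bounded_growth)+

end

section \<open>Linear equations with exponential estimates in one time direction\<close>

lemma matrix_vector_integrable:
  fixes M :: "real \<Rightarrow> real^'n^'n"
  assumes "M absolutely_integrable_on {a..b}"
  shows "(\<lambda>t. M t *v x) integrable_on {a..b}"
proof -
  have "linear (\<lambda>M :: real^'n^'n. M *v x)"
    by (rule linearI) (simp_all add: matrix_vector_mult_add_rdistrib scaleR_matrix_vector_assoc)
  then have "bounded_linear (\<lambda>M :: real^'n^'n. M *v x)" by (simp add: linear_conv_bounded_linear)
  from integrable_linear[OF set_lebesgue_integral_eq_integral(1)[OF assms] this]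
  show ?thesis by (simp add: o_def)
qed

lemma exp_decrement_ge:
  fixes \<alpha> :: real
  assumes "0 < \<alpha>" "0 \<le> \<Delta>" "\<Delta> \<le> \<theta>"
  shows "\<alpha> * exp (- \<alpha> * \<theta>) * \<Delta> \<le> 1 - exp (- \<alpha> * \<Delta>)"
proof -
  have "\<alpha> * exp (- \<alpha> * \<theta>) * \<Delta> = exp (- \<alpha> * \<theta>) * (\<alpha> * \<Delta>)" by simp
  also have "\<dots> \<le> exp (- \<alpha> * \<Delta>) * (\<alpha> * \<Delta>)"
    using assms by (intro mult_right_mono) auto
  also have "\<dots> \<le> exp (- \<alpha> * \<Delta>) * (exp (\<alpha> * \<Delta>) - 1)"
  proof (rule mult_left_mono)
    show "\<alpha> * \<Delta> \<le> exp (\<alpha> * \<Delta>) - 1" using exp_ge_add_one_self[of "\<alpha> * \<Delta>"] by linarith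
  qed simp
  also have "\<dots> = 1 - exp (- \<alpha> * \<Delta>)" by (simp add: right_diff_distrib flip: exp_add)
  finally show ?thesis .
qed

lemma two_mult_le_exp:
  fixes x :: real
  assumes "0 \<le> x"
  shows "2 * x \<le> exp x"
proof -
  have "0 \<le> (x - 1)\<^sup>2" by simp
  then have "2 * x \<le> 1 + x + x\<^sup>2 / 2"
    using zero_le_power2[of x] by (simp add: power2_eq_square algebra_simps)
  also have "\<dots> \<le> exp x" using assms by (rule exp_lower_Taylor_quadratic)
  finally show ?thesis .
qed

text \<open>
  With \<open>\<sigma> = 1\<close> the estimate is the one for the contracting block, with \<open>\<sigma> = - 1\<close> the one for the
  expanding block, so that both blocks are treated at once.
\<close>

locale dichotomy = grid T \<zeta> \<gamma> \<theta> + interval_ivp N \<theta> \<beta> \<beta>0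
  for N :: "real^'n \<Rightarrow> real" and T \<zeta> \<gamma> \<theta> \<beta> \<beta>0 +
  fixes A A0 :: "real \<Rightarrow> real^'n^'n" and Z :: "real \<Rightarrow> real \<Rightarrow> real^'n^'n"
    and \<sigma> K \<alpha> \<rho> :: real
  assumes A_integrable: "A absolutely_integrable_on {a..b}"
    and A0_integrable: "A0 absolutely_integrable_on {a..b}"
    and A_bound: "matrix_norm N (A t) \<le> \<beta>"
    and A0_bound: "matrix_norm N (A0 t) \<le> \<beta>0"
    and Z: "transition_matrix T \<gamma> A A0 Z"
    and \<sigma>: "\<sigma> = 1 \<or> \<sigma> = - 1"
    and decay: "0 \<le> \<sigma> * (t - s) \<Longrightarrow> matrix_norm N (Z t s) \<le> K * exp (- \<alpha> * \<bar>t - s\<bar>)"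
    and K: "1 \<le> K" and \<alpha>: "0 < \<alpha>"
    and \<rho>: "exp (integral {T i..T (i + 1)} (\<lambda>s. matrix_norm N (A s))) \<le> \<rho>"
begin

definition forced :: "(real \<Rightarrow> real^'n) \<Rightarrow> real \<Rightarrow> real^'n \<Rightarrow> real^'n \<Rightarrow> real^'n" where
  "forced p t x y = A t *v x + A0 t *v y + p t"

lemma rho_pos: "0 < \<rho>"
  using \<rho>[of 0] exp_gt_zero less_le_trans by blast

lemma N_A_le: "N (A t *v x) \<le> \<beta> * N x"
  using matrix_norm_le[OF vector_norm, of "A t" x] mult_right_mono[OF A_bound N_nonneg] order_trans
  by blast

lemma N_A0_le: "N (A0 t *v x) \<le> \<beta>0 * N x"
  using matrix_norm_le[OF vector_norm, of "A0 t" x] mult_right_mono[OF A0_bound N_nonneg] order_trans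
  by blast

lemma depca_forced:
  assumes p: "\<And>a b. p integrable_on {a..b}" and P: "\<And>t. N (p t) \<le> P"
  shows "depca N T \<zeta> \<gamma> \<theta> \<beta> \<beta>0 (forced p) P"
proof
  show "(\<lambda>t. forced p t x y) integrable_on {a..b}" for x y a b
    unfolding forced_def
    by (intro integrable_add matrix_vector_integrable A_integrable A0_integrable p)
  show "N (forced p t u v - forced p t u' v') \<le> \<beta> * N (u - u') + \<beta>0 * N (v - v')" for t u v u' v'
  proof -
    have "forced p t u v - forced p t u' v' = A t *v (u - u') + A0 t *v (v - v')"
      by (simp add: forced_def matrix_vector_mult_diff_distrib)
    then show ?thesis
      using N_triangle[of "A t *v (u - u')" "A0 t *v (v - v')"] N_A_le[of t "u - u'"]
        N_A0_le[of t "v - v'"] by simp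
  qed
  show "N (forced p t 0 0) \<le> P" for t
    using P by (simp add: forced_def)
qed

sublocale homogeneous: depca N T \<zeta> \<gamma> \<theta> \<beta> \<beta>0 "forced (\<lambda>_. 0)" 0
  by (rule depca_forced) auto

lemma Z_solution: "depca_solution T \<gamma> (forced (\<lambda>_. 0)) (\<lambda>t. Z t s *v x)"
proof -
  have "forced (\<lambda>_. 0) = (\<lambda>t x y. A t *v x + A0 t *v y)" by (simp add: forced_def fun_eq_iff)
  then show ?thesis using Z by (simp add: transition_matrix_def)
qed

lemma Z_refl: "Z s s *v x = x"
  using Z by (simp add: transition_matrix_def)

lemma Z_eq_flow: "Z t s *v x = homogeneous.flow t s x"
  using homogeneous.flow_unique[OF Z_solution[of s x], of t s] by (simp add: Z_refl)

lemma Z_cocycle: "Z t s *v (Z s r *v x) = Z t r *v x"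
  by (simp add: Z_eq_flow)

lemma N_Z_le:
  assumes "0 \<le> \<sigma> * (t - s)"
  shows "N (Z t s *v x) \<le> K * exp (- \<alpha> * \<bar>t - s\<bar>) * N x"
  using matrix_norm_le[OF vector_norm, of "Z t s" x] mult_right_mono[OF decay[OF assms] N_nonneg] order_trans
  by blast

text \<open>
  Variation of constants on one cell. With \<open>u\<close> the solution of \<open>u' = A u + p\<close> vanishing at \<open>\<zeta> i\<close>,
  the difference \<open>w - u\<close> solves the homogeneous equation, because the deviating argument only sees
  \<open>u (\<zeta> i) = 0\<close>.
\<close>

lemma cell_variation:
  assumes w: "interval_solution (T i) (T (i + 1)) (\<zeta> i) (forced p) w"
    and p: "p integrable_on cell i" and P: "\<And>t. t \<in> cell i \<Longrightarrow> N (p t) \<le> P"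
  obtains u where "\<And>t. t \<in> cell i \<Longrightarrow> N (u t) \<le> \<rho> * P * \<bar>t - \<zeta> i\<bar>"
    and "\<And>s t. s \<in> cell i \<Longrightarrow> t \<in> cell i \<Longrightarrow> w t - Z t s *v w s = u t - Z t s *v u s"
proof -
  have P0: "0 \<le> P" using P[OF T_in_cell(1)] N_nonneg order_trans by blast
  let ?G = "\<lambda>t x y. A t *v x + p t"
  obtain u where u: "interval_solution (T i) (T (i + 1)) (\<zeta> i) ?G u" "u (\<zeta> i) = 0"
  proof (rule interval_solution_exists[OF _ _ zeta_cell zeta_cell cell_length])
    show "(\<lambda>t. A t *v x + p t) integrable_on cell i" for x
      by (intro integrable_add matrix_vector_integrable A_integrable p)
    show "N (A t *v x + p t - (A t *v x' + p t)) \<le> \<beta> * N (x - x') + \<beta>0 * N (y - y')" for t x y x' y'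
      using N_A_le[of t "x - x'"] mult_nonneg_nonneg[OF \<beta>0 N_nonneg[of "y - y'"]]
      by (simp add: matrix_vector_mult_diff_distrib)
  qed blast
  let ?k = "\<lambda>s. matrix_norm N (A s)"
  have k: "?k integrable_on {a..b}" for a b
    by (rule matrix_norm_integrable[OF vector_norm A_integrable A_bound])
  show thesis
  proof
    fix t assume t: "t \<in> cell i"
    have "N (u t) \<le> P * \<bar>t - \<zeta> i\<bar> * exp (integral (cell i) ?k)"
    proof (rule gronwall_two_sided[where \<beta> = \<beta>])
      show "continuous_on (cell i) (\<lambda>t. N (u t))"
        using u(1) by (auto simp: interval_solution_def intro: continuous_on_N_comp)
      fix s r M assume sr: "T i \<le> s" "s \<le> r" "r \<le> T (i + 1)"
        and M: "\<And>q. q \<in> {s..r} \<Longrightarrow> N (u q) \<le> M"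
      have "N (u r - u s) \<le> M * integral {s..r} ?k + P * (r - s)"
      proof (rule N_integral_le)
        show "((\<lambda>q. A q *v u q + p q) has_integral (u r - u s)) {s..r}"
          by (rule interval_solution_has_integral[OF u(1) sr])
        show "((\<lambda>q. M * ?k q + P) has_integral (M * integral {s..r} ?k + P * (r - s))) {s..r}"
          using has_integral_const_real[of P s r] sr
          by (intro has_integral_add has_integral_mult_right integrable_integral k)
            (simp add: mult.commute)
        fix q assume q: "q \<in> {s..r}"
        have "N (A q *v u q) \<le> ?k q * M"
          using order_trans[OF matrix_norm_le[OF vector_norm] mult_left_mono[OF M[OF q] matrix_norm_nonneg[OF vector_norm]]] .
        then show "N (A q *v u q + p q) \<le> M * ?k q + P"
          using N_triangle[of "A q *v u q" "p q"] P[of q] q sr by (simp add: mult.commute)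
      qed
      then show "\<bar>N (u r) - N (u s)\<bar> \<le> M * integral {s..r} ?k + P * (r - s)"
        using N_triangle_sub[of "u r" "u s"] N_triangle_sub[of "u s" "u r"] N_minus_commute[of "u r" "u s"]
        by linarith
    qed (use u(2) t P0 zeta_cell k A_bound matrix_norm_nonneg[OF vector_norm] in auto)
    also have "\<dots> \<le> P * \<bar>t - \<zeta> i\<bar> * \<rho>" using P0 \<rho> by (intro mult_left_mono) auto
    finally show "N (u t) \<le> \<rho> * P * \<bar>t - \<zeta> i\<bar>" by (simp add: mult_ac)
  next
    fix s t assume s: "s \<in> cell i" and t: "t \<in> cell i"
    have "homogeneous.cell_solution i (\<lambda>t. w t - u t)"
      by (rule interval_solution_diff[OF w u(1)])
        (use u(2) in \<open>simp add: forced_def matrix_vector_mult_diff_distrib\<close>)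
    moreover have "homogeneous.cell_solution i (\<lambda>t. Z t s *v (w s - u s))"
      using Z_solution depca_solution_iff_interval by blast
    ultimately have "N (w t - u t - Z t s *v (w s - u s))
        \<le> exp (rate * \<bar>t - s\<bar>) * N (w s - u s - Z s s *v (w s - u s))"
      using homogeneous.cell_diff_growth[of i "\<lambda>t. w t - u t" "\<lambda>t. Z t s *v (w s - u s)" s t] s t
      by simp
    then have "w t - u t = Z t s *v (w s - u s)" by (simp add: Z_refl)
    then show "w t - Z t s *v w s = u t - Z t s *v u s"
      by (simp add: matrix_vector_mult_diff_distrib algebra_simps)
  qed
qed

text \<open>
  The decay estimate is applied to \<open>Z t a\<close> and \<open>Z t b\<close> directly and not to the factors of
  \<open>Z t b = Z t a Z a b\<close>. So \<open>K\<close> enters only once, however many cells lie between \<open>t\<close> and \<open>a\<close>.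
\<close>

lemma cell_contribution:
  assumes w: "interval_solution (T i) (T (i + 1)) (\<zeta> i) (forced p) w"
    and p: "p integrable_on cell i" and P: "\<And>t. t \<in> cell i \<Longrightarrow> N (p t) \<le> P"
    and ab: "a \<in> cell i" "b \<in> cell i" and order: "0 \<le> \<sigma> * (t - a)" "0 \<le> \<sigma> * (a - b)"
  shows "N (Z t a *v w a - Z t b *v w b)
    \<le> K * \<rho> * P * (\<bar>a - \<zeta> i\<bar> + \<bar>b - \<zeta> i\<bar>) * exp (- \<alpha> * \<bar>t - a\<bar>)"
proof -
  obtain u where u: "\<And>t. t \<in> cell i \<Longrightarrow> N (u t) \<le> \<rho> * P * \<bar>t - \<zeta> i\<bar>"
    and wu: "\<And>s t. s \<in> cell i \<Longrightarrow> t \<in> cell i \<Longrightarrow> w t - Z t s *v w s = u t - Z t s *v u s"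
    by (rule cell_variation[OF w p P]) blast+
  have eq: "Z t a *v w a - Z t b *v w b = Z t a *v u a - Z t b *v u b"
  proof -
    have "Z t a *v (w a - Z a b *v w b) = Z t a *v (u a - Z a b *v u b)"
      using wu[OF ab(2,1)] by simp
    then show ?thesis by (simp add: matrix_vector_mult_diff_distrib Z_cocycle)
  qed
  have abs: "\<bar>t - a\<bar> \<le> \<bar>t - b\<bar>" "0 \<le> \<sigma> * (t - b)" using order \<sigma> by auto
  have K0: "0 \<le> K * exp (- \<alpha> * \<bar>t - r\<bar>)" for r using K by simp
  have "N (Z t a *v u a) \<le> K * exp (- \<alpha> * \<bar>t - a\<bar>) * (\<rho> * P * \<bar>a - \<zeta> i\<bar>)"
    using order_trans[OF N_Z_le[OF order(1)] mult_left_mono[OF u[OF ab(1)] K0]] .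
  moreover have "N (Z t b *v u b) \<le> K * exp (- \<alpha> * \<bar>t - b\<bar>) * (\<rho> * P * \<bar>b - \<zeta> i\<bar>)"
    using order_trans[OF N_Z_le[OF abs(2)] mult_left_mono[OF u[OF ab(2)] K0]] .
  moreover have "K * exp (- \<alpha> * \<bar>t - b\<bar>) * (\<rho> * P * \<bar>b - \<zeta> i\<bar>)
      \<le> K * exp (- \<alpha> * \<bar>t - a\<bar>) * (\<rho> * P * \<bar>b - \<zeta> i\<bar>)"
  proof (intro mult_right_mono mult_left_mono)
    show "exp (- \<alpha> * \<bar>t - b\<bar>) \<le> exp (- \<alpha> * \<bar>t - a\<bar>)" using abs \<alpha> by simp
    show "0 \<le> \<rho> * P * \<bar>b - \<zeta> i\<bar>" using u[OF ab(2)] N_nonneg order_trans by blast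
  qed (use K in simp)
  moreover note N_triangle_minus[of "Z t a *v u a" "Z t b *v u b"]
  ultimately show ?thesis unfolding eq by (simp add: algebra_simps)
qed

text \<open>
  Contributions of successive cells decay geometrically and form a telescoping sum. The cell of \<open>t\<close>
  itself is exceptional, since its anticipating part is not damped; it adds at most \<open>2\<theta>\<close>, which
  is absorbed by \<open>exp (\<alpha>\<theta>) / \<alpha>\<close>.
\<close>

lemma solution_estimate:
  assumes w: "depca_solution T \<gamma> (forced p) w"
    and p: "\<And>a b. p integrable_on {a..b}" and P: "\<And>t. N (p t) \<le> P"
    and order: "0 \<le> \<sigma> * (t - T k)"
  shows "N (w t) \<le> K * exp (- \<alpha> * \<bar>t - T k\<bar>) * N (w (T k)) + 2 * K * \<rho> * P * exp (\<alpha> * \<theta>) / \<alpha>"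
proof -
  have P0: "0 \<le> P" using P[of 0] N_nonneg order_trans by blast
  have cells: "interval_solution (T i) (T (i + 1)) (\<zeta> i) (forced p) w" for i
    using w depca_solution_iff_interval by blast
  obtain i where i: "T i \<le> t" "t < T (i + 1)" using cell_coverE by blast
  show ?thesis
  proof (cases "t = T k")
    case True
    have "1 * N (w t) \<le> K * N (w t)" using K by (intro mult_right_mono) auto
    moreover have "0 \<le> 2 * K * \<rho> * P * exp (\<alpha> * \<theta>) / \<alpha>" using K rho_pos P0 \<alpha> by simp
    ultimately show ?thesis using True by simp
  next
    case False
    define j where "j = (if \<sigma> = 1 then i else i + 1)"
    define s where "s n = T (if \<sigma> = 1 then j - int n else j + int n)" for n
    define e where "e n = exp (- \<alpha> * \<bar>t - s n\<bar>)" for n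
    define Q where "Q = \<rho> * P * exp (\<alpha> * \<theta>) / \<alpha>"
    have Q0: "0 \<le> Q" using rho_pos P0 \<alpha> by (simp add: Q_def)
    have s0: "0 \<le> \<sigma> * (t - s 0)" "s 0 \<in> cell i"
      using i \<sigma> by (auto simp: s_def j_def)
    have step: "0 \<le> \<sigma> * (s n - s (Suc n)) \<and> \<bar>s n - s (Suc n)\<bar> \<le> \<theta> \<and>
        (\<exists>l. s n \<in> cell l \<and> s (Suc n) \<in> cell l \<and> \<bar>s n - \<zeta> l\<bar> + \<bar>s (Suc n) - \<zeta> l\<bar> = \<bar>s n - s (Suc n)\<bar>)" for n
    proof (cases "\<sigma> = 1")
      case True
      let ?l = "j - int n - 1"
      have "s n = T (?l + 1)" "s (Suc n) = T ?l" using True by (auto simp: s_def algebra_simps)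
      then show ?thesis
        using True T_less[of ?l] cell_length[of ?l] zeta_cell[of ?l] by (intro conjI exI[of _ ?l]) auto
    next
      case False
      let ?l = "j + int n"
      have "s n = T ?l" "s (Suc n) = T (?l + 1)" using False by (auto simp: s_def algebra_simps)
      then show ?thesis
        using False \<sigma> T_less[of ?l] cell_length[of ?l] zeta_cell[of ?l] by (intro conjI exI[of _ ?l]) auto
    qed
    have dir: "0 \<le> \<sigma> * (t - s n)" for n
    proof (induction n)
      case (Suc n)
      then show ?case using step[of n] by (auto simp: algebra_simps)
    qed (rule s0(1))
    have sum: "N (Z t (s 0) *v w (s 0) - Z t (s n) *v w (s n)) \<le> K * Q * (e 0 - e n)" for n
    proof (induction n)
      case (Suc n)
      let ?\<Delta> = "\<bar>s n - s (Suc n)\<bar>"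
      obtain l where l: "s n \<in> cell l" "s (Suc n) \<in> cell l" "\<bar>s n - \<zeta> l\<bar> + \<bar>s (Suc n) - \<zeta> l\<bar> = ?\<Delta>"
        using step[of n] by blast
      have "N (Z t (s n) *v w (s n) - Z t (s (Suc n)) *v w (s (Suc n))) \<le> K * \<rho> * P * ?\<Delta> * e n"
        unfolding l(3)[symmetric] e_def
        using cell_contribution[OF cells p P l(1,2) dir[of n]] step[of n] by blast
      also have "\<dots> \<le> K * Q * (e n - e (Suc n))"
      proof -
        have "\<bar>t - s (Suc n)\<bar> = \<bar>t - s n\<bar> + ?\<Delta>" using dir[of n] step[of n] \<sigma> by auto
        then have eS: "e (Suc n) = e n * exp (- \<alpha> * ?\<Delta>)"
          by (simp add: e_def algebra_simps flip: exp_add)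
        have "\<alpha> * exp (- \<alpha> * \<theta>) * ?\<Delta> \<le> 1 - exp (- \<alpha> * ?\<Delta>)"
          using step[of n] \<alpha> by (intro exp_decrement_ge) auto
        then have "Q * (\<alpha> * exp (- \<alpha> * \<theta>) * ?\<Delta>) \<le> Q * (1 - exp (- \<alpha> * ?\<Delta>))"
          using Q0 by (rule mult_left_mono)
        moreover have "Q * (\<alpha> * exp (- \<alpha> * \<theta>) * ?\<Delta>) = \<rho> * P * ?\<Delta>"
        proof -
          have "exp (\<alpha> * \<theta>) * exp (- \<alpha> * \<theta>) = 1" by (simp flip: exp_add)
          then show ?thesis using \<alpha> by (simp add: Q_def field_simps)
        qed
        ultimately have "\<rho> * P * ?\<Delta> \<le> Q * (1 - exp (- \<alpha> * ?\<Delta>))" by linarith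
        then have "K * e n * (\<rho> * P * ?\<Delta>) \<le> K * e n * (Q * (1 - exp (- \<alpha> * ?\<Delta>)))"
          using K by (intro mult_left_mono) (simp_all add: e_def)
        then show ?thesis unfolding eS by (simp add: algebra_simps)
      qed
      finally have "N (Z t (s n) *v w (s n) - Z t (s (Suc n)) *v w (s (Suc n))) \<le> K * Q * (e n - e (Suc n))" .
      then show ?case
        using Suc N_triangle_dist[of "Z t (s 0) *v w (s 0)" "Z t (s (Suc n)) *v w (s (Suc n))" "Z t (s n) *v w (s n)"]
        by (simp add: algebra_simps)
    qed (simp add: e_def)
    obtain n where n: "s n = T k"
    proof (cases "\<sigma> = 1")
      case True
      then have "k \<le> i" using order i T_mono[of "i + 1" k] by (cases "k \<le> i") auto
      then show ?thesis using True by (intro that[of "nat (i - k)"]) (simp add: s_def j_def)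
    next
      case sm: False
      then have "t < T k" using order \<sigma> False by auto
      then have "i + 1 \<le> k" using i T_mono[of k i] by (cases "i + 1 \<le> k") auto
      then show ?thesis using sm by (intro that[of "nat (k - i - 1)"]) (simp add: s_def j_def)
    qed
    have "N (Z t t *v w t - Z t (s 0) *v w (s 0))
        \<le> K * \<rho> * P * (\<bar>t - \<zeta> i\<bar> + \<bar>s 0 - \<zeta> i\<bar>) * exp (- \<alpha> * \<bar>t - t\<bar>)"
      by (rule cell_contribution[OF cells p P _ s0(2)]) (use i s0 in auto)
    also have "\<dots> \<le> K * \<rho> * P * (2 * \<theta>)"
    proof -
      have "\<bar>t - \<zeta> i\<bar> + \<bar>s 0 - \<zeta> i\<bar> \<le> 2 * \<theta>"
        using i s0(2) zeta_cell[of i] cell_length[of i] by auto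
      then show ?thesis using K rho_pos P0 by (simp add: mult_left_mono)
    qed
    also have "\<dots> \<le> K * \<rho> * P * (exp (\<alpha> * \<theta>) / \<alpha>)"
    proof (rule mult_left_mono)
      have "2 * (\<alpha> * \<theta>) \<le> exp (\<alpha> * \<theta>)" using \<alpha> \<theta> by (intro two_mult_le_exp) simp
      then show "2 * \<theta> \<le> exp (\<alpha> * \<theta>) / \<alpha>" using \<alpha> by (simp add: field_simps)
    qed (use K rho_pos P0 in simp)
    finally have first: "N (w t - Z t (s 0) *v w (s 0)) \<le> K * Q" by (simp add: Z_refl Q_def)
    have "N (w t) \<le> N (Z t (s n) *v w (s n)) + N (w t - Z t (s 0) *v w (s 0))
        + N (Z t (s 0) *v w (s 0) - Z t (s n) *v w (s n))"
      using N_triangle_sub[of "w t" "Z t (s n) *v w (s n)"]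
        N_triangle_dist[of "w t" "Z t (s n) *v w (s n)" "Z t (s 0) *v w (s 0)"] by linarith
    moreover have "N (Z t (s n) *v w (s n)) \<le> K * exp (- \<alpha> * \<bar>t - s n\<bar>) * N (w (s n))"
      by (rule N_Z_le[OF dir])
    moreover have "K * Q * (e 0 - e n) \<le> K * Q * 1"
    proof (rule mult_left_mono)
      have "e 0 \<le> 1" "0 < e n" using \<alpha> by (auto simp: e_def)
      then show "e 0 - e n \<le> 1" by linarith
    qed (use K Q0 in simp)
    ultimately have "N (w t) \<le> K * exp (- \<alpha> * \<bar>t - s n\<bar>) * N (w (s n)) + 2 * (K * Q)"
      using first sum[of n] by simp
    then show ?thesis by (simp add: n Q_def algebra_simps)
  qed
qed

definition far :: "nat \<Rightarrow> int" where
  "far n = (if \<sigma> = 1 then - int n else int n)"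

lemma far_eventually: "\<exists>m. \<forall>n\<ge>m. 0 \<le> \<sigma> * (t - T (far n)) \<and> R \<le> \<bar>t - T (far n)\<bar>"
proof (cases "\<sigma> = 1")
  case True
  obtain i where i: "\<And>j. j \<le> i \<Longrightarrow> T j \<le> t - \<bar>R\<bar>" using T_unbounded_below by blast
  have far: "far n = - int n" for n unfolding far_def using True by simp
  have "T (far n) \<le> t - \<bar>R\<bar>" if "n \<ge> nat (- i)" for n
    unfolding far using that by (intro i) auto
  then show ?thesis using True by (intro exI[of _ "nat (- i)"]) fastforce
next
  case False
  obtain i where i: "\<And>j. j \<ge> i \<Longrightarrow> t + \<bar>R\<bar> \<le> T j" using T_unbounded_above by blast
  have far: "far n = int n" for n unfolding far_def using False by simp
  have "t + \<bar>R\<bar> \<le> T (far n)" if "n \<ge> nat i" for n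
    unfolding far using that by (intro i) auto
  then show ?thesis using False \<sigma> by (intro exI[of _ "nat i"]) fastforce
qed

text \<open>
  In the estimate from a grid point \<open>s\<close> the initial value is damped away as \<open>s\<close> tends to infinity
  against the direction of contraction.
\<close>

lemma bounded_solution_estimate:
  assumes w: "depca_solution T \<gamma> (forced p) w"
    and p: "\<And>a b. p integrable_on {a..b}" and P: "\<And>t. N (p t) \<le> P"
    and bounded: "\<And>t. N (w t) \<le> B"
  shows "N (w t) \<le> 2 * K * \<rho> * P * exp (\<alpha> * \<theta>) / \<alpha>"
proof (rule field_le_epsilon)
  fix e :: real assume e: "0 < e"
  have B0: "0 \<le> B" using bounded[of 0] N_nonneg order_trans by blast
  \<comment> \<open>At distance \<open>R\<close> the damping factor satisfies \<open>exp (- \<alpha> R) (K B + 1) \<le> e\<close>, because \<open>\<alpha> R \<le> exp (\<alpha> R)\<close>.\<close>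
  define R where "R = (K * B + 1) / (\<alpha> * e)"
  have R0: "0 < R" using K B0 \<alpha> e by (simp add: R_def add_nonneg_pos)
  obtain n where n: "0 \<le> \<sigma> * (t - T (far n))" "R \<le> \<bar>t - T (far n)\<bar>"
    using far_eventually[of t R] by blast
  let ?s = "T (far n)"
  have aR: "\<alpha> * R * e = K * B + 1" using \<alpha> e by (simp add: R_def)
  have "exp (- \<alpha> * \<bar>t - ?s\<bar>) * (K * B + 1) \<le> exp (- \<alpha> * R) * (K * B + 1)"
    using n(2) \<alpha> K B0 by (intro mult_right_mono) auto
  also have "\<dots> = exp (- \<alpha> * R) * (\<alpha> * R) * e" by (simp add: mult.assoc flip: aR)
  also have "\<dots> \<le> exp (- \<alpha> * R) * exp (\<alpha> * R) * e"
  proof (intro mult_right_mono mult_left_mono)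
    show "\<alpha> * R \<le> exp (\<alpha> * R)" using exp_ge_add_one_self[of "\<alpha> * R"] by linarith
  qed (use e in auto)
  also have "\<dots> = e" by (simp flip: exp_add)
  finally have ex: "exp (- \<alpha> * \<bar>t - ?s\<bar>) * (K * B + 1) \<le> e" .
  have "K * exp (- \<alpha> * \<bar>t - ?s\<bar>) * N (w ?s) \<le> K * exp (- \<alpha> * \<bar>t - ?s\<bar>) * B"
    using bounded K by (intro mult_left_mono) auto
  also have "\<dots> \<le> exp (- \<alpha> * \<bar>t - ?s\<bar>) * (K * B + 1)" by (simp add: algebra_simps)
  also have "\<dots> \<le> e" by (rule ex)
  finally show "N (w t) \<le> 2 * K * \<rho> * P * exp (\<alpha> * \<theta>) / \<alpha> + e"
    using solution_estimate[OF w p P n(1)] by linarith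
qed

text \<open>
  Limit of the solutions vanishing at grid points that tend to infinity against the direction of
  contraction: their values at time \<open>0\<close> are bounded, and the equation depends continuously on them.
\<close>

lemma bounded_solution_exists:
  assumes p: "\<And>a b. p integrable_on {a..b}" and P: "\<And>t. N (p t) \<le> P"
  obtains w where "depca_solution T \<gamma> (forced p) w"
    "\<And>t. N (w t) \<le> 2 * K * \<rho> * P * exp (\<alpha> * \<theta>) / \<alpha>"
proof -
  interpret W: depca N T \<zeta> \<gamma> \<theta> \<beta> \<beta>0 "forced p" P by (rule depca_forced[OF p P])
  define B where "B = 2 * K * \<rho> * P * exp (\<alpha> * \<theta>) / \<alpha>"
  obtain C where C: "C > 0" "\<And>x. norm x \<le> C * N x" using norm_le_N by auto
  have small: "N (W.flow t (T (far n)) 0) \<le> B" if "0 \<le> \<sigma> * (t - T (far n))" for t n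
    using solution_estimate[OF W.flow_solution p P that, of "T (far n)" 0] by (simp add: B_def)
  obtain m where m: "\<And>n. n \<ge> m \<Longrightarrow> 0 \<le> \<sigma> * (0 - T (far n))" using far_eventually[of 0 0] by blast
  define y where "y n = W.flow 0 (T (far (m + n))) 0" for n
  have "norm (y n) \<le> C * B" for n
    using order_trans[OF C(2) mult_left_mono[OF small[OF m[of "m + n"]], of C]] C(1) by (simp add: y_def)
  then have "bounded (range y)" by (auto simp: bounded_iff)
  then obtain l r where r: "strict_mono (r :: nat \<Rightarrow> nat)" "(y \<circ> r) \<longlonglongrightarrow> l"
    using bounded_imp_convergent_subsequence by blast
  show thesis
  proof
    show "depca_solution T \<gamma> (forced p) (\<lambda>t. W.flow t 0 l)" by (rule W.flow_solution)
    fix t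
    have "(\<lambda>n. W.flow t 0 (y (r n))) \<longlonglongrightarrow> W.flow t 0 l"
      using W.cont_space[of t 0] r(2)
      by (auto simp: continuous_on_eq_continuous_at o_def intro: isCont_tendsto_compose)
    then have "(\<lambda>n. N (W.flow t 0 (y (r n)))) \<longlonglongrightarrow> N (W.flow t 0 l)" by (rule tendsto_N)
    moreover obtain m' where m': "\<And>n. n \<ge> m' \<Longrightarrow> 0 \<le> \<sigma> * (t - T (far n))"
      using far_eventually[of t 0] by blast
    have "N (W.flow t 0 (y (r n))) \<le> B" if "n \<ge> m'" for n
    proof -
      have "m' \<le> m + r n" using that seq_suble[OF r(1), of n] by linarith
      then show ?thesis using small[OF m'] by (simp add: y_def)
    qed
    ultimately show "N (W.flow t 0 l) \<le> 2 * K * \<rho> * P * exp (\<alpha> * \<theta>) / \<alpha>"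
      unfolding B_def[symmetric] by (intro LIMSEQ_le_const2) auto
  qed
qed

end

section \<open>Conjugacies of evolution families\<close>

text \<open>
  A map carrying solutions to solutions is determined by its value \<open>h\<close> at time \<open>0\<close>; at time \<open>t\<close> it is
  \<open>Q t 0 \<circ> h \<circ> P 0 t\<close>. What remains of topological conjugacy is that \<open>h\<close> is a homeomorphism and
  that these maps and their inverses are bounded on bounded sets uniformly in \<open>t\<close>.
\<close>

definition uniform_conjugacy ::
    "(real \<Rightarrow> real \<Rightarrow> 'a \<Rightarrow> 'a) \<Rightarrow> (real \<Rightarrow> real \<Rightarrow> 'a \<Rightarrow> 'a) \<Rightarrow> ('a \<Rightarrow> 'a::euclidean_space) \<Rightarrow> bool" where
  "uniform_conjugacy P Q h \<longleftrightarrow> bij h \<and> continuous_on UNIV h \<and> continuous_on UNIV (inv h) \<and>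
     (\<forall>r. \<exists>r'. \<forall>t z. norm z \<le> r \<longrightarrow> norm (Q t 0 (h (P 0 t z))) \<le> r') \<and>
     (\<forall>r. \<exists>r'. \<forall>t z. norm z \<le> r \<longrightarrow> norm (P t 0 (inv h (Q 0 t z))) \<le> r')"

lemma uniform_conjugacy_trans:
  assumes "evolution P" "evolution Q" "evolution S"
    and h: "uniform_conjugacy P Q h" and k: "uniform_conjugacy Q S k"
  shows "uniform_conjugacy P S (k \<circ> h)"
  unfolding uniform_conjugacy_def
proof (intro conjI allI)
  interpret P: evolution P by fact
  interpret Q: evolution Q by fact
  interpret S: evolution S by fact
  have bij: "bij h" "bij k" using h k by (auto simp: uniform_conjugacy_def)
  have inv: "inv (k \<circ> h) = inv h \<circ> inv k" by (rule o_inv_distrib[OF bij(2,1)])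
  show "bij (k \<circ> h)" by (rule bij_comp[OF bij])
  show "continuous_on UNIV (k \<circ> h)" "continuous_on UNIV (inv (k \<circ> h))"
    unfolding inv unfolding o_def using h k
    by (auto simp: uniform_conjugacy_def
        intro: continuous_on_compose2[of UNIV k UNIV h] continuous_on_compose2[of UNIV "inv h" UNIV "inv k"])
  fix r
  obtain r1 where r1: "\<And>t z. norm z \<le> r \<Longrightarrow> norm (Q t 0 (h (P 0 t z))) \<le> r1"
    using h unfolding uniform_conjugacy_def by blast
  obtain r2 where r2: "\<And>t z. norm z \<le> r1 \<Longrightarrow> norm (S t 0 (k (Q 0 t z))) \<le> r2"
    using k unfolding uniform_conjugacy_def by blast
  have "norm (S t 0 ((k \<circ> h) (P 0 t z))) \<le> r2" if "norm z \<le> r" for t z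
    using r2[OF r1[OF that], of t t] by simp
  then show "\<exists>r'. \<forall>t z. norm z \<le> r \<longrightarrow> norm (S t 0 ((k \<circ> h) (P 0 t z))) \<le> r'" by blast
  obtain s1 where s1: "\<And>t z. norm z \<le> r \<Longrightarrow> norm (Q t 0 (inv k (S 0 t z))) \<le> s1"
    using k unfolding uniform_conjugacy_def by blast
  obtain s2 where s2: "\<And>t z. norm z \<le> s1 \<Longrightarrow> norm (P t 0 (inv h (Q 0 t z))) \<le> s2"
    using h unfolding uniform_conjugacy_def by blast
  have "norm (P t 0 (inv (k \<circ> h) (S 0 t z))) \<le> s2" if "norm z \<le> r" for t z
    using s2[OF s1[OF that], of t t] by (simp add: inv)
  then show "\<exists>r'. \<forall>t z. norm z \<le> r \<longrightarrow> norm (P t 0 (inv (k \<circ> h) (S 0 t z))) \<le> r'" by blast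
qed

lemma uniform_conjugacy_sym:
  assumes "uniform_conjugacy P Q h"
  shows "uniform_conjugacy Q P (inv h)"
  using assms by (simp add: uniform_conjugacy_def inv_inv_eq bij_imp_bij_inv)

lemma uniform_conjugacy_inverse_map:
  assumes "evolution P" "evolution Q" and h: "uniform_conjugacy P Q h"
  shows "inv (\<lambda>z. Q t 0 (h (P 0 t z))) = (\<lambda>z. P t 0 (inv h (Q 0 t z)))"
proof -
  interpret P: evolution P by fact
  interpret Q: evolution Q by fact
  have bij: "bij h" using h by (simp add: uniform_conjugacy_def)
  show ?thesis
    by (rule inv_unique_comp)
      (auto simp: fun_eq_iff bij bij_is_inj bij_is_surj surj_f_inv_f)
qed

lemma uniform_conjugacy_continuous:
  assumes "evolution P" "evolution Q" and h: "uniform_conjugacy P Q h"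
  shows "continuous_on UNIV (\<lambda>(t, z). Q t 0 (h (P 0 t z)))"
proof -
  interpret P: evolution P by fact
  interpret Q: evolution Q by fact
  have ch: "continuous_on UNIV h" using h by (simp add: uniform_conjugacy_def)
  have "continuous_on UNIV (\<lambda>p. h (case p of (t, z) \<Rightarrow> P 0 t z))"
    by (rule continuous_on_compose2[OF ch P.cont_init_space]) simp
  then have "continuous_on UNIV (\<lambda>p. (fst p, h (P 0 (fst p) (snd p))))"
    by (intro continuous_intros) (simp add: split_def)
  from continuous_on_compose2[OF Q.cont_time_space[of 0] this]
  show ?thesis by (simp add: split_def)
qed

lemma uniform_conjugacy_maps_solutions:
  fixes P Q :: "real \<Rightarrow> real \<Rightarrow> 'a::euclidean_space \<Rightarrow> 'a"
  assumes "evolution P" "evolution Q" and h: "uniform_conjugacy P Q h"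
    and sol_P: "\<And>z t. sol_P z \<Longrightarrow> P 0 t (z t) = z 0" and sol_Q: "\<And>x. sol_Q (\<lambda>t. Q t 0 x)"
  shows "maps_solutions_homeomorphically sol_P sol_Q (\<lambda>t z. Q t 0 (h (P 0 t z)))"
  unfolding maps_solutions_homeomorphically_def
proof (intro conjI allI impI)
  interpret P: evolution P by fact
  interpret Q: evolution Q by fact
  have bij: "bij h" using h by (simp add: uniform_conjugacy_def)
  have inv_h [simp]: "inv h (h x) = x" "h (inv h x) = x" for x
    using bij by (simp_all add: bij_is_inj bij_is_surj surj_f_inv_f)
  fix t
  have c: "continuous_on UNIV (\<lambda>z. Q t 0 (h (P 0 t z)))" "continuous_on UNIV (\<lambda>z. P t 0 (inv h (Q 0 t z)))"
    using continuous_on_compose2[OF uniform_conjugacy_continuous[OF assms(1-3)], of UNIV "\<lambda>z. (t, z)"]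
      continuous_on_compose2[OF uniform_conjugacy_continuous[OF assms(2,1) uniform_conjugacy_sym[OF h]], of UNIV "\<lambda>z. (t, z)"]
    by (simp_all add: continuous_on_Pair continuous_on_id)
  have "homeomorphism UNIV UNIV (\<lambda>z. Q t 0 (h (P 0 t z))) (\<lambda>z. P t 0 (inv h (Q 0 t z)))"
    by (rule homeomorphismI[OF c]) auto
  then show "\<exists>G. homeomorphism UNIV UNIV (\<lambda>z. Q t 0 (h (P 0 t z))) G" by blast
next
  interpret P: evolution P by fact
  interpret Q: evolution Q by fact
  have bij: "bij h" using h by (simp add: uniform_conjugacy_def)
  fix R
  obtain r where r: "\<And>t z. norm z \<le> R \<Longrightarrow> norm (P t 0 (inv h (Q 0 t z))) \<le> r"
    using h unfolding uniform_conjugacy_def by blast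
  show "\<forall>\<^sub>F z in at_infinity. \<forall>t. R < norm (Q t 0 (h (P 0 t z)))"
    unfolding eventually_at_infinity
  proof (intro exI[of _ "r + 1"] allI impI)
    fix z :: 'a and t assume z: "r + 1 \<le> norm z"
    show "R < norm (Q t 0 (h (P 0 t z)))"
    proof (rule ccontr)
      assume "\<not> R < norm (Q t 0 (h (P 0 t z)))"
      then have "norm (P t 0 (inv h (Q 0 t (Q t 0 (h (P 0 t z)))))) \<le> r" by (intro r) simp
      then show False using z bij by (simp add: bij_is_inj)
    qed
  qed
next
  fix z assume "sol_P z"
  then show "sol_Q (\<lambda>t. Q t 0 (h (P 0 t (z t))))" using sol_P sol_Q by simp
qed

lemma uniform_conjugacy_imp_topologically_conjugate:
  assumes P: "evolution P" and Q: "evolution Q" and h: "uniform_conjugacy P Q h"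
    and "\<And>z t. sol_P z \<Longrightarrow> P 0 t (z t) = z 0" "\<And>x. sol_P (\<lambda>t. P t 0 x)"
    and "\<And>z t. sol_Q z \<Longrightarrow> Q 0 t (z t) = z 0" "\<And>x. sol_Q (\<lambda>t. Q t 0 x)"
  shows "topologically_conjugate sol_P sol_Q"
  unfolding topologically_conjugate_def
proof (intro exI conjI)
  show "continuous_on UNIV (\<lambda>(t, z). Q t 0 (h (P 0 t z)))"
    by (rule uniform_conjugacy_continuous[OF P Q h])
  show "maps_solutions_homeomorphically sol_P sol_Q (\<lambda>t z. Q t 0 (h (P 0 t z)))"
    by (rule uniform_conjugacy_maps_solutions[OF P Q h]) (use assms in auto)
  show "maps_solutions_homeomorphically sol_Q sol_P (\<lambda>t. inv (\<lambda>z. Q t 0 (h (P 0 t z))))"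
    unfolding uniform_conjugacy_inverse_map[OF P Q h]
    by (rule uniform_conjugacy_maps_solutions[OF Q P uniform_conjugacy_sym[OF h]]) (use assms in auto)
qed

section \<open>Orbits at bounded distance\<close>

lemma continuous_if_closed_graph_near_identity:
  fixes g :: "'a::euclidean_space \<Rightarrow> 'a"
  assumes closed: "closed \<Gamma>" and graph: "\<And>x y. (x, y) \<in> \<Gamma> \<longleftrightarrow> y = g x"
    and near: "\<And>x. norm (g x - x) \<le> W"
  shows "continuous_on UNIV g"
proof (rule continuous_at_imp_continuous_on, intro ballI)
  fix x :: 'a
  define r where "r = norm x + 1"
  let ?S = "cball (0::'a) r" and ?T = "cball (0::'a) (r + W)"
  have "continuous_on ?S g"
  proof (rule continuous_from_closed_graph)
    show "compact ?T" by simp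
    show "g \<in> ?S \<rightarrow> ?T"
    proof
      fix y assume "y \<in> ?S"
      then show "g y \<in> ?T" using near[of y] norm_triangle_ineq2[of "g y" y] by simp
    qed
    then have "(\<lambda>x. (x, g x)) ` ?S = (?S \<times> ?T) \<inter> \<Gamma>" by (auto simp: graph)
    then show "closed ((\<lambda>x. (x, g x)) ` ?S)"
      using closed by (simp add: closed_Int closed_Times)
  qed
  moreover have "x \<in> interior ?S" by (simp add: r_def)
  ultimately show "isCont g x" by (rule continuous_on_interior)
qed

text \<open>
  Being at distance at most \<open>W\<close> for all times is a closed relation between initial values, so the
  map it defines is continuous in both directions without any estimate of its modulus of
  continuity. It is onto by Brouwer's theorem, being at bounded distance from the identity.
\<close>

lemma bounded_distance_conjugacy:
  fixes P Q :: "real \<Rightarrow> real \<Rightarrow> 'a::euclidean_space \<Rightarrow> 'a"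
  assumes "evolution P" "evolution Q"
    and ex: "\<And>x. \<exists>y. \<forall>t. norm (P t 0 x - Q t 0 y) \<le> W"
    and unique_Q: "\<And>x y y'. (\<And>t. norm (P t 0 x - Q t 0 y) \<le> W) \<Longrightarrow>
        (\<And>t. norm (P t 0 x - Q t 0 y') \<le> W) \<Longrightarrow> y = y'"
    and unique_P: "\<And>x x' y. (\<And>t. norm (P t 0 x - Q t 0 y) \<le> W) \<Longrightarrow>
        (\<And>t. norm (P t 0 x' - Q t 0 y) \<le> W) \<Longrightarrow> x = x'"
  shows "\<exists>h. uniform_conjugacy P Q h"
proof -
  interpret P: evolution P by fact
  interpret Q: evolution Q by fact
  obtain g where g: "\<And>x t. norm (P t 0 x - Q t 0 (g x)) \<le> W" using ex by metis
  have W: "0 \<le> W" using g[of 0 0] norm_ge_zero order_trans by blast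
  define \<Gamma> where "\<Gamma> = {(x, y). \<forall>t. norm (P t 0 x - Q t 0 y) \<le> W}"
  have \<Gamma>: "(x, y) \<in> \<Gamma> \<longleftrightarrow> y = g x" for x y
    using unique_Q[of x y "g x"] g by (auto simp: \<Gamma>_def)
  have closed: "closed \<Gamma>"
  proof -
    have "closed {p. norm (P t 0 (fst p) - Q t 0 (snd p)) \<le> W}" for t
      by (intro closed_Collect_le continuous_intros continuous_on_compose2[OF P.cont_space]
          continuous_on_compose2[OF Q.cont_space]) auto
    moreover have "\<Gamma> = (\<Inter>t. {p. norm (P t 0 (fst p) - Q t 0 (snd p)) \<le> W})"
      by (auto simp: \<Gamma>_def)
    ultimately show ?thesis by auto
  qed
  have near: "norm (g x - x) \<le> W" for x using g[of 0 x] by (simp add: norm_minus_commute)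
  have cont: "continuous_on UNIV g"
    by (rule continuous_if_closed_graph_near_identity[OF closed \<Gamma> near])
  have inj: "inj g"
    using unique_P g by (intro injI) metis
  have surj: "surj g"
  proof (rule surjI)
    have "\<exists>x. g x = y" for y
    proof -
      have c: "continuous_on (cball y W) (\<lambda>x. x - g x + y)"
        by (intro continuous_intros continuous_on_subset[OF cont]) auto
      have m: "(\<lambda>x. x - g x + y) \<in> cball y W \<rightarrow> cball y W"
        using near by (auto simp: dist_norm)
      have "cball y W \<noteq> {}" using W by simp
      from brouwer[OF compact_cball convex_cball this c m] obtain x where "x - g x + y = x" .
      then have "g x = y" by (simp add: algebra_simps)
      then show ?thesis by blast
    qed
    then show "g (SOME x. g x = y) = y" for y by (metis (mono_tags) someI_ex)
  qed
  have bij: "bij g" using inj surj by (simp add: bij_def)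
  have inv_g [simp]: "inv g (g x) = x" "g (inv g x) = x" for x
    using bij by (simp_all add: bij_is_inj bij_is_surj surj_f_inv_f)
  have cont_inv: "continuous_on UNIV (inv g)"
  proof (rule continuous_if_closed_graph_near_identity)
    show "closed (prod.swap -` \<Gamma>)"
      by (rule closed_vimage[OF closed]) (auto simp: prod.swap_def intro!: continuous_intros)
    show "(x, y) \<in> prod.swap -` \<Gamma> \<longleftrightarrow> y = inv g x" for x y by (auto simp: \<Gamma>)
    show "norm (inv g x - x) \<le> W" for x
      using near[of "inv g x"] by (simp add: norm_minus_commute)
  qed
  have "norm (Q t 0 (g (P 0 t z))) \<le> r + W" if "norm z \<le> r" for t z r
    using g[of t "P 0 t z"] that norm_triangle_ineq2[of "Q t 0 (g (P 0 t z))" z]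
    by (simp add: norm_minus_commute)
  moreover have "norm (P t 0 (inv g (Q 0 t z))) \<le> r + W" if "norm z \<le> r" for t z r
    using g[of t "inv g (Q 0 t z)"] that norm_triangle_ineq2[of "P t 0 (inv g (Q 0 t z))" z] by simp
  ultimately have "uniform_conjugacy P Q g"
    unfolding uniform_conjugacy_def using bij cont cont_inv by blast
  then show ?thesis by blast
qed

section \<open>Eventually common orbits\<close>

text \<open>
  Orbits of \<open>P\<close> become orbits of \<open>Q\<close> after a time controlled by their size. Following an orbit by \<open>P\<close>
  until then and going back by \<open>Q\<close> is independent of the turning time.
\<close>

lemma eventually_common_orbits_map:
  fixes P Q :: "real \<Rightarrow> real \<Rightarrow> 'a::euclidean_space \<Rightarrow> 'a" and S :: "real \<Rightarrow> real"
  assumes "evolution P" "evolution Q"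
    and S0: "\<And>r. 0 \<le> S r"
    and S: "\<And>r t x s s'. norm x \<le> r \<Longrightarrow> t + S r \<le> s \<Longrightarrow> s \<le> s' \<Longrightarrow> Q s' s (P s t x) = P s' t x"
  obtains h where "continuous_on UNIV h"
    and "\<And>x r s. norm x \<le> r \<Longrightarrow> S r \<le> s \<Longrightarrow> h x = Q 0 s (P s 0 x)"
    and "\<And>r. \<exists>r'. \<forall>t z. norm z \<le> r \<longrightarrow> norm (Q t 0 (h (P 0 t z))) \<le> r'"
proof -
  interpret P: evolution P by fact
  interpret Q: evolution Q by fact
  define h where "h x = Q 0 (S (norm x)) (P (S (norm x)) 0 x)" for x
  have later: "Q t s' (P s' t x) = Q t s (P s t x)"
    if "norm x \<le> r" "t + S r \<le> s" "s \<le> s'" for t s s' x r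
    using arg_cong[OF S[OF that], of "Q t s'"] by simp
  have h: "h x = Q 0 s (P s 0 x)" if "norm x \<le> r" "S r \<le> s" for x r s
  proof -
    let ?m = "max s (S (norm x))"
    have "Q 0 ?m (P ?m 0 x) = Q 0 s (P s 0 x)"
      using later[of x r 0 s ?m] that by simp
    moreover have "Q 0 ?m (P ?m 0 x) = h x"
      using later[of x "norm x" 0 "S (norm x)" ?m] by (simp add: h_def)
    ultimately show ?thesis by simp
  qed
  have "continuous_on UNIV h"
  proof (rule continuous_at_imp_continuous_on, intro ballI)
    fix x :: 'a
    let ?s = "S (norm x + 1)"
    have "continuous_on (cball 0 (norm x + 1)) (\<lambda>y. Q 0 ?s (P ?s 0 y))"
      by (rule continuous_on_compose2[OF Q.cont_space continuous_on_subset[OF P.cont_space]]) auto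
    then have "continuous_on (cball 0 (norm x + 1)) h"
      by (rule continuous_on_eq) (rule h[symmetric, of _ "norm x + 1"], auto)
    moreover have "x \<in> interior (cball 0 (norm x + 1))" by simp
    ultimately show "isCont h x" by (rule continuous_on_interior)
  qed
  moreover have "\<exists>r'. \<forall>t z. norm z \<le> r \<longrightarrow> norm (Q t 0 (h (P 0 t z))) \<le> r'" for r
  proof -
    obtain r1 where r1: "\<And>t s x. \<bar>t - s\<bar> \<le> S r \<Longrightarrow> norm x \<le> r \<Longrightarrow> norm (P t s x) \<le> r1"
      using P.bounded_growth by meson
    obtain r2 where r2: "\<And>t s x. \<bar>t - s\<bar> \<le> S r \<Longrightarrow> norm x \<le> r1 \<Longrightarrow> norm (Q t s x) \<le> r2"
      using Q.bounded_growth by meson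
    have "norm (Q t 0 (h (P 0 t z))) \<le> r2" if z: "norm z \<le> r" for t z
    proof -
      let ?s1 = "t + S r" and ?x = "P 0 t z"
      let ?s = "max ?s1 (S (norm ?x))"
      have "Q t 0 (h ?x) = Q t ?s (P ?s t z)" by (simp add: h[of ?x "norm ?x" ?s])
      also have "\<dots> = Q t ?s1 (P ?s1 t z)" by (rule later[OF z]) auto
      also have "norm \<dots> \<le> r2" using z S0[of r] by (intro r1 r2) auto
      finally show ?thesis .
    qed
    then show ?thesis by blast
  qed
  ultimately show thesis using that h by blast
qed

lemma eventually_common_orbits_conjugacy:
  fixes P Q :: "real \<Rightarrow> real \<Rightarrow> 'a::euclidean_space \<Rightarrow> 'a"
  assumes P: "evolution P" and Q: "evolution Q"
    and PQ: "\<And>r. \<exists>S\<ge>0. \<forall>t x s s'. norm x \<le> r \<longrightarrow> t + S \<le> s \<longrightarrow> s \<le> s' \<longrightarrow> Q s' s (P s t x) = P s' t x"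
    and QP: "\<And>r. \<exists>S\<ge>0. \<forall>t x s s'. norm x \<le> r \<longrightarrow> t + S \<le> s \<longrightarrow> s \<le> s' \<longrightarrow> P s' s (Q s t x) = Q s' t x"
  shows "\<exists>h. uniform_conjugacy P Q h"
proof -
  interpret P: evolution P by fact
  interpret Q: evolution Q by fact
  obtain S where S: "\<And>r. 0 \<le> S r"
      "\<And>r t x s s'. norm x \<le> r \<Longrightarrow> t + S r \<le> s \<Longrightarrow> s \<le> s' \<Longrightarrow> Q s' s (P s t x) = P s' t x"
    using PQ by metis
  obtain S' where S': "\<And>r. 0 \<le> S' r"
      "\<And>r t x s s'. norm x \<le> r \<Longrightarrow> t + S' r \<le> s \<Longrightarrow> s \<le> s' \<Longrightarrow> P s' s (Q s t x) = Q s' t x"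
    using QP by metis
  obtain h where h: "continuous_on UNIV h"
      "\<And>x r s. norm x \<le> r \<Longrightarrow> S r \<le> s \<Longrightarrow> h x = Q 0 s (P s 0 x)"
      "\<And>r. \<exists>r'. \<forall>t z. norm z \<le> r \<longrightarrow> norm (Q t 0 (h (P 0 t z))) \<le> r'"
    by (rule eventually_common_orbits_map[OF P Q, of S]) (use S in blast)+
  obtain k where k: "continuous_on UNIV k"
      "\<And>x r s. norm x \<le> r \<Longrightarrow> S' r \<le> s \<Longrightarrow> k x = P 0 s (Q s 0 x)"
      "\<And>r. \<exists>r'. \<forall>t z. norm z \<le> r \<longrightarrow> norm (P t 0 (k (Q 0 t z))) \<le> r'"
    by (rule eventually_common_orbits_map[OF Q P, of S']) (use S' in blast)+
  have kh: "k (h x) = x" for x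
  proof -
    define s where "s = max (S (norm x)) (S' (norm (h x)))"
    have "h x = Q 0 s (P s 0 x)" by (rule h(2)[OF order_refl]) (simp add: s_def)
    moreover have "k (h x) = P 0 s (Q s 0 (h x))" by (rule k(2)[OF order_refl]) (simp add: s_def)
    ultimately show ?thesis by simp
  qed
  have hk: "h (k x) = x" for x
  proof -
    define s where "s = max (S' (norm x)) (S (norm (k x)))"
    have "k x = P 0 s (Q s 0 x)" by (rule k(2)[OF order_refl]) (simp add: s_def)
    moreover have "h (k x) = Q 0 s (P s 0 (k x))" by (rule h(2)[OF order_refl]) (simp add: s_def)
    ultimately show ?thesis by simp
  qed
  have inv: "inv h = k" by (rule inv_unique_comp) (auto simp: fun_eq_iff hk kh)
  have "bij h" by (rule o_bij[of k]) (auto simp: fun_eq_iff hk kh)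
  then have "uniform_conjugacy P Q h"
    unfolding uniform_conjugacy_def inv using h(1,3) k(1,3) by blast
  then show ?thesis by blast
qed

section \<open>Absorption of the contracting component\<close>

context dichotomy
begin

definition absorption_rate :: real where
  "absorption_rate = 6 / 7 * (\<alpha> * exp (- \<alpha> * \<theta>))"

text \<open>
  The fixed point of the recursion that bounds the norm at one grid point by the norm at the
  preceding one.
\<close>

definition limit_radius :: "real \<Rightarrow> real" where
  "limit_radius \<delta> = (\<alpha> * exp (- \<alpha> * \<theta>) / 7 * (2 * \<rho> * \<theta> * \<delta>) + \<rho> * \<delta>) / absorption_rate"

text \<open>
  The margin \<open>1\<close> makes the ball reached in finite time; the remaining terms pass from the grid
  points to whole cells.
\<close>

definition absorbing_radius :: "real \<Rightarrow> real" where
  "absorbing_radius \<delta> = 8 / 7 * (limit_radius \<delta> + 1 + 2 * \<rho> * \<theta> * \<delta>)"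

lemma absorption_rate_pos: "0 < absorption_rate"
  using \<alpha> by (simp add: absorption_rate_def)

text \<open>
  On one cell the forcing is first estimated through the maximum \<open>m\<close> of the solution there, which
  in turn is at most \<open>8/7\<close> of the value at the left end point, up to a constant. Thus the
  perturbation takes away only a seventh of the contraction rate.
\<close>

lemma absorption_on_cell:
  assumes dir: "\<sigma> = 1" "K = 1"
    and w: "interval_solution (T i) (T (i + 1)) (\<zeta> i) (forced p) w"
    and p: "p integrable_on cell i"
    and P: "\<And>t. t \<in> cell i \<Longrightarrow> N (p t) \<le> lam * (N (w t) + N (w (\<zeta> i))) + \<delta>"
    and lam: "0 \<le> lam" "16 * \<rho> * exp (\<alpha> * \<theta>) * lam / \<alpha> < 1" and \<delta>: "0 \<le> \<delta>"
  shows "t \<in> cell i \<Longrightarrow> N (w t) \<le> 8 / 7 * (N (w (T i)) + 2 * \<rho> * \<theta> * \<delta>)"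
    and "N (w (T (i + 1))) - limit_radius \<delta>
      \<le> (1 - absorption_rate * (T (i + 1) - T i)) * (N (w (T i)) - limit_radius \<delta>)"
proof -
  define \<mu> where "\<mu> = \<alpha> * exp (- \<alpha> * \<theta>)"
  define \<Delta> where "\<Delta> = T (i + 1) - T i"
  have \<mu>: "0 < \<mu>" using \<alpha> by (simp add: \<mu>_def)
  have \<Delta>: "0 < \<Delta>" "\<Delta> \<le> \<theta>" using T_less[of i] cell_length[of i] by (auto simp: \<Delta>_def)
  have ee: "exp (\<alpha> * \<theta>) * exp (- \<alpha> * \<theta>) = 1" by (simp flip: exp_add)
  have \<rho>lam: "16 * (\<rho> * lam) \<le> \<mu>"
  proof -
    have "16 * \<rho> * exp (\<alpha> * \<theta>) * lam \<le> \<alpha>" using lam(2) \<alpha> by (simp add: field_simps)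
    then have "(16 * \<rho> * exp (\<alpha> * \<theta>) * lam) * exp (- \<alpha> * \<theta>) \<le> \<mu>"
      unfolding \<mu>_def by (intro mult_right_mono) auto
    moreover have "(16 * \<rho> * exp (\<alpha> * \<theta>) * lam) * exp (- \<alpha> * \<theta>)
        = 16 * (\<rho> * lam) * (exp (\<alpha> * \<theta>) * exp (- \<alpha> * \<theta>))" by (simp only: mult_ac)
    ultimately show ?thesis unfolding ee by linarith
  qed
  have \<mu>\<theta>: "\<mu> * \<theta> \<le> 1 / 2"
  proof -
    have "2 * (\<alpha> * \<theta>) \<le> exp (\<alpha> * \<theta>)" using \<alpha> \<theta> by (intro two_mult_le_exp) simp
    then have "2 * (\<alpha> * \<theta>) * exp (- \<alpha> * \<theta>) \<le> exp (\<alpha> * \<theta>) * exp (- \<alpha> * \<theta>)"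
      by (rule mult_right_mono) simp
    then show ?thesis unfolding ee by (simp add: \<mu>_def mult_ac)
  qed
  have \<rho>lam\<theta>: "4 * (\<rho> * lam) * \<theta> \<le> 1 / 8"
    using mult_right_mono[OF \<rho>lam less_imp_le[OF \<theta>]] \<mu>\<theta> by linarith
  have cw: "continuous_on (cell i) w" using w by (simp add: interval_solution_def)
  obtain tm where tm: "tm \<in> cell i" "\<And>t. t \<in> cell i \<Longrightarrow> N (w t) \<le> N (w tm)"
    using continuous_attains_sup[of "cell i" "\<lambda>t. N (w t)"] continuous_on_N_comp[OF cw] T_in_cell(1)[of i]
    by auto
  define m where "m = N (w tm)"
  define x where "x = N (w (T i))"
  have x: "0 \<le> x" by (simp add: x_def)
  define P where "P = 2 * lam * m + \<delta>"
  have P0: "0 \<le> P" using lam(1) \<delta> by (simp add: P_def m_def)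
  have bound: "N (p t) \<le> P" if "t \<in> cell i" for t
  proof -
    have "lam * (N (w t) + N (w (\<zeta> i))) \<le> lam * (m + m)"
      using tm(2)[OF that] tm(2)[OF zeta_cell] lam(1) unfolding m_def
      by (intro mult_left_mono add_mono) auto
    then show ?thesis using assms(5)[OF that] by (simp add: P_def algebra_simps)
  qed
  have contr: "N (w t) \<le> exp (- \<alpha> * (t - T i)) * x + \<rho> * P * (\<bar>t - \<zeta> i\<bar> + \<bar>T i - \<zeta> i\<bar>)"
    if t: "t \<in> cell i" for t
  proof -
    have "N (Z t t *v w t - Z t (T i) *v w (T i))
        \<le> K * \<rho> * P * (\<bar>t - \<zeta> i\<bar> + \<bar>T i - \<zeta> i\<bar>) * exp (- \<alpha> * \<bar>t - t\<bar>)"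
      by (rule cell_contribution[OF w p bound t T_in_cell(1)]) (use dir t in auto)
    moreover have "N (Z t (T i) *v w (T i)) \<le> K * exp (- \<alpha> * \<bar>t - T i\<bar>) * N (w (T i))"
      by (rule N_Z_le) (use dir t in auto)
    ultimately show ?thesis
      using N_triangle_sub[of "w t" "Z t (T i) *v w (T i)"] dir t by (simp add: Z_refl x_def)
  qed
  have m_le: "m \<le> 8 / 7 * (x + 2 * \<rho> * \<theta> * \<delta>)"
  proof -
    have "exp (- \<alpha> * (tm - T i)) * x \<le> 1 * x" using tm(1) \<alpha> x by (intro mult_right_mono) auto
    moreover have "\<rho> * P * (\<bar>tm - \<zeta> i\<bar> + \<bar>T i - \<zeta> i\<bar>) \<le> \<rho> * P * (2 * \<theta>)"
      using tm(1) zeta_cell[of i] cell_length[of i] rho_pos P0 by (intro mult_left_mono) auto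
    ultimately have "m \<le> x + \<rho> * P * (2 * \<theta>)" using contr[OF tm(1)] by (simp add: m_def)
    also have "\<dots> = x + 2 * \<rho> * \<theta> * \<delta> + 4 * (\<rho> * lam) * \<theta> * m" by (simp add: P_def algebra_simps)
    also have "\<dots> \<le> x + 2 * \<rho> * \<theta> * \<delta> + 1 / 8 * m"
      using mult_right_mono[OF \<rho>lam\<theta>, of m] by (simp add: m_def)
    finally show ?thesis by simp
  qed
  show "N (w t) \<le> 8 / 7 * (N (w (T i)) + 2 * \<rho> * \<theta> * \<delta>)" if "t \<in> cell i"
    using tm(2)[OF that] m_le by (simp add: m_def x_def)
  define c where "c = \<mu> / 7 * (2 * \<rho> * \<theta> * \<delta>) + \<rho> * \<delta>"
  have \<rho>P: "\<rho> * P \<le> \<mu> / 7 * x + c"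
  proof -
    have "\<rho> * P = 2 * (\<rho> * lam) * m + \<rho> * \<delta>" by (simp add: P_def algebra_simps)
    also have "2 * (\<rho> * lam) * m \<le> (\<mu> / 8) * m"
      using \<rho>lam by (intro mult_right_mono) (auto simp: m_def)
    also have "(\<mu> / 8) * m \<le> (\<mu> / 8) * (8 / 7 * (x + 2 * \<rho> * \<theta> * \<delta>))"
      using m_le \<mu> by (intro mult_left_mono) auto
    finally show ?thesis by (simp add: c_def algebra_simps)
  qed
  have rate: "absorption_rate = 6 / 7 * \<mu>" by (simp add: absorption_rate_def \<mu>_def)
  have c: "c = absorption_rate * limit_radius \<delta>"
    using absorption_rate_pos by (simp add: limit_radius_def c_def \<mu>_def)
  have "\<bar>T (i + 1) - \<zeta> i\<bar> + \<bar>T i - \<zeta> i\<bar> = \<Delta>" using zeta_cell[of i] by (auto simp: \<Delta>_def)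
  then have "N (w (T (i + 1))) \<le> exp (- \<alpha> * \<Delta>) * x + \<rho> * P * \<Delta>"
    using contr[OF T_in_cell(2)] by (simp add: \<Delta>_def)
  also have "\<dots> \<le> (1 - \<mu> * \<Delta>) * x + (\<mu> / 7 * x + c) * \<Delta>"
  proof (rule add_mono)
    have "\<mu> * \<Delta> \<le> 1 - exp (- \<alpha> * \<Delta>)" unfolding \<mu>_def using \<Delta> \<alpha> by (intro exp_decrement_ge) auto
    then show "exp (- \<alpha> * \<Delta>) * x \<le> (1 - \<mu> * \<Delta>) * x" using x by (intro mult_right_mono) auto
    show "\<rho> * P * \<Delta> \<le> (\<mu> / 7 * x + c) * \<Delta>" using \<rho>P \<Delta> by (intro mult_right_mono) auto
  qed
  also have "\<dots> = (1 - absorption_rate * \<Delta>) * x + absorption_rate * limit_radius \<delta> * \<Delta>"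
    by (simp add: rate c[unfolded rate] algebra_simps)
  finally show "N (w (T (i + 1))) - limit_radius \<delta>
      \<le> (1 - absorption_rate * (T (i + 1) - T i)) * (N (w (T i)) - limit_radius \<delta>)"
    by (simp add: \<Delta>_def x_def algebra_simps)
qed

lemma absorption:
  assumes dir: "\<sigma> = 1" "K = 1"
    and cells: "\<And>i. \<exists>p. interval_solution (T i) (T (i + 1)) (\<zeta> i) (forced p) w \<and> p integrable_on cell i \<and>
        (\<forall>t\<in>cell i. N (p t) \<le> lam * (N (w t) + N (w (\<zeta> i))) + \<delta>)"
    and lam: "0 \<le> lam" "16 * \<rho> * exp (\<alpha> * \<theta>) * lam / \<alpha> < 1" and \<delta>: "0 \<le> \<delta>"
    and start: "N (w (T i)) \<le> r" and s: "T i + \<theta> + r / absorption_rate \<le> s"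
  shows "N (w s) \<le> absorbing_radius \<delta>"
proof -
  let ?\<nu> = absorption_rate and ?R = "limit_radius \<delta>"
  have r0: "0 \<le> r" using start N_nonneg order_trans by blast
  have R0: "0 \<le> ?R"
    using rho_pos \<theta> \<delta> \<alpha> absorption_rate_pos by (simp add: limit_radius_def)
  have cell_step: "N (w (T (k + 1))) - ?R \<le> (1 - ?\<nu> * (T (k + 1) - T k)) * (N (w (T k)) - ?R)" for k
    using cells[of k] absorption_on_cell(2)[OF dir _ _ _ lam \<delta>] by blast
  have sup: "N (w t) \<le> 8 / 7 * (N (w (T k)) + 2 * \<rho> * \<theta> * \<delta>)" if "t \<in> cell k" for k t
    using cells[of k] absorption_on_cell(1)[OF dir _ _ _ lam \<delta> that] by blast
  have decay: "N (w (T j)) - ?R \<le> exp (- ?\<nu> * (T j - T i)) * r" if "i \<le> j" for j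
    using that
  proof (induction j rule: int_ge_induct)
    case base
    then show ?case using start R0 by simp
  next
    case (step j)
    let ?\<Delta> = "T (j + 1) - T j"
    have "?\<nu> * ?\<Delta> \<le> 1"
    proof -
      have "\<alpha> * exp (- \<alpha> * \<theta>) * ?\<Delta> \<le> 1 - exp (- \<alpha> * ?\<Delta>)"
        using T_less[of j] cell_length[of j] \<alpha> by (intro exp_decrement_ge) auto
      moreover have "0 < exp (- \<alpha> * ?\<Delta>)" by simp
      moreover have "0 \<le> \<alpha> * exp (- \<alpha> * \<theta>) * ?\<Delta>" using \<alpha> T_less[of j] by simp
      moreover have "?\<nu> * ?\<Delta> = 6 / 7 * (\<alpha> * exp (- \<alpha> * \<theta>) * ?\<Delta>)" by (simp add: absorption_rate_def)
      ultimately show ?thesis by linarith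
    qed
    then have "(1 - ?\<nu> * ?\<Delta>) * (N (w (T j)) - ?R) \<le> (1 - ?\<nu> * ?\<Delta>) * (exp (- ?\<nu> * (T j - T i)) * r)"
      using step.IH by (intro mult_left_mono) auto
    also have "\<dots> \<le> exp (- ?\<nu> * ?\<Delta>) * (exp (- ?\<nu> * (T j - T i)) * r)"
      using exp_ge_add_one_self[of "- ?\<nu> * ?\<Delta>"] r0 by (intro mult_right_mono) auto
    also have "\<dots> = exp (- ?\<nu> * (T (j + 1) - T i)) * r"
      by (simp add: algebra_simps flip: exp_add mult.assoc)
    finally show ?case using cell_step[of j] by linarith
  qed
  obtain j where j: "T j \<le> s" "s < T (j + 1)" using cell_coverE by blast
  have late: "r / ?\<nu> \<le> T j - T i" using s j cell_length[of j] by linarith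
  have "0 \<le> r / ?\<nu>" using r0 absorption_rate_pos by simp
  then have "T i + \<theta> \<le> s" using s by linarith
  then have "i \<le> j" using j cell_length[of i] T_mono[of "j + 1" i] \<theta> by (cases "i \<le> j") auto
  then have "N (w (T j)) - ?R \<le> exp (- ?\<nu> * (T j - T i)) * r" by (rule decay)
  also have "\<dots> \<le> 1"
  proof -
    have "r \<le> ?\<nu> * (T j - T i)" using late absorption_rate_pos by (simp add: field_simps)
    also have "\<dots> \<le> exp (?\<nu> * (T j - T i))"
      using exp_ge_add_one_self[of "?\<nu> * (T j - T i)"] by linarith
    finally have "exp (- ?\<nu> * (T j - T i)) * r \<le> exp (- ?\<nu> * (T j - T i)) * exp (?\<nu> * (T j - T i))"
      by (intro mult_left_mono) auto
    then show ?thesis by (simp flip: exp_add)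
  qed
  finally have "N (w (T j)) \<le> ?R + 1" by simp
  then have "8 / 7 * (N (w (T j)) + 2 * \<rho> * \<theta> * \<delta>) \<le> absorbing_radius \<delta>"
    by (simp add: absorbing_radius_def)
  then show ?thesis using sup[of s j] j by auto
qed

end

section \<open>The coupled system\<close>

lemma (in grid) integrable_if_on_cells:
  fixes h :: "real \<Rightarrow> 'a::euclidean_space"
  assumes h: "\<And>i. h integrable_on cell i"
  shows "h integrable_on {a..b}"
proof -
  obtain i where i: "T i \<le> a" using T_unbounded_below by blast
  obtain j where j: "\<And>k. j \<le> k \<Longrightarrow> b \<le> T k" using T_unbounded_above by blast
  have "h integrable_on {T i..T k}" if "i \<le> k" for k
    using that
  proof (induction k rule: int_ge_induct)
    case (step k)
    then show ?case
      using T_less[of k] T_mono[of i k] h[of k]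
      by (intro Henstock_Kurzweil_Integration.integrable_combine[of "T i" "T k" "T (k + 1)"]) auto
  qed (use integrable_on_refl[of h "T i"] in simp)
  then have "h integrable_on {T i..T (max i j)}" by simp
  then show ?thesis by (rule integrable_on_subinterval) (use i j[of "max i j"] in auto)
qed

context depca
begin

lemma frozen_field_integrable:
  assumes "continuous_on (cell i) z"
  shows "(\<lambda>s. F s (z s) y) integrable_on cell i"
  by (rule caratheodory_integrable_N[OF F_integrable F_lipschitz assms])

lemma field_along_integrable:
  assumes z: "continuous_on UNIV z"
  shows "(\<lambda>s. F s (z s) (z (\<gamma> s))) integrable_on {a..b}"
proof (rule integrable_if_on_cells)
  fix i
  have "(\<lambda>s. F s (z s) (z (\<zeta> i))) integrable_on cell i"
    by (rule frozen_field_integrable[OF continuous_on_subset[OF z]]) simp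
  then show "(\<lambda>s. F s (z s) (z (\<gamma> s))) integrable_on cell i"
    by (rule integrable_spike[OF _ negligible_sing[of "T (i + 1)"]]) (subst gamma_eq, auto)
qed

end

lemma has_integral_fst:
  assumes "(h has_integral I) S"
  shows "((\<lambda>t. fst (h t)) has_integral fst I) S"
  using has_integral_linear[OF assms bounded_linear_fst] by (simp add: o_def)

lemma has_integral_snd:
  assumes "(h has_integral I) S"
  shows "((\<lambda>t. snd (h t)) has_integral snd I) S"
  using has_integral_linear[OF assms bounded_linear_snd] by (simp add: o_def)

lemma has_integral_Pair:
  fixes h :: "real \<Rightarrow> 'a::euclidean_space" and k :: "real \<Rightarrow> 'b::euclidean_space"
  assumes "(h has_integral I) S" "(k has_integral J) S"
  shows "((\<lambda>t. (h t, k t)) has_integral (I, J)) S"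
proof -
  have "bounded_linear (\<lambda>x :: 'a. (x, 0 :: 'b))" "bounded_linear (\<lambda>y :: 'b. (0 :: 'a, y))"
    by (auto intro!: bounded_linear_Pair bounded_linear_ident bounded_linear_zero)
  from has_integral_add[OF has_integral_linear[OF assms(1) this(1)] has_integral_linear[OF assms(2) this(2)]]
  show ?thesis by (simp add: o_def)
qed

text \<open>
  The constants \<open>\<beta> + l\<close> and \<open>\<beta>0 + l\<close>, which are those of a perturbed system, are used for the linear
  system and its blocks too. A single smallness condition then serves all of them.
\<close>

locale coupled =
  X: dichotomy N1 T \<zeta> \<gamma> \<theta> "\<beta> + l" "\<beta>0 + l" A A0 Z1 1 1 \<alpha> \<rho>1 +
  Y: dichotomy N2 T \<zeta> \<gamma> \<theta> "\<beta> + l" "\<beta>0 + l" B B0 Z2 "- 1" K \<alpha> \<rho>2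
  for N1 :: "real^'n \<Rightarrow> real" and N2 :: "real^'m \<Rightarrow> real" and T \<zeta> \<gamma> \<theta> \<beta> \<beta>0 l A A0 Z1 B B0 Z2 K \<alpha> \<rho>1 \<rho>2 +
  fixes N :: "(real^'n) \<times> (real^'m) \<Rightarrow> real"
  assumes product_norm: "product_vector_norm N1 N2 N"
    and l_nonneg: "0 \<le> l" and b_nonneg: "0 \<le> \<beta>" "0 \<le> \<beta>0"
    and A_le: "matrix_norm N1 (A t) \<le> \<beta>" and A0_le: "matrix_norm N1 (A0 t) \<le> \<beta>0"
    and B_le: "matrix_norm N2 (B t) \<le> \<beta>" and B0_le: "matrix_norm N2 (B0 t) \<le> \<beta>0"
begin

lemma N_mono: "N1 x \<le> N1 x' \<Longrightarrow> N2 y \<le> N2 y' \<Longrightarrow> N (x, y) \<le> N (x', y')"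
  and N_left: "N (x, 0) = N1 x" and N_right: "N (0, y) = N2 y"
  using product_norm by (auto simp: product_vector_norm_def)

sublocale NN: interval_ivp N \<theta> "\<beta> + l" "\<beta>0 + l"
  using product_norm X.\<beta> X.\<beta>0 X.\<theta> X.small
  by unfold_locales (auto simp: product_vector_norm_def)

lemma N1_le: "N1 x \<le> N (x, y)" and N2_le: "N2 y \<le> N (x, y)"
  using N_mono[of x x 0 y] N_mono[of 0 x y y] by (simp_all add: N_left N_right)

lemma N_le_sum: "N (x, y) \<le> N1 x + N2 y"
  using NN.N_triangle[of "(x, 0)" "(0, y)"] by (simp add: N_left N_right)

lemma N_blocks_le:
  assumes "matrix_norm N1 P \<le> c" "matrix_norm N2 Q \<le> c" "0 \<le> c"
  shows "N (P *v x, Q *v y) \<le> c * N (x, y)"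
proof -
  have "N (P *v x, Q *v y) \<le> N (c *\<^sub>R x, c *\<^sub>R y)"
  proof (rule N_mono)
    show "N1 (P *v x) \<le> N1 (c *\<^sub>R x)"
      using matrix_norm_le[OF X.vector_norm, of P x] mult_right_mono[OF assms(1), of "N1 x"] assms(3)
      by (simp add: X.N_scaleR)
    show "N2 (Q *v y) \<le> N2 (c *\<^sub>R y)"
      using matrix_norm_le[OF Y.vector_norm, of Q y] mult_right_mono[OF assms(2), of "N2 y"] assms(3)
      by (simp add: Y.N_scaleR)
  qed
  also have "\<dots> = c * N (x, y)" using NN.N_scaleR[of c "(x, y)"] assms(3) by simp
  finally show ?thesis .
qed

lemma linear_field_lipschitz:
  "N (linear_field A A0 B B0 t u v - linear_field A A0 B B0 t u' v') \<le> \<beta> * N (u - u') + \<beta>0 * N (v - v')"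
proof -
  let ?p = "(A t *v fst (u - u'), B t *v snd (u - u'))" and ?q = "(A0 t *v fst (v - v'), B0 t *v snd (v - v'))"
  have eq: "linear_field A A0 B B0 t u v - linear_field A A0 B B0 t u' v' = ?p + ?q"
    by (simp add: linear_field_def split_def matrix_vector_mult_diff_distrib)
  have "N ?p \<le> \<beta> * N (u - u')" "N ?q \<le> \<beta>0 * N (v - v')"
    using N_blocks_le[OF A_le B_le b_nonneg(1), of t "fst (u - u')" t "snd (u - u')"]
      N_blocks_le[OF A0_le B0_le b_nonneg(2), of t "fst (v - v')" t "snd (v - v')"]
    by (simp_all only: prod.collapse)
  then show ?thesis unfolding eq using NN.N_triangle[of ?p ?q] by linarith
qed

lemma linear_field_integrable: "(\<lambda>t. linear_field A A0 B B0 t u v) integrable_on {a..b}"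
proof -
  have "(\<lambda>t. A t *v fst u + A0 t *v fst v) integrable_on {a..b}"
    "(\<lambda>t. B t *v snd u + B0 t *v snd v) integrable_on {a..b}"
    by (intro integrable_add matrix_vector_integrable X.A_integrable X.A0_integrable Y.A_integrable Y.A0_integrable)+
  then have "(\<lambda>t. (A t *v fst u + A0 t *v fst v, B t *v snd u + B0 t *v snd v)) integrable_on {a..b}"
    unfolding integrable_on_def using has_integral_Pair by blast
  then show ?thesis by (simp add: linear_field_def split_def)
qed

sublocale L: depca N T \<zeta> \<gamma> \<theta> "\<beta> + l" "\<beta>0 + l" "linear_field A A0 B B0" 0
proof
  show "(\<lambda>t. linear_field A A0 B B0 t x y) integrable_on {a..b}" for x y a b
    by (rule linear_field_integrable)
  show "N (linear_field A A0 B B0 t u v - linear_field A A0 B B0 t u' v')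
      \<le> (\<beta> + l) * N (u - u') + (\<beta>0 + l) * N (v - v')" for t u v u' v'
    using linear_field_lipschitz[of t u v u' v'] mult_nonneg_nonneg[OF l_nonneg NN.N_nonneg[of "u - u'"]]
      mult_nonneg_nonneg[OF l_nonneg NN.N_nonneg[of "v - v'"]] by (simp add: distrib_right)
  show "N (linear_field A A0 B B0 t 0 0) \<le> 0" for t
    by (simp add: linear_field_def split_def zero_prod_def[symmetric])
qed

lemma linear_plus_forcing:
  "linear_field A A0 B B0 t u v + p = (X.forced (\<lambda>_. fst p) t (fst u) (fst v), Y.forced (\<lambda>_. snd p) t (snd u) (snd v))"
  by (simp add: linear_field_def split_def X.forced_def Y.forced_def plus_prod_def)

lemma cell_components:
  assumes "interval_solution a b c (\<lambda>t u v. linear_field A A0 B B0 t u v + h t u v) z"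
  shows "interval_solution a b c (X.forced (\<lambda>t. fst (h t (z t) (z c)))) (\<lambda>t. fst (z t))"
    and "interval_solution a b c (Y.forced (\<lambda>t. snd (h t (z t) (z c)))) (\<lambda>t. snd (z t))"
proof -
  have eq: "(\<lambda>s. fst (linear_field A A0 B B0 s (z s) (z c) + h s (z s) (z c)))
        = (\<lambda>s. X.forced (\<lambda>t. fst (h t (z t) (z c))) s (fst (z s)) (fst (z c)))"
      "(\<lambda>s. snd (linear_field A A0 B B0 s (z s) (z c) + h s (z s) (z c)))
        = (\<lambda>s. Y.forced (\<lambda>t. snd (h t (z t) (z c))) s (snd (z s)) (snd (z c)))"
    by (simp_all add: linear_plus_forcing X.forced_def Y.forced_def)
  have cont: "continuous_on {a..b} z" and
    int: "\<And>t. t \<in> {a..b} \<Longrightarrow> ((\<lambda>s. linear_field A A0 B B0 s (z s) (z c) + h s (z s) (z c))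
      has_integral (z t - z a)) {a..t}"
    using assms by (auto simp: interval_solution_def)
  show "interval_solution a b c (X.forced (\<lambda>t. fst (h t (z t) (z c)))) (\<lambda>t. fst (z t))"
    "interval_solution a b c (Y.forced (\<lambda>t. snd (h t (z t) (z c)))) (\<lambda>t. snd (z t))"
    unfolding interval_solution_def eq[symmetric]
    using has_integral_fst[OF int] has_integral_snd[OF int]
    by (auto simp: minus_prod_def intro!: continuous_on_fst continuous_on_snd cont)
qed

lemma solution_components:
  assumes "depca_solution T \<gamma> (\<lambda>t u v. linear_field A A0 B B0 t u v + h t u v) z"
  shows "depca_solution T \<gamma> (X.forced (\<lambda>t. fst (h t (z t) (z (\<gamma> t))))) (\<lambda>t. fst (z t))"
    and "depca_solution T \<gamma> (Y.forced (\<lambda>t. snd (h t (z t) (z (\<gamma> t))))) (\<lambda>t. snd (z t))"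
proof -
  have eq: "(\<lambda>s. fst (linear_field A A0 B B0 s (z s) (z (\<gamma> s)) + h s (z s) (z (\<gamma> s))))
        = (\<lambda>s. X.forced (\<lambda>t. fst (h t (z t) (z (\<gamma> t)))) s (fst (z s)) (fst (z (\<gamma> s))))"
      "(\<lambda>s. snd (linear_field A A0 B B0 s (z s) (z (\<gamma> s)) + h s (z s) (z (\<gamma> s))))
        = (\<lambda>s. Y.forced (\<lambda>t. snd (h t (z t) (z (\<gamma> t)))) s (snd (z s)) (snd (z (\<gamma> s))))"
    by (simp_all add: linear_plus_forcing X.forced_def Y.forced_def)
  have cont: "continuous_on UNIV z" and
    int: "\<And>i t. t \<in> {T i..T (i + 1)} \<Longrightarrow>
      ((\<lambda>s. linear_field A A0 B B0 s (z s) (z (\<gamma> s)) + h s (z s) (z (\<gamma> s)))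
      has_integral (z t - z (T i))) {T i..t}"
    using assms by (auto simp: depca_solution_def)
  show "depca_solution T \<gamma> (X.forced (\<lambda>t. fst (h t (z t) (z (\<gamma> t))))) (\<lambda>t. fst (z t))"
    "depca_solution T \<gamma> (Y.forced (\<lambda>t. snd (h t (z t) (z (\<gamma> t))))) (\<lambda>t. snd (z t))"
    unfolding depca_solution_def eq[symmetric]
    using has_integral_fst[OF int] has_integral_snd[OF int]
    by (auto simp: minus_prod_def intro!: continuous_on_fst continuous_on_snd cont)
qed

end

lemma depca_solution_diff:
  assumes "depca_solution T \<gamma> G z" "depca_solution T \<gamma> H w"
    and D: "\<And>t. D t (z t - w t) (z (\<gamma> t) - w (\<gamma> t)) = G t (z t) (z (\<gamma> t)) - H t (w t) (w (\<gamma> t))"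
  shows "depca_solution T \<gamma> D (\<lambda>t. z t - w t)"
  unfolding depca_solution_def D
proof (intro conjI allI ballI)
  show "continuous_on UNIV (\<lambda>t. z t - w t)"
    using assms by (auto simp: depca_solution_def intro: continuous_on_diff)
  fix i t assume t: "t \<in> {T i..T (i + 1)}"
  have "((\<lambda>s. G s (z s) (z (\<gamma> s)) - H s (w s) (w (\<gamma> s))) has_integral (z t - z (T i)) - (w t - w (T i))) {T i..t}"
    using assms t by (intro has_integral_diff) (auto simp: depca_solution_def)
  then show "((\<lambda>s. G s (z s) (z (\<gamma> s)) - H s (w s) (w (\<gamma> s))) has_integral z t - w t - (z (T i) - w (T i))) {T i..t}"
    by (simp add: algebra_simps)
qed

context coupled
begin

lemma linear_field_diff:
  "linear_field A A0 B B0 t (u - u') (v - v')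
    = linear_field A A0 B B0 t u v - linear_field A A0 B B0 t u' v'"
  by (simp add: linear_field_def split_def matrix_vector_mult_diff_distrib)

lemma bounded_forced_estimate:
  assumes z: "depca_solution T \<gamma> (\<lambda>t u v. linear_field A A0 B B0 t u v + p t) z"
    and p: "\<And>a b. p integrable_on {a..b}"
    and P: "\<And>t. N1 (fst (p t)) \<le> P" "\<And>t. N2 (snd (p t)) \<le> P"
    and bounded: "\<And>t. N1 (fst (z t)) \<le> C" "\<And>t. N2 (snd (z t)) \<le> C"
  shows "N1 (fst (z t)) \<le> 2 * \<rho>1 * P * exp (\<alpha> * \<theta>) / \<alpha>"
    and "N2 (snd (z t)) \<le> 2 * K * \<rho>2 * P * exp (\<alpha> * \<theta>) / \<alpha>"
proof -
  have int: "(\<lambda>t. fst (p t)) integrable_on {a..b}" "(\<lambda>t. snd (p t)) integrable_on {a..b}" for a b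
    using p[of a b] unfolding integrable_on_def by (blast intro: has_integral_fst has_integral_snd)+
  show "N1 (fst (z t)) \<le> 2 * \<rho>1 * P * exp (\<alpha> * \<theta>) / \<alpha>"
    using X.bounded_solution_estimate[OF solution_components(1)[OF z] int(1) P(1) bounded(1)] by simp
  show "N2 (snd (z t)) \<le> 2 * K * \<rho>2 * P * exp (\<alpha> * \<theta>) / \<alpha>"
    using Y.bounded_solution_estimate[OF solution_components(2)[OF z] int(2) P(2) bounded(2)] by simp
qed

lemma bounded_forced_exists:
  assumes p: "\<And>a b. p integrable_on {a..b}"
    and P: "\<And>t. N1 (fst (p t)) \<le> P" "\<And>t. N2 (snd (p t)) \<le> P"
  obtains w where "depca_solution T \<gamma> (\<lambda>t u v. linear_field A A0 B B0 t u v + p t) w"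
    and "\<And>t. N1 (fst (w t)) \<le> 2 * \<rho>1 * P * exp (\<alpha> * \<theta>) / \<alpha>"
    and "\<And>t. N2 (snd (w t)) \<le> 2 * K * \<rho>2 * P * exp (\<alpha> * \<theta>) / \<alpha>"
proof -
  have int: "(\<lambda>t. fst (p t)) integrable_on {a..b}" "(\<lambda>t. snd (p t)) integrable_on {a..b}" for a b
    using p[of a b] unfolding integrable_on_def by (blast intro: has_integral_fst has_integral_snd)+
  obtain w1 where w1: "depca_solution T \<gamma> (X.forced (\<lambda>t. fst (p t))) w1"
      "\<And>t. N1 (w1 t) \<le> 2 * 1 * \<rho>1 * P * exp (\<alpha> * \<theta>) / \<alpha>"
    by (rule X.bounded_solution_exists[OF int(1) P(1)]) blast
  obtain w2 where w2: "depca_solution T \<gamma> (Y.forced (\<lambda>t. snd (p t))) w2"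
      "\<And>t. N2 (w2 t) \<le> 2 * K * \<rho>2 * P * exp (\<alpha> * \<theta>) / \<alpha>"
    by (rule Y.bounded_solution_exists[OF int(2) P(2)]) blast
  show thesis
  proof
    have eq: "linear_field A A0 B B0 s (w1 s, w2 s) (w1 (\<gamma> s), w2 (\<gamma> s)) + p s
        = (X.forced (\<lambda>t. fst (p t)) s (w1 s) (w1 (\<gamma> s)), Y.forced (\<lambda>t. snd (p t)) s (w2 s) (w2 (\<gamma> s)))" for s
      by (simp add: linear_plus_forcing X.forced_def Y.forced_def)
    show "depca_solution T \<gamma> (\<lambda>t u v. linear_field A A0 B B0 t u v + p t) (\<lambda>t. (w1 t, w2 t))"
      unfolding depca_solution_def eq
    proof (intro conjI allI ballI)
      show "continuous_on UNIV (\<lambda>t. (w1 t, w2 t))"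
        using w1(1) w2(1) by (auto simp: depca_solution_def intro: continuous_on_Pair)
      fix i t assume t: "t \<in> {T i..T (i + 1)}"
      have "((\<lambda>s. (X.forced (\<lambda>t. fst (p t)) s (w1 s) (w1 (\<gamma> s)), Y.forced (\<lambda>t. snd (p t)) s (w2 s) (w2 (\<gamma> s))))
          has_integral (w1 t - w1 (T i), w2 t - w2 (T i))) {T i..t}"
        using w1(1) w2(1) t by (intro has_integral_Pair) (auto simp: depca_solution_def)
      then show "((\<lambda>s. (X.forced (\<lambda>t. fst (p t)) s (w1 s) (w1 (\<gamma> s)), Y.forced (\<lambda>t. snd (p t)) s (w2 s) (w2 (\<gamma> s))))
          has_integral (w1 t, w2 t) - (w1 (T i), w2 (T i))) {T i..t}"
        by simp
    qed
  qed (use w1(2) w2(2) in auto)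
qed

end

section \<open>Perturbed systems\<close>

lemma norm_fst_component: "norm (fst p) \<le> norm p" and norm_snd_component: "norm (snd p) \<le> norm p"
  by (metis norm_fst_le prod.collapse) (metis norm_snd_le prod.collapse)

locale perturbed =
  coupled N1 N2 T \<zeta> \<gamma> \<theta> \<beta> \<beta>0 l A A0 Z1 B B0 Z2 K \<alpha> \<rho>1 \<rho>2 N
  for N1 :: "real^'n \<Rightarrow> real" and N2 :: "real^'m \<Rightarrow> real" and T \<zeta> \<gamma> \<theta> \<beta> \<beta>0 l A A0 Z1 B B0 Z2 K \<alpha> \<rho>1 \<rho>2 N +
  fixes f :: "real \<Rightarrow> real^'n \<Rightarrow> real^'n \<Rightarrow> real^'n" and g :: "real \<Rightarrow> real^'n \<Rightarrow> real^'n \<Rightarrow> real^'m"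
    and \<phi> :: "real \<Rightarrow> real^'m \<Rightarrow> real^'m \<Rightarrow> real^'n" and \<psi> :: "real \<Rightarrow> real^'m \<Rightarrow> real^'m \<Rightarrow> real^'m"
    and lam \<delta> :: real
  assumes f_integrable: "(\<lambda>t. f t x xb) integrable_on {a..b}"
    and g_integrable: "(\<lambda>t. g t x xb) integrable_on {a..b}"
    and \<phi>_integrable: "(\<lambda>t. \<phi> t y yb) integrable_on {a..b}"
    and \<psi>_integrable: "(\<lambda>t. \<psi> t y yb) integrable_on {a..b}"
    and growth_f: "N1 (f t x xb) \<le> lam * (N1 x + N1 xb)"
    and growth_g: "N2 (g t x xb) \<le> lam * (N1 x + N1 xb)"
    and bound_\<phi>: "N1 (\<phi> t y yb) \<le> \<delta>" and bound_\<psi>: "N2 (\<psi> t y yb) \<le> \<delta>"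
    and lipschitz: "N (nonlinear_term f g \<phi> \<psi> t z zb - nonlinear_term f g \<phi> \<psi> t w wb)
        \<le> l * (N (z - w) + N (zb - wb))"
    and lam: "0 \<le> lam" "16 * \<rho>1 * exp (\<alpha> * \<theta>) * lam / \<alpha> < 1"
begin

lemma delta_nonneg: "0 \<le> \<delta>"
  using bound_\<phi> X.N_nonneg order_trans by blast

sublocale P: depca N T \<zeta> \<gamma> \<theta> "\<beta> + l" "\<beta>0 + l"
  "\<lambda>t z zb. linear_field A A0 B B0 t z zb + nonlinear_term f g \<phi> \<psi> t z zb" "2 * \<delta>"
proof
  fix x y :: "(real^'n) \<times> (real^'m)" and a b t :: real
  have "(\<lambda>t. f t (fst x) (fst y) + \<phi> t (snd x) (snd y)) integrable_on {a..b}"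
    "(\<lambda>t. g t (fst x) (fst y) + \<psi> t (snd x) (snd y)) integrable_on {a..b}"
    by (intro integrable_add f_integrable g_integrable \<phi>_integrable \<psi>_integrable)+
  then have "(\<lambda>t. (f t (fst x) (fst y) + \<phi> t (snd x) (snd y), g t (fst x) (fst y) + \<psi> t (snd x) (snd y)))
      integrable_on {a..b}"
    unfolding integrable_on_def using has_integral_Pair by blast
  then have "(\<lambda>t. nonlinear_term f g \<phi> \<psi> t x y) integrable_on {a..b}"
    by (simp add: nonlinear_term_def split_def)
  then show "(\<lambda>t. linear_field A A0 B B0 t x y + nonlinear_term f g \<phi> \<psi> t x y) integrable_on {a..b}"
    by (intro integrable_add linear_field_integrable)
  have "f t 0 0 = 0" "g t 0 0 = 0"
    using growth_f[of t 0 0] growth_g[of t 0 0] by simp_all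
  then have "linear_field A A0 B B0 t 0 0 + nonlinear_term f g \<phi> \<psi> t 0 0 = (\<phi> t 0 0, \<psi> t 0 0)"
    by (simp add: linear_field_def nonlinear_term_def split_def zero_prod_def)
  then show "N (linear_field A A0 B B0 t 0 0 + nonlinear_term f g \<phi> \<psi> t 0 0) \<le> 2 * \<delta>"
    using N_le_sum[of "\<phi> t 0 0" "\<psi> t 0 0"] bound_\<phi>[of t 0 0] bound_\<psi>[of t 0 0] by simp
next
  fix t :: real and u v u' v' :: "(real^'n) \<times> (real^'m)"
  let ?L = "linear_field A A0 B B0 t" and ?h = "nonlinear_term f g \<phi> \<psi> t"
  have eq: "?L u v + ?h u v - (?L u' v' + ?h u' v') = (?L u v - ?L u' v') + (?h u v - ?h u' v')" by simp
  show "N (?L u v + ?h u v - (?L u' v' + ?h u' v')) \<le> (\<beta> + l) * N (u - u') + (\<beta>0 + l) * N (v - v')"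
    unfolding eq
    using NN.N_triangle[of "?L u v - ?L u' v'" "?h u v - ?h u' v'"]
      linear_field_lipschitz[of t u v u' v'] lipschitz[of t u v u' v']
    by (simp only: distrib_left distrib_right)
qed

lemma contracting_component_absorbed:
  assumes z: "depca_solution T \<gamma> (\<lambda>t z zb. linear_field A A0 B B0 t z zb + nonlinear_term f g \<phi> \<psi> t z zb) z"
    and start: "N1 (fst (z (T i))) \<le> r" and s: "T i + \<theta> + r / X.absorption_rate \<le> s"
  shows "N1 (fst (z s)) \<le> X.absorbing_radius \<delta>"
proof (rule X.absorption[OF refl refl _ lam delta_nonneg, where w = "\<lambda>t. fst (z t)", OF _ start s])
  fix i
  let ?p = "\<lambda>t. nonlinear_term f g \<phi> \<psi> t (z t) (z (\<zeta> i))"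
  have cell: "P.cell_solution i z" using z X.depca_solution_iff_interval by blast
  then have cz: "continuous_on (X.cell i) z" by (simp add: interval_solution_def)
  have "(\<lambda>t. linear_field A A0 B B0 t (z t) (z (\<zeta> i)) + ?p t - linear_field A A0 B B0 t (z t) (z (\<zeta> i)))
      integrable_on X.cell i"
    by (intro integrable_diff P.frozen_field_integrable L.frozen_field_integrable cz)
  then have "?p integrable_on X.cell i" by simp
  then have "(\<lambda>t. fst (?p t)) integrable_on X.cell i"
    unfolding integrable_on_def using has_integral_fst by blast
  moreover have "N1 (fst (?p t)) \<le> lam * (N1 (fst (z t)) + N1 (fst (z (\<zeta> i)))) + \<delta>" for t
    using X.N_triangle[of "f t (fst (z t)) (fst (z (\<zeta> i)))" "\<phi> t (snd (z t)) (snd (z (\<zeta> i)))"]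
      growth_f[of t "fst (z t)" "fst (z (\<zeta> i))"] bound_\<phi>[of t "snd (z t)" "snd (z (\<zeta> i))"]
    by (simp add: nonlinear_term_def split_def)
  ultimately show "\<exists>p. interval_solution (T i) (T (i + 1)) (\<zeta> i) (X.forced p) (\<lambda>t. fst (z t)) \<and>
      p integrable_on X.cell i \<and>
      (\<forall>t\<in>X.cell i. N1 (p t) \<le> lam * (N1 (fst (z t)) + N1 (fst (z (\<zeta> i)))) + \<delta>)"
    using cell_components(1)[OF cell] by blast
qed

text \<open>
  The absorption estimate starts at a grid point. The next one is reached within time \<open>\<theta>\<close>, in which
  the orbit can grow only by a bounded amount.
\<close>

lemma orbits_absorbed:
  "\<exists>S\<ge>0. \<forall>t x s. norm x \<le> r \<longrightarrow> t + S \<le> s \<longrightarrow> N1 (fst (P.flow s t x)) \<le> X.absorbing_radius \<delta>"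
proof -
  obtain C where C: "C > 0" "\<And>x. N1 x \<le> C * norm x" using X.N_le_norm by auto
  obtain r0 where r0: "\<And>t s x. \<bar>t - s\<bar> \<le> \<theta> \<Longrightarrow> norm x \<le> r \<Longrightarrow> norm (P.flow t s x) \<le> r0"
    using P.bounded_growth by meson
  define r' where "r' = C * max 0 r0"
  define S where "S = 2 * \<theta> + r' / X.absorption_rate"
  have r': "0 \<le> r' / X.absorption_rate" using C(1) X.absorption_rate_pos by (simp add: r'_def)
  have "N1 (fst (P.flow s t x)) \<le> X.absorbing_radius \<delta>" if x: "norm x \<le> r" and s: "t + S \<le> s" for t x s
  proof -
    obtain i where i: "T i \<le> t" "t < T (i + 1)" using X.cell_coverE by blast
    have near: "\<bar>T (i + 1) - t\<bar> \<le> \<theta>" using i X.cell_length[of i] by auto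
    have "norm (fst (P.flow (T (i + 1)) t x)) \<le> max 0 r0"
      using r0[OF near x] norm_fst_component[of "P.flow (T (i + 1)) t x"] by linarith
    then have "N1 (fst (P.flow (T (i + 1)) t x)) \<le> r'"
      using C(2)[of "fst (P.flow (T (i + 1)) t x)"] mult_left_mono[of _ "max 0 r0" C] C(1)
      unfolding r'_def by (meson less_imp_le order_trans)
    moreover have "T (i + 1) + \<theta> + r' / X.absorption_rate \<le> s" using near s by (simp add: S_def)
    ultimately show ?thesis by (rule contracting_component_absorbed[OF P.flow_solution])
  qed
  moreover have "0 \<le> S" using r' X.\<theta> by (simp add: S_def)
  ultimately show ?thesis by blast
qed

text \<open>
  The turning time \<open>s\<close> may lie inside a cell, and the equation there refers to the whole cell. So the
  orbit must be absorbed already at time \<open>s - \<theta>\<close>.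
\<close>

lemma eventually_orbits_of_other_system:
  assumes "perturbed N1 N2 T \<zeta> \<gamma> \<theta> \<beta> \<beta>0 l A A0 Z1 B B0 Z2 K \<alpha> \<rho>1 \<rho>2 N f' g' \<phi> \<psi> lam \<delta>"
    and agree: "\<And>t x xb. N1 x + N1 xb \<le> 2 * X.absorbing_radius \<delta> \<Longrightarrow>
        f' t x xb = f t x xb \<and> g' t x xb = g t x xb"
  shows "\<exists>S\<ge>0. \<forall>t x s s'. norm x \<le> r \<longrightarrow> t + S \<le> s \<longrightarrow> s \<le> s' \<longrightarrow>
      depca.flow T \<gamma> (\<lambda>t z zb. linear_field A A0 B B0 t z zb + nonlinear_term f' g' \<phi> \<psi> t z zb) s' s (P.flow s t x)
        = P.flow s' t x"
proof -
  interpret Q: perturbed N1 N2 T \<zeta> \<gamma> \<theta> \<beta> \<beta>0 l A A0 Z1 B B0 Z2 K \<alpha> \<rho>1 \<rho>2 N f' g' \<phi> \<psi> lam \<delta> by fact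
  obtain S where S: "0 \<le> S"
      "\<And>t x s. norm x \<le> r \<Longrightarrow> t + S \<le> s \<Longrightarrow> N1 (fst (P.flow s t x)) \<le> X.absorbing_radius \<delta>"
    using orbits_absorbed[of r] by blast
  have "Q.P.flow s' s (P.flow s t x) = P.flow s' t x"
    if x: "norm x \<le> r" and s: "t + (S + \<theta>) \<le> s" "s \<le> s'" for t x s s'
  proof -
    let ?z = "\<lambda>s. P.flow s t x"
    obtain i where i: "T i \<le> s" "s < T (i + 1)" using X.cell_coverE by blast
    have cell: "Q.P.cell_solution k ?z" if k: "i \<le> k" for k
    proof (rule interval_solution_cong)
      show "P.cell_solution k ?z" using P.flow_solution X.depca_solution_iff_interval by blast
      show "\<zeta> k \<in> X.cell k" by (rule X.zeta_cell)
      fix q assume q: "q \<in> X.cell k"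
      have "t + S \<le> T k" using s i X.cell_length[of i] X.T_mono[OF k] by linarith
      then have "N1 (fst (?z q)) \<le> X.absorbing_radius \<delta>" "N1 (fst (?z (\<zeta> k))) \<le> X.absorbing_radius \<delta>"
        using q X.zeta_cell[of k] by (auto intro!: S(2)[OF x])
      then have "N1 (fst (?z q)) + N1 (fst (?z (\<zeta> k))) \<le> 2 * X.absorbing_radius \<delta>" by simp
      from agree[OF this]
      show "linear_field A A0 B B0 q (?z q) (?z (\<zeta> k)) + nonlinear_term f' g' \<phi> \<psi> q (?z q) (?z (\<zeta> k))
          = linear_field A A0 B B0 q (?z q) (?z (\<zeta> k)) + nonlinear_term f g \<phi> \<psi> q (?z q) (?z (\<zeta> k))"
        by (simp add: nonlinear_term_def split_def)
    qed simp
    have "Q.P.cell_solution k (\<lambda>s'. Q.P.flow s' s (?z s))" for k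
      using Q.P.flow_solution X.depca_solution_iff_interval by blast
    from Q.P.forward_uniqueness[OF this cell _ _ s(2)] show ?thesis using i by simp
  qed
  then show ?thesis using S(1) X.\<theta> by (intro exI[of _ "S + \<theta>"]) auto
qed

text \<open>
  The difference between a perturbed and a linear orbit at bounded distance is the bounded solution
  of a linear equation with bounded forcing. Two perturbed orbits at bounded distance coincide,
  because the estimate improves any bound for their distance by the factor \<open>q\<close>.
\<close>

lemma bounded_perturbation_conjugacy:
  assumes M: "\<And>t u v. N1 (fst (nonlinear_term f g \<phi> \<psi> t u v)) \<le> M"
      "\<And>t u v. N2 (snd (nonlinear_term f g \<phi> \<psi> t u v)) \<le> M"
    and lip: "\<And>t u v u' v'. N1 (fst (nonlinear_term f g \<phi> \<psi> t u v - nonlinear_term f g \<phi> \<psi> t u' v'))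
        \<le> \<omega> * (N1 (fst (u - u')) + N1 (fst (v - v')) + N2 (snd (u - u')) + N2 (snd (v - v')))"
      "\<And>t u v u' v'. N2 (snd (nonlinear_term f g \<phi> \<psi> t u v - nonlinear_term f g \<phi> \<psi> t u' v'))
        \<le> \<omega> * (N1 (fst (u - u')) + N1 (fst (v - v')) + N2 (snd (u - u')) + N2 (snd (v - v')))"
    and \<omega>: "0 \<le> \<omega>"
    and q: "8 * \<rho>1 * \<omega> * exp (\<alpha> * \<theta>) / \<alpha> \<le> q" "8 * K * \<rho>2 * \<omega> * exp (\<alpha> * \<theta>) / \<alpha> \<le> q" "q < 1"
  shows "\<exists>h. uniform_conjugacy P.flow L.flow h"
proof -
  let ?L = "linear_field A A0 B B0" and ?h = "nonlinear_term f g \<phi> \<psi>"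
  obtain C1 where C1: "C1 > 0" "\<And>x. norm x \<le> C1 * N1 x" using X.norm_le_N by auto
  obtain C2 where C2: "C2 > 0" "\<And>x. norm x \<le> C2 * N2 x" using Y.norm_le_N by auto
  obtain D1 where D1: "D1 > 0" "\<And>x. N1 x \<le> D1 * norm x" using X.N_le_norm by auto
  obtain D2 where D2: "D2 > 0" "\<And>x. N2 x \<le> D2 * norm x" using Y.N_le_norm by auto
  define W where "W = C1 * (2 * \<rho>1 * M * exp (\<alpha> * \<theta>) / \<alpha>) + C2 * (2 * K * \<rho>2 * M * exp (\<alpha> * \<theta>) / \<alpha>)"
  have q0: "0 \<le> q"
  proof -
    have "0 \<le> 8 * \<rho>1 * \<omega> * exp (\<alpha> * \<theta>) / \<alpha>" using X.rho_pos X.\<alpha> \<omega> by simp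
    then show ?thesis using q(1) by linarith
  qed
  have h_int: "(\<lambda>s. ?h s (z s) (z (\<gamma> s))) integrable_on {a..b}" if "continuous_on UNIV z" for z a b
  proof -
    have "(\<lambda>s. ?L s (z s) (z (\<gamma> s)) + ?h s (z s) (z (\<gamma> s)) - ?L s (z s) (z (\<gamma> s))) integrable_on {a..b}"
      by (intro integrable_diff P.field_along_integrable L.field_along_integrable that)
    then show ?thesis by simp
  qed
  have forced: "depca_solution T \<gamma> (\<lambda>t u v. ?L t u v + ?h t (P.flow t 0 x) (P.flow (\<gamma> t) 0 x)) (\<lambda>t. P.flow t 0 x)" for x
    using P.flow_solution[of 0 x] by (simp add: depca_solution_def)
  have bounded_diff: "\<exists>C. \<forall>t. N1 (fst (u t - v t)) \<le> C \<and> N2 (snd (u t - v t)) \<le> C"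
    if "\<And>t. norm (u t - y t) \<le> W" "\<And>t. norm (v t - y t) \<le> W" for u v y :: "real \<Rightarrow> (real^'n) \<times> (real^'m)"
  proof -
    have n: "norm (u t - v t) \<le> 2 * W" for t
      using norm_triangle_ineq4[of "u t - y t" "v t - y t"] that[of t] by simp
    have "N1 (fst (u t - v t)) \<le> D1 * (2 * W)" "N2 (snd (u t - v t)) \<le> D2 * (2 * W)" for t
      using order_trans[OF D1(2) mult_left_mono[OF order_trans[OF norm_fst_component n]]]
        order_trans[OF D2(2) mult_left_mono[OF order_trans[OF norm_snd_component n]]] D1(1) D2(1)
      by auto
    then show ?thesis by (intro exI[of _ "max (D1 * (2 * W)) (D2 * (2 * W))"]) (auto simp: le_max_iff_disj)
  qed
  show ?thesis
  proof (rule bounded_distance_conjugacy[where W = W])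
    show "evolution P.flow" "evolution L.flow" by unfold_locales
  next
    fix x
    let ?z = "\<lambda>t. P.flow t 0 x"
    obtain w where w: "depca_solution T \<gamma> (\<lambda>t u v. ?L t u v + ?h t (?z t) (?z (\<gamma> t))) w"
        "\<And>t. N1 (fst (w t)) \<le> 2 * \<rho>1 * M * exp (\<alpha> * \<theta>) / \<alpha>"
        "\<And>t. N2 (snd (w t)) \<le> 2 * K * \<rho>2 * M * exp (\<alpha> * \<theta>) / \<alpha>"
      by (rule bounded_forced_exists[of "\<lambda>t. ?h t (?z t) (?z (\<gamma> t))" M, OF h_int[OF P.flow_cont_time] M]) blast
    have "depca_solution T \<gamma> ?L (\<lambda>t. ?z t - w t)"
      by (rule depca_solution_diff[OF forced w(1)]) (simp add: linear_field_diff)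
    then have v: "L.flow t 0 (?z 0 - w 0) = ?z t - w t" for t by (rule L.flow_unique)
    have "norm (?z t - L.flow t 0 (?z 0 - w 0)) \<le> W" for t
    proof -
      have "norm (w t) \<le> norm (fst (w t)) + norm (snd (w t))"
        using norm_Pair_le[of "fst (w t)" "snd (w t)"] by simp
      also have "\<dots> \<le> W" unfolding W_def
        using order_trans[OF C1(2) mult_left_mono[OF w(2)]] order_trans[OF C2(2) mult_left_mono[OF w(3)]] C1(1) C2(1)
        by (intro add_mono) auto
      finally show ?thesis unfolding v by simp
    qed
    then show "\<exists>y. \<forall>t. norm (?z t - L.flow t 0 y) \<le> W" by blast
  next
    fix x y y'
    assume A: "\<And>t. norm (P.flow t 0 x - L.flow t 0 y) \<le> W" "\<And>t. norm (P.flow t 0 x - L.flow t 0 y') \<le> W"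
    let ?d = "\<lambda>t. L.flow t 0 y - L.flow t 0 y'"
    obtain C where C: "\<And>t. N1 (fst (?d t)) \<le> C" "\<And>t. N2 (snd (?d t)) \<le> C"
      using bounded_diff[of "\<lambda>t. L.flow t 0 y" "\<lambda>t. P.flow t 0 x" "\<lambda>t. L.flow t 0 y'"] A
      by (auto simp: norm_minus_commute)
    have "depca_solution T \<gamma> (\<lambda>t u v. ?L t u v + 0) ?d"
      by (rule depca_solution_diff[OF L.flow_solution L.flow_solution]) (simp add: linear_field_diff)
    from bounded_forced_estimate[OF this integrable_0 _ _ C, of 0 0]
    have "N1 (fst (?d 0)) \<le> 0" "N2 (snd (?d 0)) \<le> 0" by simp_all
    then show "y = y'" by (simp add: prod_eq_iff)
  next
    fix x x' y
    assume A: "\<And>t. norm (P.flow t 0 x - L.flow t 0 y) \<le> W" "\<And>t. norm (P.flow t 0 x' - L.flow t 0 y) \<le> W"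
    let ?z = "\<lambda>t. P.flow t 0 x" and ?z' = "\<lambda>t. P.flow t 0 x'"
    let ?d = "\<lambda>t. ?z t - ?z' t"
    let ?p = "\<lambda>t. ?h t (?z t) (?z (\<gamma> t)) - ?h t (?z' t) (?z' (\<gamma> t))"
    obtain C where C: "\<And>t. N1 (fst (?d t)) \<le> C" "\<And>t. N2 (snd (?d t)) \<le> C"
      using bounded_diff[of ?z "\<lambda>t. L.flow t 0 y" ?z'] A by auto
    have C0: "0 \<le> C" using C(1)[of 0] X.N_nonneg order_trans by blast
    have d: "depca_solution T \<gamma> (\<lambda>t u v. ?L t u v + ?p t) ?d"
      by (rule depca_solution_diff[OF forced forced]) (simp add: linear_field_diff)
    have p: "?p integrable_on {a..b}" for a b
      by (intro integrable_diff h_int P.flow_cont_time)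
    have "(\<forall>t. N1 (fst (?d t)) \<le> q ^ n * C) \<and> (\<forall>t. N2 (snd (?d t)) \<le> q ^ n * C)" for n
    proof (induction n)
      case 0
      then show ?case using C by simp
    next
      case (Suc n)
      define E where "E = q ^ n * C"
      have E: "\<And>t. N1 (fst (?d t)) \<le> E" "\<And>t. N2 (snd (?d t)) \<le> E" "0 \<le> E"
        using Suc q0 C0 by (auto simp: E_def)
      have sum: "\<omega> * (N1 (fst (?d t)) + N1 (fst (?d (\<gamma> t))) + N2 (snd (?d t)) + N2 (snd (?d (\<gamma> t)))) \<le> \<omega> * (4 * E)" for t
        using E(1)[of t] E(1)[of "\<gamma> t"] E(2)[of t] E(2)[of "\<gamma> t"] \<omega> by (intro mult_left_mono) linarith+
      have P: "N1 (fst (?p t)) \<le> \<omega> * (4 * E)" "N2 (snd (?p t)) \<le> \<omega> * (4 * E)" for t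
        using order_trans[OF lip(1) sum] order_trans[OF lip(2) sum] by blast+
      have "N1 (fst (?d t)) \<le> q * E" "N2 (snd (?d t)) \<le> q * E" for t
      proof -
        have "N1 (fst (?d t)) \<le> (8 * \<rho>1 * \<omega> * exp (\<alpha> * \<theta>) / \<alpha>) * E"
          using bounded_forced_estimate(1)[OF d p P E(1,2), of t] by (simp add: mult_ac)
        also have "\<dots> \<le> q * E" using q(1) E(3) by (rule mult_right_mono)
        finally show "N1 (fst (?d t)) \<le> q * E" .
        have "N2 (snd (?d t)) \<le> (8 * K * \<rho>2 * \<omega> * exp (\<alpha> * \<theta>) / \<alpha>) * E"
          using bounded_forced_estimate(2)[OF d p P E(1,2), of t] by (simp add: mult_ac)
        also have "\<dots> \<le> q * E" using q(2) E(3) by (rule mult_right_mono)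
        finally show "N2 (snd (?d t)) \<le> q * E" .
      qed
      then show ?case by (simp add: E_def mult.assoc)
    qed
    then have le: "N1 (fst (?d 0)) \<le> q ^ n * C" "N2 (snd (?d 0)) \<le> q ^ n * C" for n by blast+
    have lim: "(\<lambda>n. q ^ n * C) \<longlonglongrightarrow> 0"
      using LIMSEQ_power_zero[of q] q0 q(3) tendsto_mult_left_zero by fastforce
    have "N1 (fst (?d 0)) \<le> 0" by (rule LIMSEQ_le_const[OF lim]) (use le(1) in blast)
    moreover have "N2 (snd (?d 0)) \<le> 0" by (rule LIMSEQ_le_const[OF lim]) (use le(2) in blast)
    ultimately show "x = x'" by (simp add: prod_eq_iff)
  qed
qed

end

section \<open>Cutting off the unbounded terms\<close>

text \<open>
  The cut-off descends from \<open>1\<close> to \<open>0\<close> linearly in \<open>ln s\<close> with the small slope \<open>\<kappa>\<close>. Multiplying a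
  term of linear growth by it makes the term bounded, but increases the Lipschitz constant only by
  a multiple of \<open>\<kappa>\<close>.
\<close>

definition cutoff :: "real \<Rightarrow> real \<Rightarrow> real \<Rightarrow> real" where
  "cutoff \<kappa> R s = max 0 (1 - \<kappa> * ln (max s R / R))"

lemma cutoff_eq_1:
  assumes "0 < R" "s \<le> R"
  shows "cutoff \<kappa> R s = 1"
  using assms by (simp add: cutoff_def max_def)

lemma cutoff_range:
  assumes "0 < R" "0 < \<kappa>"
  shows "0 \<le> cutoff \<kappa> R s" "cutoff \<kappa> R s \<le> 1"
proof -
  have "0 \<le> ln (max s R / R)" using assms by (intro ln_ge_zero) simp
  then show "0 \<le> cutoff \<kappa> R s" "cutoff \<kappa> R s \<le> 1" using assms by (auto simp: cutoff_def)
qed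

lemma cutoff_times_le:
  assumes R: "0 < R" and \<kappa>: "0 < \<kappa>" and s: "0 \<le> s"
  shows "cutoff \<kappa> R s * s \<le> R * exp (1 / \<kappa>)"
proof (cases "s \<le> R * exp (1 / \<kappa>)")
  case True
  then show ?thesis using mult_left_le_one_le[OF s cutoff_range[OF R \<kappa>, of s]] by linarith
next
  case False
  then have "exp (1 / \<kappa>) \<le> max s R / R" using R by (simp add: pos_le_divide_eq mult.commute)
  then have "1 / \<kappa> \<le> ln (max s R / R)" using R by (subst ln_ge_iff) auto
  then have "1 \<le> \<kappa> * ln (max s R / R)" using \<kappa> by (simp add: field_simps)
  then show ?thesis using R by (simp add: cutoff_def)
qed

lemma cutoff_increment:
  assumes R: "0 < R" and \<kappa>: "0 < \<kappa>" and s: "0 \<le> s'" "s' \<le> s"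
  shows "\<bar>cutoff \<kappa> R s - cutoff \<kappa> R s'\<bar> * s' \<le> \<kappa> * (s - s')"
proof (cases "s' = 0")
  case False
  then have s': "0 < s'" using s by simp
  let ?m = "max s R" and ?m' = "max s' R"
  have m: "0 < ?m" "0 < ?m'" "?m' \<le> ?m" using R s by auto
  have "ln (?m / R) - ln (?m' / R) = ln (?m / ?m')" using m R by (simp add: ln_div)
  also have "\<dots> \<le> ?m / ?m' - 1" using m by (intro ln_le_minus_one) simp
  also have "\<dots> \<le> s / s' - 1"
  proof (cases "s \<le> R")
    case True
    then show ?thesis using s s' R by (simp add: max_def)
  next
    case False
    then show ?thesis using s s' by (auto simp: max_def intro: divide_left_mono)
  qed
  finally have ln: "ln (?m / R) - ln (?m' / R) \<le> s / s' - 1" .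
  have mono: "ln (?m' / R) \<le> ln (?m / R)" using m R by (simp add: divide_right_mono)
  have "\<bar>cutoff \<kappa> R s - cutoff \<kappa> R s'\<bar> \<le> \<kappa> * (ln (?m / R) - ln (?m' / R))"
    using mult_left_mono[OF mono, of \<kappa>] \<kappa> unfolding cutoff_def right_diff_distrib by linarith
  also have "\<dots> \<le> \<kappa> * (s / s' - 1)" using ln \<kappa> by (intro mult_left_mono) auto
  finally have "\<bar>cutoff \<kappa> R s - cutoff \<kappa> R s'\<bar> * s' \<le> \<kappa> * (s / s' - 1) * s'"
    using s' by (intro mult_right_mono) auto
  also have "\<dots> = \<kappa> * (s - s')" using s' by (simp add: field_simps)
  finally show ?thesis .
qed (use s \<kappa> in simp)

text \<open>
  At the point with the smaller argument \<open>s'\<close> the cut-off term is at most \<open>lam s'\<close>, which compensates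
  the slope \<open>\<kappa> / s'\<close> of the cut-off function. The rest is a convex combination of the differences
  with and without the term that is cut off, so the Lipschitz constant is not doubled.
\<close>

lemma (in normed) cutoff_difference:
  assumes R: "0 < R" and \<kappa>: "0 < \<kappa>" and s: "0 \<le> s" "0 \<le> s'" and lam: "0 \<le> lam"
    and a: "N a \<le> lam * s" "N a' \<le> lam * s'"
    and E: "N (a + b - (a' + b')) \<le> E" "N (b - b') \<le> E"
  shows "N (cutoff \<kappa> R s *\<^sub>R a + b - (cutoff \<kappa> R s' *\<^sub>R a' + b')) \<le> E + \<kappa> * lam * \<bar>s - s'\<bar>"
proof -
  have key: "N (cutoff \<kappa> R s *\<^sub>R a + b - (cutoff \<kappa> R s' *\<^sub>R a' + b')) \<le> E + \<kappa> * lam * \<bar>s - s'\<bar>"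
    if s: "0 \<le> s'" "s' \<le> s" and a': "N a' \<le> lam * s'"
      and E: "N (a + b - (a' + b')) \<le> E" "N (b - b') \<le> E" for s s' a a' b b'
  proof -
    let ?c = "cutoff \<kappa> R s" and ?c' = "cutoff \<kappa> R s'"
    have c: "0 \<le> ?c" "?c \<le> 1" using cutoff_range[OF R \<kappa>] by auto
    have eq: "?c *\<^sub>R a + b - (?c' *\<^sub>R a' + b')
        = (?c *\<^sub>R (a + b - (a' + b')) + (1 - ?c) *\<^sub>R (b - b')) + (?c - ?c') *\<^sub>R a'"
      by (simp add: algebra_simps)
    have "N (?c *\<^sub>R (a + b - (a' + b')) + (1 - ?c) *\<^sub>R (b - b')) \<le> ?c * E + (1 - ?c) * E"
      using N_triangle[of "?c *\<^sub>R (a + b - (a' + b'))" "(1 - ?c) *\<^sub>R (b - b')"]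
        mult_left_mono[OF E(1) c(1)] mult_left_mono[OF E(2), of "1 - ?c"] c by (simp add: N_scaleR)
    moreover have "N ((?c - ?c') *\<^sub>R a') \<le> \<kappa> * lam * (s - s')"
    proof -
      have "\<bar>?c - ?c'\<bar> * N a' \<le> \<bar>?c - ?c'\<bar> * (lam * s')" using a' by (intro mult_left_mono) auto
      also have "\<dots> = lam * (\<bar>?c - ?c'\<bar> * s')" by simp
      also have "\<dots> \<le> lam * (\<kappa> * (s - s'))" using cutoff_increment[OF R \<kappa> s] lam by (intro mult_left_mono)
      finally show ?thesis by (simp add: N_scaleR mult_ac)
    qed
    moreover have "?c * E + (1 - ?c) * E = E" by (simp add: algebra_simps)
    ultimately show ?thesis unfolding eq using s(2) order_trans[OF N_triangle add_mono] by fastforce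
  qed
  show ?thesis
  proof (cases "s' \<le> s")
    case True
    then show ?thesis using key[of s' s a' a b b'] s a E by blast
  next
    case False
    then show ?thesis
      using key[of s s' a a' b' b] s a E
      by (simp add: N_minus_commute[of "a' + b'"] N_minus_commute[of b'] abs_minus_commute
          N_minus_commute[of "cutoff \<kappa> R s' *\<^sub>R a' + b'"])
  qed
qed

text \<open>
  The form in which the estimate is used for the two blocks: \<open>x\<close> and \<open>y\<close> are the distances of the
  arguments of the term that is cut off and of the one that is kept.
\<close>

lemma (in normed) cutoff_lipschitz:
  assumes R: "0 < R" and \<kappa>: "0 < \<kappa>" "\<kappa> * lam \<le> \<epsilon>" and s: "0 \<le> s" "0 \<le> s'" and lam: "0 \<le> lam"
    and a: "N a \<le> lam * s" "N a' \<le> lam * s'" and \<omega>: "0 \<le> \<omega>" "0 \<le> \<epsilon>"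
    and diff: "N (a - a') \<le> \<omega> * x" "N (b - b') \<le> \<omega> * y" "\<bar>s - s'\<bar> \<le> x" "0 \<le> y"
  shows "N (cutoff \<kappa> R s *\<^sub>R a + b - (cutoff \<kappa> R s' *\<^sub>R a' + b')) \<le> (\<omega> + \<epsilon>) * (x + y)"
proof -
  have "0 \<le> x" using diff(3) by linarith
  then have nonneg: "0 \<le> \<omega> * x" "0 \<le> \<epsilon> * y" using \<omega> diff(4) by simp_all
  have "\<kappa> * lam * \<bar>s - s'\<bar> \<le> \<epsilon> * x" using \<kappa>(2) diff(3) \<omega>(2) by (intro mult_mono) auto
  moreover have "N (a + b - (a' + b')) \<le> \<omega> * x + \<omega> * y"
    using N_triangle[of "a - a'" "b - b'"] diff by (simp add: add_diff_add)
  then have "N (cutoff \<kappa> R s *\<^sub>R a + b - (cutoff \<kappa> R s' *\<^sub>R a' + b'))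
      \<le> \<omega> * x + \<omega> * y + \<kappa> * lam * \<bar>s - s'\<bar>"
    using diff(2) nonneg by (intro cutoff_difference[OF R \<kappa>(1) s lam a]) linarith+
  ultimately show ?thesis using nonneg by (simp add: algebra_simps)
qed

text \<open>
  The supremum is one of a bounded set, since the matrix norms are bounded and the cells have
  length at most \<open>\<theta>\<close>.
\<close>

lemma (in grid) rho_upper:
  assumes N: "vector_norm N" and A: "\<And>a b. A absolutely_integrable_on {a..b}"
    and bound: "\<And>t. matrix_norm N (A t) \<le> \<beta>"
  shows "exp (integral (cell i) (\<lambda>s. matrix_norm N (A s))) \<le> rho N T \<zeta> A"
proof -
  let ?k = "\<lambda>s. matrix_norm N (A s)"
  have k: "?k integrable_on {a..b}" for a b by (rule matrix_norm_integrable[OF N A bound])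
  have eq: "rho_plus N T \<zeta> A i * rho_minus N T \<zeta> A i = exp (integral (cell i) ?k)" for i
    unfolding rho_plus_def rho_minus_def exp_add[symmetric]
    using zeta_cell[of i] k by (subst Henstock_Kurzweil_Integration.integral_combine) auto
  have \<beta>: "0 \<le> \<beta>" using bound[of 0] matrix_norm_nonneg[OF N] order_trans by blast
  have le: "integral (cell i) ?k \<le> \<beta> * \<theta>" for i
  proof -
    have "integral (cell i) ?k \<le> integral (cell i) (\<lambda>_. \<beta>)"
      by (intro integral_le k) (auto simp: bound)
    also have "\<dots> = (T (i + 1) - T i) * \<beta>" using T_less[of i] by simp
    also have "\<dots> \<le> \<theta> * \<beta>" using cell_length[of i] \<beta> by (intro mult_right_mono) auto
    finally show ?thesis by (simp add: mult.commute)
  qed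
  have "bdd_above (range (\<lambda>i. exp (integral (cell i) ?k)))"
    using le by (intro bdd_aboveI2[of _ _ "exp (\<beta> * \<theta>)"]) simp
  then show ?thesis unfolding rho_def eq by (intro cSUP_upper) auto
qed

section \<open>Topological conjugacy\<close>

text \<open>
  The locale provides the flows for the Lipschitz constant \<open>l\<close>, while the perturbation itself has the
  smaller constant \<open>l - \<epsilon>\<close>. The margin \<open>\<epsilon>\<close> is spent on the cut-off, so that the cut-off system is an
  instance of the same locale.
\<close>

lemma (in perturbed) linearization:
  assumes \<epsilon>: "0 < \<epsilon>" and lam_pos: "0 < lam" and \<omega>: "0 \<le> \<omega>"
    and lip_h: "\<And>t z zb w wb. N (nonlinear_term f g \<phi> \<psi> t z zb - nonlinear_term f g \<phi> \<psi> t w wb)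
        \<le> (l - \<epsilon>) * (N (z - w) + N (zb - wb))"
    and lip_f: "\<And>t u v u' v'. N1 (f t u v - f t u' v') \<le> \<omega> * (N1 (u - u') + N1 (v - v'))"
    and lip_g: "\<And>t u v u' v'. N2 (g t u v - g t u' v') \<le> \<omega> * (N1 (u - u') + N1 (v - v'))"
    and lip_\<phi>: "\<And>t u v u' v'. N1 (\<phi> t u v - \<phi> t u' v') \<le> \<omega> * (N2 (u - u') + N2 (v - v'))"
    and lip_\<psi>: "\<And>t u v u' v'. N2 (\<psi> t u v - \<psi> t u' v') \<le> \<omega> * (N2 (u - u') + N2 (v - v'))"
    and small: "8 * K * \<rho>1 * (\<omega> + \<epsilon>) * exp (\<alpha> * \<theta>) / \<alpha> < 1" "8 * K * \<rho>2 * (\<omega> + \<epsilon>) * exp (\<alpha> * \<theta>) / \<alpha> < 1"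
  shows "topologically_conjugate
      (depca_solution T \<gamma> (\<lambda>t z zb. linear_field A A0 B B0 t z zb + nonlinear_term f g \<phi> \<psi> t z zb))
      (depca_solution T \<gamma> (linear_field A A0 B B0))"
proof -
  \<comment> \<open>The cut-off acts on the sum of two arguments, each of which is at most the absorbing radius.\<close>
  define R where "R = max 1 (2 * X.absorbing_radius \<delta>)"
  have R: "0 < R" "2 * X.absorbing_radius \<delta> \<le> R" by (auto simp: R_def)
  \<comment> \<open>The pair \<open>(f, g)\<close> has growth \<open>2 lam\<close>, so this slope costs \<open>\<epsilon>\<close> in the Lipschitz constant.\<close>
  define \<kappa> where "\<kappa> = \<epsilon> / (2 * lam)"
  have \<kappa>: "0 < \<kappa>" "\<kappa> * (2 * lam) = \<epsilon>" using \<epsilon> lam_pos by (auto simp: \<kappa>_def)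
  define cut where "cut x xb = cutoff \<kappa> R (N1 x + N1 xb)" for x xb
  have cut_range: "0 \<le> cut x xb" "cut x xb \<le> 1" for x xb
    using cutoff_range[OF R(1) \<kappa>(1)] by (auto simp: cut_def)
  define f' where "f' t x xb = cut x xb *\<^sub>R f t x xb" for t x xb
  define g' where "g' t x xb = cut x xb *\<^sub>R g t x xb" for t x xb
  have agree: "f' t x xb = f t x xb \<and> g' t x xb = g t x xb"
    if "N1 x + N1 xb \<le> 2 * X.absorbing_radius \<delta>" for t x xb
    using that cutoff_eq_1[OF R(1), of "N1 x + N1 xb"] R(2) by (simp add: f'_def g'_def cut_def)
  have abs_sum: "\<bar>N1 x + N1 xb - (N1 x' + N1 xb')\<bar> \<le> N1 (x - x') + N1 (xb - xb')" for x xb x' xb'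
    using X.N_triangle_sub[of x x'] X.N_triangle_sub[of x' x] X.N_triangle_sub[of xb xb']
      X.N_triangle_sub[of xb' xb] X.N_minus_commute[of x x'] X.N_minus_commute[of xb xb'] by linarith
  have growth_f': "N1 (f' t x xb) \<le> lam * (N1 x + N1 xb)"
    and growth_g': "N2 (g' t x xb) \<le> lam * (N1 x + N1 xb)" for t x xb
    using mult_left_le_one_le[OF X.N_nonneg[of "f t x xb"] cut_range(1,2)[of x xb]] growth_f[of t x xb]
      mult_left_le_one_le[OF Y.N_nonneg[of "g t x xb"] cut_range(1,2)[of x xb]] growth_g[of t x xb]
      cut_range(1)[of x xb]
    by (auto simp: f'_def g'_def X.N_scaleR Y.N_scaleR)
  have Q: "perturbed N1 N2 T \<zeta> \<gamma> \<theta> \<beta> \<beta>0 l A A0 Z1 B B0 Z2 K \<alpha> \<rho>1 \<rho>2 N f' g' \<phi> \<psi> lam \<delta>"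
  proof unfold_locales
    show "(\<lambda>t. f' t x xb) integrable_on {a..b}" "(\<lambda>t. g' t x xb) integrable_on {a..b}" for x xb a b
      unfolding f'_def g'_def by (intro integrable_cmul f_integrable g_integrable)+
  next
    fix t :: real and z zb w wb :: "(real^'n) \<times> (real^'m)"
    obtain x y xb yb where z: "z = (x, y)" "zb = (xb, yb)" by fastforce
    obtain x' y' xb' yb' where w: "w = (x', y')" "wb = (xb', yb')" by fastforce
    let ?s = "N1 x + N1 xb" and ?s' = "N1 x' + N1 xb'"
    let ?a = "(f t x xb, g t x xb)" and ?a' = "(f t x' xb', g t x' xb')"
    let ?b = "(\<phi> t y yb, \<psi> t y yb)" and ?b' = "(\<phi> t y' yb', \<psi> t y' yb')"
    let ?D = "N (z - w) + N (zb - wb)"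
    \<comment> \<open>A Lipschitz constant on a nontrivial space cannot be negative.\<close>
    have l\<epsilon>: "0 \<le> l - \<epsilon>"
    proof (rule ccontr)
      obtain v :: "real^'n" where v: "v \<noteq> 0" using zero_neq_one by blast
      have pos: "0 < N ((v, 0) - 0)" using v NN.N_nonneg[of "(v, 0)"] NN.N_eq_0[of "(v, 0)"]
        by (simp add: zero_prod_def order_less_le)
      assume "\<not> 0 \<le> l - \<epsilon>"
      then have "(l - \<epsilon>) * (N ((v, 0) - 0) + N ((0 :: (real^'n) \<times> (real^'m)) - 0)) < 0"
        using pos by (simp add: mult_neg_pos)
      then show False
        using lip_h[of t "(v, 0)" 0 0 0] NN.N_nonneg order_trans by (meson not_le)
    qed
    have "N (cutoff \<kappa> R ?s *\<^sub>R ?a + ?b - (cutoff \<kappa> R ?s' *\<^sub>R ?a' + ?b'))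
        \<le> (l - \<epsilon>) * ?D + \<kappa> * (2 * lam) * \<bar>?s - ?s'\<bar>"
    proof (rule NN.cutoff_difference[OF R(1) \<kappa>(1)])
      show "N ?a \<le> 2 * lam * ?s" "N ?a' \<le> 2 * lam * ?s'"
        using N_le_sum[of "f t x xb" "g t x xb"] growth_f[of t x xb] growth_g[of t x xb]
          N_le_sum[of "f t x' xb'" "g t x' xb'"] growth_f[of t x' xb'] growth_g[of t x' xb'] by auto
      show "N (?a + ?b - (?a' + ?b')) \<le> (l - \<epsilon>) * ?D"
        using lip_h[of t z zb w wb] by (simp add: z w nonlinear_term_def)
      \<comment> \<open>For \<open>x = 0\<close> in both arguments the terms \<open>f\<close> and \<open>g\<close> cancel.\<close>
      have "N (?b - ?b') \<le> (l - \<epsilon>) * (N ((0, y) - (0, y')) + N ((0, yb) - (0, yb')))"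
        using lip_h[of t "(0, y)" "(0, yb)" "(0, y')" "(0, yb')"] by (simp add: nonlinear_term_def)
      also have "\<dots> \<le> (l - \<epsilon>) * ?D"
        using l\<epsilon> by (intro mult_left_mono add_mono) (auto simp: z w intro!: N_mono)
      finally show "N (?b - ?b') \<le> (l - \<epsilon>) * ?D" .
    qed (use lam in auto)
    also have "\<kappa> * (2 * lam) * \<bar>?s - ?s'\<bar> \<le> \<epsilon> * ?D"
      unfolding \<kappa>(2)
    proof (rule mult_left_mono)
      show "\<bar>?s - ?s'\<bar> \<le> ?D"
        using abs_sum[of x xb x' xb'] N1_le[of "x - x'" "y - y'"] N1_le[of "xb - xb'" "yb - yb'"]
        by (simp add: z w)
    qed (use \<epsilon> in simp)
    finally show "N (nonlinear_term f' g' \<phi> \<psi> t z zb - nonlinear_term f' g' \<phi> \<psi> t w wb) \<le> l * ?D"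
      by (simp add: z w nonlinear_term_def f'_def g'_def cut_def algebra_simps)
  qed (use growth_f' growth_g' \<phi>_integrable \<psi>_integrable bound_\<phi> bound_\<psi> lam in auto)
  interpret Q: perturbed N1 N2 T \<zeta> \<gamma> \<theta> \<beta> \<beta>0 l A A0 Z1 B B0 Z2 K \<alpha> \<rho>1 \<rho>2 N f' g' \<phi> \<psi> lam \<delta>
    by (rule Q)
  have evo: "evolution P.flow" "evolution Q.P.flow" "evolution L.flow" by unfold_locales
  have "\<exists>h. uniform_conjugacy P.flow Q.P.flow h"
  proof (rule eventually_common_orbits_conjugacy[OF evo(1,2)])
    show "\<exists>S\<ge>0. \<forall>t x s s'. norm x \<le> r \<longrightarrow> t + S \<le> s \<longrightarrow> s \<le> s' \<longrightarrow> Q.P.flow s' s (P.flow s t x) = P.flow s' t x" for r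
      by (rule eventually_orbits_of_other_system[OF Q agree])
    show "\<exists>S\<ge>0. \<forall>t x s s'. norm x \<le> r \<longrightarrow> t + S \<le> s \<longrightarrow> s \<le> s' \<longrightarrow> P.flow s' s (Q.P.flow s t x) = Q.P.flow s' t x" for r
      by (rule Q.eventually_orbits_of_other_system[OF perturbed_axioms]) (use agree in auto)
  qed
  then obtain h where h: "uniform_conjugacy P.flow Q.P.flow h" by blast
  define q where "q = max (8 * K * \<rho>1 * (\<omega> + \<epsilon>) * exp (\<alpha> * \<theta>) / \<alpha>) (8 * K * \<rho>2 * (\<omega> + \<epsilon>) * exp (\<alpha> * \<theta>) / \<alpha>)"
  have "\<exists>k. uniform_conjugacy Q.P.flow L.flow k"
  proof (rule Q.bounded_perturbation_conjugacy)
    fix t :: real and u v :: "(real^'n) \<times> (real^'m)"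
    let ?x = "fst u" and ?xb = "fst v"
    have cut_le: "cut ?x ?xb * (lam * (N1 ?x + N1 ?xb)) \<le> lam * (R * exp (1 / \<kappa>))"
      using mult_left_mono[OF cutoff_times_le[OF R(1) \<kappa>(1), of "N1 ?x + N1 ?xb"] lam(1)]
      by (simp add: cut_def mult_ac)
    have "N1 (f' t ?x ?xb) \<le> lam * (R * exp (1 / \<kappa>))" "N2 (g' t ?x ?xb) \<le> lam * (R * exp (1 / \<kappa>))"
      using order_trans[OF mult_left_mono[OF growth_f cut_range(1)] cut_le] order_trans[OF mult_left_mono[OF growth_g cut_range(1)] cut_le] cut_range
      by (auto simp: f'_def g'_def X.N_scaleR Y.N_scaleR)
    then show "N1 (fst (nonlinear_term f' g' \<phi> \<psi> t u v)) \<le> lam * (R * exp (1 / \<kappa>)) + \<delta>"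
      "N2 (snd (nonlinear_term f' g' \<phi> \<psi> t u v)) \<le> lam * (R * exp (1 / \<kappa>)) + \<delta>"
      using X.N_triangle[of "f' t ?x ?xb" "\<phi> t (snd u) (snd v)"] bound_\<phi>[of t "snd u" "snd v"]
        Y.N_triangle[of "g' t ?x ?xb" "\<psi> t (snd u) (snd v)"] bound_\<psi>[of t "snd u" "snd v"]
      by (auto simp: nonlinear_term_def split_def)
  next
    fix t :: real and u v u' v' :: "(real^'n) \<times> (real^'m)"
    obtain x y xb yb where u: "u = (x, y)" "v = (xb, yb)" by fastforce
    obtain x' y' xb' yb' where u': "u' = (x', y')" "v' = (xb', yb')" by fastforce
    let ?s = "N1 x + N1 xb" and ?s' = "N1 x' + N1 xb'"
    let ?X = "N1 (x - x') + N1 (xb - xb')" and ?Y = "N2 (y - y') + N2 (yb - yb')"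
    have \<kappa>lam: "\<kappa> * lam \<le> \<epsilon>" using \<kappa>(2) \<epsilon> by linarith
    have "N1 (cutoff \<kappa> R ?s *\<^sub>R f t x xb + \<phi> t y yb - (cutoff \<kappa> R ?s' *\<^sub>R f t x' xb' + \<phi> t y' yb'))
        \<le> (\<omega> + \<epsilon>) * (?X + ?Y)"
      by (rule X.cutoff_lipschitz[OF R(1) \<kappa>(1) \<kappa>lam _ _ lam(1) growth_f growth_f \<omega> _ lip_f lip_\<phi> abs_sum])
        (use \<epsilon> in simp_all)
    then show "N1 (fst (nonlinear_term f' g' \<phi> \<psi> t u v - nonlinear_term f' g' \<phi> \<psi> t u' v'))
        \<le> (\<omega> + \<epsilon>) * (N1 (fst (u - u')) + N1 (fst (v - v')) + N2 (snd (u - u')) + N2 (snd (v - v')))"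
      by (simp add: u u' nonlinear_term_def f'_def cut_def add.assoc)
    have "N2 (cutoff \<kappa> R ?s *\<^sub>R g t x xb + \<psi> t y yb - (cutoff \<kappa> R ?s' *\<^sub>R g t x' xb' + \<psi> t y' yb'))
        \<le> (\<omega> + \<epsilon>) * (?X + ?Y)"
      by (rule Y.cutoff_lipschitz[OF R(1) \<kappa>(1) \<kappa>lam _ _ lam(1) growth_g growth_g \<omega> _ lip_g lip_\<psi> abs_sum])
        (use \<epsilon> in simp_all)
    then show "N2 (snd (nonlinear_term f' g' \<phi> \<psi> t u v - nonlinear_term f' g' \<phi> \<psi> t u' v'))
        \<le> (\<omega> + \<epsilon>) * (N1 (fst (u - u')) + N1 (fst (v - v')) + N2 (snd (u - u')) + N2 (snd (v - v')))"
      by (simp add: u u' nonlinear_term_def g'_def cut_def add.assoc)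
  next
    have "8 * \<rho>1 * (\<omega> + \<epsilon>) * exp (\<alpha> * \<theta>) / \<alpha> * 1 \<le> 8 * \<rho>1 * (\<omega> + \<epsilon>) * exp (\<alpha> * \<theta>) / \<alpha> * K"
      using Y.K X.rho_pos X.\<alpha> \<omega> \<epsilon> by (intro mult_left_mono) auto
    then have "8 * \<rho>1 * (\<omega> + \<epsilon>) * exp (\<alpha> * \<theta>) / \<alpha> \<le> 8 * K * \<rho>1 * (\<omega> + \<epsilon>) * exp (\<alpha> * \<theta>) / \<alpha>"
      by (simp add: mult_ac)
    then show "8 * \<rho>1 * (\<omega> + \<epsilon>) * exp (\<alpha> * \<theta>) / \<alpha> \<le> q" by (simp add: q_def le_max_iff_disj)
    show "8 * K * \<rho>2 * (\<omega> + \<epsilon>) * exp (\<alpha> * \<theta>) / \<alpha> \<le> q" by (simp add: q_def)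
    show "q < 1" using small by (simp add: q_def)
  qed (use \<omega> \<epsilon> in simp)
  then obtain k where k: "uniform_conjugacy Q.P.flow L.flow k" by blast
  show ?thesis
    by (rule uniform_conjugacy_imp_topologically_conjugate[OF evo(1,3) uniform_conjugacy_trans[OF evo h k]])
      (auto simp: P.flow_unique L.flow_unique P.flow_solution L.flow_solution)
qed

theorem theorem2:
  fixes N\<^sub>1 :: "real^'n \<Rightarrow> real" and N\<^sub>2 :: "real^'m \<Rightarrow> real"
    and N :: "(real^'n) \<times> (real^'m) \<Rightarrow> real"
    and A A\<^sub>0 :: "real \<Rightarrow> real^'n^'n" and B B\<^sub>0 :: "real \<Rightarrow> real^'m^'m"
    and f :: "real \<Rightarrow> real^'n \<Rightarrow> real^'n \<Rightarrow> real^'n"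
    and g :: "real \<Rightarrow> real^'n \<Rightarrow> real^'n \<Rightarrow> real^'m"
    and \<phi> :: "real \<Rightarrow> real^'m \<Rightarrow> real^'m \<Rightarrow> real^'n"
    and \<psi> :: "real \<Rightarrow> real^'m \<Rightarrow> real^'m \<Rightarrow> real^'m"
    and T \<zeta> :: "int \<Rightarrow> real" and \<gamma> :: "real \<Rightarrow> real"
    and Z\<^sub>1 :: "real \<Rightarrow> real \<Rightarrow> real^'n^'n" and Z\<^sub>2 :: "real \<Rightarrow> real \<Rightarrow> real^'m^'m"
    and \<theta> \<beta> \<beta>\<^sub>0 \<delta> lam \<omega> l \<nu>p \<nu>m K \<alpha> :: real
  assumes norms: "product_vector_norm N\<^sub>1 N\<^sub>2 N"
    \<comment> \<open>local integrability in time\<close>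
    and int_A: "\<And>a b. A absolutely_integrable_on {a..b}"
    and int_A0: "\<And>a b. A\<^sub>0 absolutely_integrable_on {a..b}"
    and int_B: "\<And>a b. B absolutely_integrable_on {a..b}"
    and int_B0: "\<And>a b. B\<^sub>0 absolutely_integrable_on {a..b}"
    and int_f: "\<And>x xb a b. (\<lambda>t. f t x xb) absolutely_integrable_on {a..b}"
    and int_g: "\<And>x xb a b. (\<lambda>t. g t x xb) absolutely_integrable_on {a..b}"
    and int_\<phi>: "\<And>y yb a b. (\<lambda>t. \<phi> t y yb) absolutely_integrable_on {a..b}"
    and int_\<psi>: "\<And>y yb a b. (\<lambda>t. \<psi> t y yb) absolutely_integrable_on {a..b}"
    \<comment> \<open>condition (A)\<close>
    and cond_A: "piecewise_constant_argument T \<zeta> \<gamma> \<theta>"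
    \<comment> \<open>condition (B)\<close>
    and pos: "\<beta> > 0" "\<beta>\<^sub>0 > 0" "\<delta> > 0" "lam > 0" "\<omega> > 0"
    and bound_A: "\<And>t. matrix_norm N\<^sub>1 (A t) \<le> \<beta>"
    and bound_B: "\<And>t. matrix_norm N\<^sub>2 (B t) \<le> \<beta>"
    and bound_A0: "\<And>t. matrix_norm N\<^sub>1 (A\<^sub>0 t) \<le> \<beta>\<^sub>0"
    and bound_B0: "\<And>t. matrix_norm N\<^sub>2 (B\<^sub>0 t) \<le> \<beta>\<^sub>0"
    and growth_f: "\<And>t x xb. N\<^sub>1 (f t x xb) \<le> lam * (N\<^sub>1 x + N\<^sub>1 xb)"
    and growth_g: "\<And>t x xb. N\<^sub>2 (g t x xb) \<le> lam * (N\<^sub>1 x + N\<^sub>1 xb)"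
    and bound_\<phi>: "\<And>t y yb. N\<^sub>1 (\<phi> t y yb) \<le> \<delta>"
    and bound_\<psi>: "\<And>t y yb. N\<^sub>2 (\<psi> t y yb) \<le> \<delta>"
    and lipschitz_f: "\<And>t u1 v1 u2 v2.
          N\<^sub>1 (f t u1 v1 - f t u2 v2) \<le> \<omega> * (N\<^sub>1 (u1 - u2) + N\<^sub>1 (v1 - v2))"
    and lipschitz_g: "\<And>t u1 v1 u2 v2.
          N\<^sub>2 (g t u1 v1 - g t u2 v2) \<le> \<omega> * (N\<^sub>1 (u1 - u2) + N\<^sub>1 (v1 - v2))"
    and lipschitz_\<phi>: "\<And>t u1 v1 u2 v2.
          N\<^sub>1 (\<phi> t u1 v1 - \<phi> t u2 v2) \<le> \<omega> * (N\<^sub>2 (u1 - u2) + N\<^sub>2 (v1 - v2))"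
    and lipschitz_\<psi>: "\<And>t u1 v1 u2 v2.
          N\<^sub>2 (\<psi> t u1 v1 - \<psi> t u2 v2) \<le> \<omega> * (N\<^sub>2 (u1 - u2) + N\<^sub>2 (v1 - v2))"
    \<comment> \<open>the Lipschitz constant of the whole nonlinear term\<close>
    and l_pos: "l > 0"
    and lipschitz_h: "\<And>t z zb w wb.
          N (nonlinear_term f g \<phi> \<psi> t z zb - nonlinear_term f g \<phi> \<psi> t w wb)
            \<le> l * (N (z - w) + N (zb - wb))"
    \<comment> \<open>condition (C)\<close>
    and \<nu>p: "0 < \<nu>p" "\<nu>p < 1" and \<nu>m: "0 < \<nu>m" "\<nu>m < 1"
    and cond_C_A: "\<And>i. rho_plus N\<^sub>1 T \<zeta> A i * ln (rho_plus N\<^sub>1 T \<zeta> A\<^sub>0 i) \<le> \<nu>p"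
                  "\<And>i. rho_minus N\<^sub>1 T \<zeta> A i * ln (rho_minus N\<^sub>1 T \<zeta> A\<^sub>0 i) \<le> \<nu>m"
    and cond_C_B: "\<And>i. rho_plus N\<^sub>2 T \<zeta> B i * ln (rho_plus N\<^sub>2 T \<zeta> B\<^sub>0 i) \<le> \<nu>p"
                  "\<And>i. rho_minus N\<^sub>2 T \<zeta> B i * ln (rho_minus N\<^sub>2 T \<zeta> B\<^sub>0 i) \<le> \<nu>m"
    \<comment> \<open>condition (D)\<close>
    and Z\<^sub>1: "transition_matrix T \<gamma> A A\<^sub>0 Z\<^sub>1"
    and Z\<^sub>2: "transition_matrix T \<gamma> B B\<^sub>0 Z\<^sub>2"
    and K: "K \<ge> 1" and \<alpha>: "\<alpha> > 0"
    and decay_Z\<^sub>1: "\<And>t s. t \<ge> s \<Longrightarrow> matrix_norm N\<^sub>1 (Z\<^sub>1 t s) \<le> exp (- \<alpha> * (t - s))"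
    and decay_Z\<^sub>2: "\<And>t s. s > t \<Longrightarrow> matrix_norm N\<^sub>2 (Z\<^sub>2 t s) \<le> K * exp (\<alpha> * (t - s))"
    \<comment> \<open>smallness conditions\<close>
    and small_\<omega>_A: "8 * K * rho_tilde N\<^sub>1 T \<zeta> \<nu>p \<nu>m \<alpha> \<theta> A * \<omega> / \<alpha> < 1"
    and small_\<omega>_B: "8 * K * rho_tilde N\<^sub>2 T \<zeta> \<nu>p \<nu>m \<alpha> \<theta> B * \<omega> / \<alpha> < 1"
    and small_lam_A: "16 * K * rho_tilde N\<^sub>1 T \<zeta> \<nu>p \<nu>m \<alpha> \<theta> A * lam / \<alpha> < 1"
    and small_lam_B: "16 * K * rho_tilde N\<^sub>2 T \<zeta> \<nu>p \<nu>m \<alpha> \<theta> B * lam / \<alpha> < 1"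
    and \<alpha>0_pos: "\<alpha> - 2 * \<omega> * rho_tilde N\<^sub>1 T \<zeta> \<nu>p \<nu>m \<alpha> \<theta> A * exp (\<alpha> * \<theta>) > 0"
    and small_F: "F_factor \<beta> l \<theta> * (\<beta>\<^sub>0 + l) * \<theta> < 1"
  shows "topologically_conjugate
           (depca_solution T \<gamma>
              (\<lambda>t z zb. linear_field A A\<^sub>0 B B\<^sub>0 t z zb + nonlinear_term f g \<phi> \<psi> t z zb))
           (depca_solution T \<gamma> (linear_field A A\<^sub>0 B B\<^sub>0))"
proof -
  have vn: "vector_norm N\<^sub>1" "vector_norm N\<^sub>2" using norms by (auto simp: product_vector_norm_def)
  interpret grid T \<zeta> \<gamma> \<theta> by unfold_locales (rule cond_A)
  define e where "e = exp (\<alpha> * \<theta>)"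
  define \<rho>1 where "\<rho>1 = rho N\<^sub>1 T \<zeta> A"
  define \<rho>2 where "\<rho>2 = rho N\<^sub>2 T \<zeta> B"
  have \<rho>: "exp (integral (cell i) (\<lambda>s. matrix_norm N\<^sub>1 (A s))) \<le> \<rho>1"
      "exp (integral (cell i) (\<lambda>s. matrix_norm N\<^sub>2 (B s))) \<le> \<rho>2" for i
    unfolding \<rho>1_def \<rho>2_def
    by (rule rho_upper[OF vn(1) int_A bound_A] rho_upper[OF vn(2) int_B bound_B])+
  have \<rho>_pos: "0 < \<rho>1" "0 < \<rho>2"
    using \<rho>[of 0] exp_gt_zero less_le_trans by blast+
  have tilde: "\<rho>1 * e \<le> rho_tilde N\<^sub>1 T \<zeta> \<nu>p \<nu>m \<alpha> \<theta> A" "\<rho>2 * e \<le> rho_tilde N\<^sub>2 T \<zeta> \<nu>p \<nu>m \<alpha> \<theta> B"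
    by (auto simp: rho_tilde_def \<rho>1_def \<rho>2_def e_def)
  have scale: "c * K * r * d / \<alpha> < 1"
    if "r \<le> r'" "c * K * r' * d / \<alpha> < 1" "0 \<le> c" "0 \<le> d" for c r r' d :: real
  proof -
    have "c * K * r * d / \<alpha> \<le> c * K * r' * d / \<alpha>"
      using that K \<alpha> by (intro divide_right_mono mult_right_mono mult_left_mono) auto
    then show ?thesis using that(2) by linarith
  qed
  have small_\<omega>: "8 * K * (\<rho>1 * e) * \<omega> / \<alpha> < 1" "8 * K * (\<rho>2 * e) * \<omega> / \<alpha> < 1"
    using scale[OF tilde(1) small_\<omega>_A] scale[OF tilde(2) small_\<omega>_B] pos by auto
  have small_lam: "16 * \<rho>1 * exp (\<alpha> * \<theta>) * lam / \<alpha> < 1"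
  proof -
    have "16 * (\<rho>1 * e) * lam / \<alpha> * 1 \<le> 16 * (\<rho>1 * e) * lam / \<alpha> * K"
      using K \<rho>_pos pos \<alpha> by (intro mult_left_mono) (auto simp: e_def)
    moreover have "16 * K * (\<rho>1 * e) * lam / \<alpha> < 1"
      using scale[OF tilde(1) small_lam_A] pos by auto
    ultimately show ?thesis by (simp add: e_def mult_ac)
  qed
  have small_l: "(\<beta>\<^sub>0 + l) * (exp ((\<beta> + l) * \<theta>) - 1) / (\<beta> + l) < 1"
  proof -
    have "F_factor \<beta> l \<theta> * (\<beta>\<^sub>0 + l) * \<theta> = (\<beta>\<^sub>0 + l) * (exp ((\<beta> + l) * \<theta>) - 1) / (\<beta> + l)"
      using \<theta> by (simp add: F_factor_def)
    then show ?thesis using small_F by simp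
  qed
  \<comment> \<open>All smallness conditions are strict, which leaves room for the cut-off.\<close>
  have "\<forall>\<^sub>F \<epsilon> in at_right 0. (\<beta>\<^sub>0 + (l + \<epsilon>)) * (exp ((\<beta> + (l + \<epsilon>)) * \<theta>) - 1) / (\<beta> + (l + \<epsilon>)) < 1"
  proof (rule order_tendstoD(2))
    show "((\<lambda>\<epsilon>. (\<beta>\<^sub>0 + (l + \<epsilon>)) * (exp ((\<beta> + (l + \<epsilon>)) * \<theta>) - 1) / (\<beta> + (l + \<epsilon>)))
        \<longlongrightarrow> (\<beta>\<^sub>0 + (l + 0)) * (exp ((\<beta> + (l + 0)) * \<theta>) - 1) / (\<beta> + (l + 0))) (at_right 0)"
      using pos l_pos by (intro tendsto_intros) auto
  qed (use small_l in simp)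
  moreover have "\<forall>\<^sub>F \<epsilon> in at_right 0. 8 * K * (\<rho>1 * e) * (\<omega> + \<epsilon>) / \<alpha> < 1"
  proof (rule order_tendstoD(2))
    show "((\<lambda>\<epsilon>. 8 * K * (\<rho>1 * e) * (\<omega> + \<epsilon>) / \<alpha>) \<longlongrightarrow> 8 * K * (\<rho>1 * e) * (\<omega> + 0) / \<alpha>) (at_right 0)"
      using \<alpha> by (intro tendsto_intros) auto
  qed (use small_\<omega> in simp)
  moreover have "\<forall>\<^sub>F \<epsilon> in at_right 0. 8 * K * (\<rho>2 * e) * (\<omega> + \<epsilon>) / \<alpha> < 1"
  proof (rule order_tendstoD(2))
    show "((\<lambda>\<epsilon>. 8 * K * (\<rho>2 * e) * (\<omega> + \<epsilon>) / \<alpha>) \<longlongrightarrow> 8 * K * (\<rho>2 * e) * (\<omega> + 0) / \<alpha>) (at_right 0)"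
      using \<alpha> by (intro tendsto_intros) auto
  qed (use small_\<omega> in simp)
  moreover have "\<forall>\<^sub>F \<epsilon>::real in at_right 0. 0 < \<epsilon>" by (rule eventually_at_right_less)
  ultimately have "\<forall>\<^sub>F \<epsilon> in at_right 0. 0 < \<epsilon>
      \<and> (\<beta>\<^sub>0 + (l + \<epsilon>)) * (exp ((\<beta> + (l + \<epsilon>)) * \<theta>) - 1) / (\<beta> + (l + \<epsilon>)) < 1
      \<and> 8 * K * (\<rho>1 * e) * (\<omega> + \<epsilon>) / \<alpha> < 1 \<and> 8 * K * (\<rho>2 * e) * (\<omega> + \<epsilon>) / \<alpha> < 1"
    by eventually_elim blast
  then obtain \<epsilon> where \<epsilon>: "0 < \<epsilon>"
      "(\<beta>\<^sub>0 + (l + \<epsilon>)) * (exp ((\<beta> + (l + \<epsilon>)) * \<theta>) - 1) / (\<beta> + (l + \<epsilon>)) < 1"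
      "8 * K * (\<rho>1 * e) * (\<omega> + \<epsilon>) / \<alpha> < 1" "8 * K * (\<rho>2 * e) * (\<omega> + \<epsilon>) / \<alpha> < 1"
    using eventually_happens'[OF trivial_limit_at_right_real] by blast
  \<comment> \<open>The estimate for the expanding block extends to equal times, where \<open>Z\<^sub>2\<close> is the identity.\<close>
  have Z2_refl: "matrix_norm N\<^sub>2 (Z\<^sub>2 s s) \<le> K" for s
  proof (rule matrix_norm_least[OF vn(2)])
    fix x
    have "1 * N\<^sub>2 x \<le> K * N\<^sub>2 x"
      using K vn(2) by (intro mult_right_mono) (auto simp: vector_norm_def)
    then show "N\<^sub>2 (Z\<^sub>2 s s *v x) \<le> K * N\<^sub>2 x" using Z\<^sub>2 by (simp add: transition_matrix_def)
  qed (use K in simp)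
  interpret perturbed N\<^sub>1 N\<^sub>2 T \<zeta> \<gamma> \<theta> \<beta> \<beta>\<^sub>0 "l + \<epsilon>" A A\<^sub>0 Z\<^sub>1 B B\<^sub>0 Z\<^sub>2 K \<alpha> \<rho>1 \<rho>2 N f g \<phi> \<psi> lam \<delta>
  proof unfold_locales
    show "matrix_norm N\<^sub>1 (A t) \<le> \<beta> + (l + \<epsilon>)" "matrix_norm N\<^sub>1 (A\<^sub>0 t) \<le> \<beta>\<^sub>0 + (l + \<epsilon>)"
      "matrix_norm N\<^sub>2 (B t) \<le> \<beta> + (l + \<epsilon>)" "matrix_norm N\<^sub>2 (B\<^sub>0 t) \<le> \<beta>\<^sub>0 + (l + \<epsilon>)" for t
      using bound_A[of t] bound_A0[of t] bound_B[of t] bound_B0[of t] l_pos \<epsilon>(1) by auto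
    show "matrix_norm N\<^sub>1 (Z\<^sub>1 t s) \<le> 1 * exp (- \<alpha> * \<bar>t - s\<bar>)" if "0 \<le> 1 * (t - s)" for t s
      using decay_Z\<^sub>1[of s t] that by simp
    show "matrix_norm N\<^sub>2 (Z\<^sub>2 t s) \<le> K * exp (- \<alpha> * \<bar>t - s\<bar>)" if "0 \<le> - 1 * (t - s)" for t s
      using decay_Z\<^sub>2[of t s] Z2_refl[of s] that by (cases "t = s") (auto simp: algebra_simps)
    show "N (nonlinear_term f g \<phi> \<psi> t z zb - nonlinear_term f g \<phi> \<psi> t w wb)
        \<le> (l + \<epsilon>) * (N (z - w) + N (zb - wb))" for t z zb w wb
    proof -
      have "0 \<le> N v" for v
        using norms unfolding product_vector_norm_def vector_norm_def by blast
      then have "l * (N (z - w) + N (zb - wb)) \<le> (l + \<epsilon>) * (N (z - w) + N (zb - wb))"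
        using \<epsilon>(1) by (intro mult_right_mono add_nonneg_nonneg) auto
      then show ?thesis using lipschitz_h[of t z zb w wb] by linarith
    qed
  qed (use vn \<theta> \<rho> int_A int_A0 int_B int_B0 Z\<^sub>1 Z\<^sub>2 K \<alpha> norms pos l_pos \<epsilon>(1,2) bound_A bound_A0 bound_B bound_B0
      growth_f growth_g bound_\<phi> bound_\<psi> small_lam
      set_lebesgue_integral_eq_integral(1)[OF int_f] set_lebesgue_integral_eq_integral(1)[OF int_g]
      set_lebesgue_integral_eq_integral(1)[OF int_\<phi>] set_lebesgue_integral_eq_integral(1)[OF int_\<psi>] in auto)
  have "8 * K * \<rho>1 * (\<omega> + \<epsilon>) * exp (\<alpha> * \<theta>) / \<alpha> < 1" "8 * K * \<rho>2 * (\<omega> + \<epsilon>) * exp (\<alpha> * \<theta>) / \<alpha> < 1"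
    using \<epsilon>(3,4) by (simp_all only: e_def mult_ac)
  from linearization[OF \<epsilon>(1) pos(4) less_imp_le[OF pos(5)] _ lipschitz_f lipschitz_g lipschitz_\<phi> lipschitz_\<psi> this]
  show ?thesis using lipschitz_h by simp
qed

end
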